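(* Let $\alpha>1$, $\sigma\in(0,1)$ and $\bar h_0>0$ be fixed. There exist $\varepsilon_0>0$ and constants $c,C>0$ such that for all $\varepsilon\in(0,\varepsilon_0)$ and all initial values $h_0\in H^1(S^1)$ with $h_0(\theta)>0$ for all $\theta\in S^1$, $$\frac1{2\pi}\int_{S^1}h_0\,d\theta=\bar h_0\quad\text{and}\quad\|h_0-\bar h_0\|_{H^1(S^1)}\le\varepsilon,$$ the corresponding local solution $h$ of the regularised problem $(P_\sigma)$ satisfies $$\bigl\|h(t,\theta)-\bigl(\bar h_0+h_{-1}(t)e^{-i\theta}+h_1(t)e^{i\theta}\bigr)\bigr\|_{C([\bar t/4,\bar t];H^1(S^1))}\le C\,\Lambda_\varepsilon(\bar t),\qquad\bar t\in[0,t_*],$$ where $$\Lambda_\varepsilon(t)=\frac{\varepsilon}{(1+c\,\varepsilon^{\alpha-1}t)^{\frac1{\alpha-1}}},\qquad t\ge0.$$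
   Context: $S^1$ is identified with $[0,2\pi]$ with periodic boundary conditions. For $\sigma\in(0,1)$ let $\psi_\sigma(s)=(s^2+\sigma^2)^{\frac{\alpha-1}2}s$. The regularised problem is $$(P_\sigma)\qquad\partial_th+\partial_\theta\bigl(h^{\alpha+2}\psi_\sigma(\partial_\theta h+\partial_\theta^3h)\bigr)=0,\ t>0,\ \theta\in S^1,\qquad h(0,\cdot)=h_0.$$ A solution of $(P_\sigma)$ on $[0,T)$ is a function $h>0$ with $h\in C^1((0,T);H^4(S^1))\cap C([0,T);H^1(S^1))\cap L_{\alpha+1}((0,T);W^3_{\alpha+1}(S^1))$, $h(0)=h_0$, satisfying the equation in the weak form $\int_0^T\langle\partial_th,\varphi\rangle_{W^1_{\alpha+1}(S^1)}dt=\int_0^T\int_{S^1}h^{\alpha+2}\psi_\sigma(\partial_\theta h+\partial_\theta^3h)\partial_\theta\varphi\,d\theta\,dt$ for all $\varphi\in L_{\alpha+1}((0,T);W^1_{\alpha+1}(S^1))$. $t_*$ is the supremum of all $T>0$ for which a solution $h$ of $(P_\sigma)$ exists with $\tfrac12\bar h_0\le h(t,\theta)\le2\bar h_0$ on $[0,T]\times S^1$. The solution $h$ is considered on an interval $[0,T_\sigma)$ with $T_\sigma>t_*$ if $t_*<\infty$, and on $[0,\infty)$ if $t_*=\infty$ (then $[0,t_*]$ means $[0,\infty)$). $h_n(t)=\frac1{2\pi}\int_{S^1}h(t,\theta)e^{-in\theta}d\theta$ are the Fourier coefficients. The constants $c,C$ do not depend on $h_0$, $\varepsilon$ or $\bar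 t$. *)

theory Defs
  imports "HOL-Analysis.Analysis"
begin

text \<open>
  Functions on the circle are \<open>2\<pi>\<close>-periodic functions on the real line, integrated over
  \<open>[0, 2\<pi>]\<close>. The complete Lebesgue measure is used throughout, so that changing a
  function on a null set never affects measurability.
\<close>

abbreviation circle_measure :: "real measure" where
  "circle_measure \<equiv> lebesgue_on {0..2 * pi}"

definition periodic :: "(real \<Rightarrow> 'a) \<Rightarrow> bool" where
  "periodic f \<longleftrightarrow> (\<forall>\<theta>. f (\<theta> + 2 * pi) = f \<theta>)"

definition circle_test_function :: "(real \<Rightarrow> real) \<Rightarrow> bool" where
  "circle_test_function \<phi> \<longleftrightarrow>
     periodic \<phi> \<and> (\<forall>k \<theta>. (deriv ^^ k) \<phi> differentiable (at \<theta>))"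

definition has_weak_deriv ::
    "nat \<Rightarrow> (real \<Rightarrow> 'a::euclidean_space) \<Rightarrow> (real \<Rightarrow> 'a) \<Rightarrow> bool" where
  "has_weak_deriv k f g \<longleftrightarrow>
     integrable circle_measure f \<and> integrable circle_measure g \<and>
     (\<forall>\<phi>. circle_test_function \<phi> \<longrightarrow>
        (\<integral>\<theta>. (deriv ^^ k) \<phi> \<theta> *\<^sub>R f \<theta> \<partial>circle_measure)
          = (- 1) ^ k *\<^sub>R (\<integral>\<theta>. \<phi> \<theta> *\<^sub>R g \<theta> \<partial>circle_measure))"

text \<open>
  Weak derivatives are unique only almost everywhere on \<open>[0, 2\<pi>]\<close>; \<open>weak_deriv\<close>
  picks a representative, and is used below only under integrals.
\<close>

definition weak_deriv :: "nat \<Rightarrow> (real \<Rightarrow> 'a::euclidean_space) \<Rightarrow> (real \<Rightarrow> 'a)" where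
  "weak_deriv k f = (SOME g. has_weak_deriv k f g)"

definition sobolev :: "nat \<Rightarrow> real \<Rightarrow> (real \<Rightarrow> 'a::euclidean_space) set" where
  "sobolev k p = {f. periodic f \<and>
     (\<forall>j\<le>k. \<exists>g. has_weak_deriv j f g \<and>
                  integrable circle_measure (\<lambda>\<theta>. norm (g \<theta>) powr p))}"

definition sobolev_norm :: "nat \<Rightarrow> real \<Rightarrow> (real \<Rightarrow> 'a::euclidean_space) \<Rightarrow> real" where
  "sobolev_norm k p f =
     (\<Sum>j\<le>k. \<integral>\<theta>. norm (weak_deriv j f \<theta>) powr p \<partial>circle_measure) powr (1 / p)"

text \<open>
  Functions of time with values in \<open>W\<^sup>k\<^sub>p\<close>: a function \<open>u\<close> of \<open>t\<close> and \<open>\<theta>\<close> is regarded as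
  the map \<open>t \<mapsto> u t\<close>.
\<close>

definition sobolev_continuous ::
    "real set \<Rightarrow> nat \<Rightarrow> real \<Rightarrow> (real \<Rightarrow> real \<Rightarrow> 'a::euclidean_space) \<Rightarrow> bool" where
  "sobolev_continuous I k p u \<longleftrightarrow>
     (\<forall>t\<in>I. u t \<in> sobolev k p) \<and>
     (\<forall>t\<in>I. ((\<lambda>s. sobolev_norm k p (\<lambda>\<theta>. u s \<theta> - u t \<theta>)) \<longlongrightarrow> 0) (at t within I))"

definition sobolev_C1 ::
    "real set \<Rightarrow> nat \<Rightarrow> real \<Rightarrow> (real \<Rightarrow> real \<Rightarrow> 'a::euclidean_space)
       \<Rightarrow> (real \<Rightarrow> real \<Rightarrow> 'a) \<Rightarrow> bool" where
  \<comment> \<open>\<open>u \<in> C\<^sup>1(I; W\<^sup>k\<^sub>p)\<close> with time derivative \<open>v\<close>\<close>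
  "sobolev_C1 I k p u v \<longleftrightarrow>
     sobolev_continuous I k p u \<and> sobolev_continuous I k p v \<and>
     (\<forall>t\<in>I. ((\<lambda>s. sobolev_norm k p (\<lambda>\<theta>. (u s \<theta> - u t \<theta>) /\<^sub>R (s - t) - v t \<theta>)) \<longlongrightarrow> 0)
               (at t within I))"

text \<open>
  The Bochner space \<open>L\<^sub>p(I; W\<^sup>k\<^sub>p)\<close>: strong measurability means being an almost everywhere
  limit, in the norm of \<open>W\<^sup>k\<^sub>p\<close>, of simple functions with values in \<open>W\<^sup>k\<^sub>p\<close>.
\<close>

definition sobolev_Lp ::
    "real set \<Rightarrow> nat \<Rightarrow> real \<Rightarrow> (real \<Rightarrow> real \<Rightarrow> 'a::euclidean_space) \<Rightarrow> bool" where
  "sobolev_Lp I k p u \<longleftrightarrow>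
     (AE t in lebesgue_on I. u t \<in> sobolev k p) \<and>
     (\<exists>s. (\<forall>n::nat. simple_function (lebesgue_on I) (s n) \<and> (\<forall>t\<in>I. s n t \<in> sobolev k p)) \<and>
          (AE t in lebesgue_on I.
             (\<lambda>n. sobolev_norm k p (\<lambda>\<theta>. s n t \<theta> - u t \<theta>)) \<longlonglongrightarrow> 0)) \<and>
     integrable (lebesgue_on I) (\<lambda>t. sobolev_norm k p (u t) powr p)"

definition psi :: "real \<Rightarrow> real \<Rightarrow> real \<Rightarrow> real" where
  "psi \<alpha> \<sigma> s = (s\<^sup>2 + \<sigma>\<^sup>2) powr ((\<alpha> - 1) / 2) * s"

definition flux :: "real \<Rightarrow> real \<Rightarrow> (real \<Rightarrow> real) \<Rightarrow> real \<Rightarrow> real" where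
  "flux \<alpha> \<sigma> f \<theta> = f \<theta> powr (\<alpha> + 2) * psi \<alpha> \<sigma> (weak_deriv 1 f \<theta> + weak_deriv 3 f \<theta>)"

text \<open>
  Solutions on \<open>[0, T)\<close>. Elements of \<open>H\<^sup>1\<close> are identified with their continuous
  representatives, which gives pointwise positivity and the initial condition their meaning.
  The time derivative has values in \<open>H\<^sup>4\<close> and acts on \<open>W\<^sup>1\<^sub>\<alpha>\<^sub>+\<^sub>1\<close> through the \<open>L\<^sub>2\<close> pairing.
  Existence of the two time integrals in the weak form is part of the definition, since
  the integral of a non-integrable function is \<open>0\<close> by convention.
\<close>

definition is_solution ::
    "real \<Rightarrow> real \<Rightarrow> (real \<Rightarrow> real) \<Rightarrow> real \<Rightarrow> (real \<Rightarrow> real \<Rightarrow> real) \<Rightarrow> bool" where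
  "is_solution \<alpha> \<sigma> h0 T h \<longleftrightarrow>
     0 < T \<and>
     (\<forall>t\<in>{0..<T}. continuous_on UNIV (h t) \<and> (\<forall>\<theta>. 0 < h t \<theta>)) \<and>
     sobolev_continuous {0..<T} 1 2 h \<and>
     sobolev_Lp {0<..<T} 3 (\<alpha> + 1) h \<and>
     h 0 = h0 \<and>
     (\<exists>dth. sobolev_C1 {0<..<T} 4 2 h dth \<and>
        (\<forall>\<phi>. sobolev_Lp {0<..<T} 1 (\<alpha> + 1) \<phi> \<longrightarrow>
           integrable (lebesgue_on {0<..<T})
             (\<lambda>t. \<integral>\<theta>. dth t \<theta> * \<phi> t \<theta> \<partial>circle_measure) \<and>
           integrable (lebesgue_on {0<..<T})
             (\<lambda>t. \<integral>\<theta>. flux \<alpha> \<sigma> (h t) \<theta> * weak_deriv 1 (\<phi> t) \<theta> \<partial>circle_measure) \<and>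
           (\<integral>t. (\<integral>\<theta>. dth t \<theta> * \<phi> t \<theta> \<partial>circle_measure) \<partial>lebesgue_on {0<..<T})
             = (\<integral>t. (\<integral>\<theta>. flux \<alpha> \<sigma> (h t) \<theta> * weak_deriv 1 (\<phi> t) \<theta> \<partial>circle_measure)
                  \<partial>lebesgue_on {0<..<T})))"

text \<open>
  A solution on \<open>[0, T)\<close> has no prescribed value at \<open>T\<close>, so two-sided bounds on the closed
  interval \<open>[0, T]\<close> are asked of a solution living on some longer interval.
\<close>

definition t_star :: "real \<Rightarrow> real \<Rightarrow> real \<Rightarrow> (real \<Rightarrow> real) \<Rightarrow> ereal" where
  "t_star \<alpha> \<sigma> hbar h0 =
     Sup {ereal T | T. 0 < T \<and>
       (\<exists>T' h. T < T' \<and> is_solution \<alpha> \<sigma> h0 T' h \<and>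
          (\<forall>t\<in>{0..T}. \<forall>\<theta>. hbar / 2 \<le> h t \<theta> \<and> h t \<theta> \<le> 2 * hbar))}"

text \<open>
  On \<open>[0, \<infinity>)\<close> a solution means a solution on every bounded \<open>[0, T)\<close>: a function close to a
  positive constant is not in \<open>L\<^sub>\<alpha>\<^sub>+\<^sub>1((0, \<infinity>); W\<^sup>3\<^sub>\<alpha>\<^sub>+\<^sub>1)\<close>.
\<close>

definition is_solution_past_t_star ::
    "real \<Rightarrow> real \<Rightarrow> real \<Rightarrow> (real \<Rightarrow> real) \<Rightarrow> (real \<Rightarrow> real \<Rightarrow> real) \<Rightarrow> bool" where
  "is_solution_past_t_star \<alpha> \<sigma> hbar h0 h \<longleftrightarrow>
     (if t_star \<alpha> \<sigma> hbar h0 = \<infinity> then (\<forall>T>0. is_solution \<alpha> \<sigma> h0 T h)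
      else (\<exists>T\<sigma>. t_star \<alpha> \<sigma> hbar h0 < ereal T\<sigma> \<and> is_solution \<alpha> \<sigma> h0 T\<sigma> h))"

definition circle_mean :: "(real \<Rightarrow> real) \<Rightarrow> real" where
  "circle_mean f = 1 / (2 * pi) * (\<integral>\<theta>. f \<theta> \<partial>circle_measure)"

definition fourier_coeff :: "(real \<Rightarrow> real) \<Rightarrow> int \<Rightarrow> complex" where
  "fourier_coeff f n =
     1 / (2 * pi) * (\<integral>\<theta>. of_real (f \<theta>) * exp (- (\<i> * of_int n * of_real \<theta>)) \<partial>circle_measure)"

definition first_modes :: "real \<Rightarrow> (real \<Rightarrow> real) \<Rightarrow> real \<Rightarrow> complex" where
  "first_modes hbar f \<theta> =
     of_real hbar + fourier_coeff f (- 1) * exp (- (\<i> * of_real \<theta>))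
       + fourier_coeff f 1 * exp (\<i> * of_real \<theta>)"

definition C_H1_norm :: "real \<Rightarrow> real \<Rightarrow> (real \<Rightarrow> real \<Rightarrow> 'a::euclidean_space) \<Rightarrow> ereal" where
  "C_H1_norm a b u = (SUP t\<in>{a..b}. ereal (sobolev_norm 1 2 (u t)))"

definition Lambda :: "real \<Rightarrow> real \<Rightarrow> real \<Rightarrow> real \<Rightarrow> real" where
  "Lambda \<alpha> c \<epsilon> t = \<epsilon> / (1 + c * \<epsilon> powr (\<alpha> - 1) * t) powr (1 / (\<alpha> - 1))"

end

theory Submission
  imports Defs
begin

text \<open>
  Since the constants may depend on \<open>\<sigma>\<close>, the mobility is bounded below and the problem is
  uniformly parabolic near \<open>hbar\<close>. The energy \<open>\<pi> \<Sum> (n\<^sup>2 - 1) |h\<^sub>n|\<^sup>2\<close> (sum over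
  \<open>n \<noteq> 0\<close>) controls the \<open>H\<^sup>1\<close> norm of the modes \<open>|n| \<ge> 2\<close>, and its dissipation rate \<open>D\<close>
  dominates the energy itself, which therefore decays like \<open>exp (- \<mu> t)\<close> as long as \<open>h\<close> stays
  close to \<open>hbar\<close>. The speed of the modes \<open>n = 1, -1\<close> is bounded by \<open>\<surd>D + D\<close>; since
  \<open>exp (\<mu> t) D\<close> is integrable in time, these modes move by \<open>O(\<epsilon>)\<close> only. This closes a
  bootstrap along every solution, whatever its lifespan, and exponential decay is stronger
  than the algebraic rate \<open>\<Lambda>\<close>.
\<close>

section \<open>Trigonometric uniqueness on the circle\<close>

text \<open>The modes \<open>n = 0, 1, -1\<close> lie in the kernel both of the energy and of the
  symbol \<open>\<i> * n * (1 - n\<^sup>2)\<close> of the operator inside the flux, so nothing damps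
  them. The mean is conserved, but the modes \<open>n = 1, -1\<close> could drift until
  \<open>h\<close> leaves the range where the mobility is controlled; this is why their speed is
  estimated and not only their distance to the rest. Two features of the definitions shape the rest.
  \<open>weak_deriv\<close> is a choice among functions that agree almost everywhere, so its values
  become usable only after uniqueness, which is reduced to the fact that an integrable function with
  vanishing Fourier coefficients is zero almost everywhere. And the equation is an identity of
  integrals in time, so every estimate is first obtained for almost every \<open>t\<close> and then
  extended by continuity of both sides in \<open>t\<close>. The flux is only known to be integrable,
  with no derivative. Hence integration by parts is done on Fourier coefficients, with a form of
  Parseval in which one factor has absolutely summable coefficients and the other is merely
  integrable.\<close>

lemma finite_measure_circle [simp, intro]: "finite_measure circle_measure"
  by (rule finite_measure_lebesgue_on) simp

lemma measurable_circle_borel: "f \<in> borel_measurable borel \<Longrightarrow> f \<in> borel_measurable circle_measure"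
  by (simp add: measurable_completion measurable_restrict_space1)

lemma measurable_circle_continuous:
  "continuous_on UNIV f \<Longrightarrow> f \<in> borel_measurable circle_measure"
  by (intro measurable_circle_borel borel_measurable_continuous_onI)

lemma integrable_circle_const [simp, intro]: "integrable circle_measure (\<lambda>_. c)"
  using finite_measure.integrable_const[OF finite_measure_circle] by blast

lemma integrable_circle_bounded:
  fixes f :: "real \<Rightarrow> 'a::{banach,second_countable_topology}"
  assumes "f \<in> borel_measurable circle_measure" "AE \<theta> in circle_measure. norm (f \<theta>) \<le> B"
  shows "integrable circle_measure f"
  by (rule finite_measure.integrable_const_bound[OF finite_measure_circle assms(2,1)])

lemma integrable_circle_mult_bounded:
  fixes f g :: "real \<Rightarrow> 'a::{real_normed_algebra,banach,second_countable_topology}"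
  assumes "integrable circle_measure f" "g \<in> borel_measurable circle_measure"
    "AE \<theta> in circle_measure. norm (g \<theta>) \<le> B"
  shows "integrable circle_measure (\<lambda>\<theta>. g \<theta> * f \<theta>)"
proof (rule Bochner_Integration.integrable_bound)
  show "integrable circle_measure (\<lambda>\<theta>. B * norm (f \<theta>))"
    using assms(1) by auto
  show "(\<lambda>\<theta>. g \<theta> * f \<theta>) \<in> borel_measurable circle_measure"
    using assms by measurable
  show "AE \<theta> in circle_measure. norm (g \<theta> * f \<theta>) \<le> norm (B * norm (f \<theta>))"
    using assms(3)
  proof eventually_elim
    case (elim \<theta>)
    have "norm (g \<theta> * f \<theta>) \<le> norm (g \<theta>) * norm (f \<theta>)" by (rule norm_mult_ineq)
    also have "\<dots> \<le> B * norm (f \<theta>)" using elim by (intro mult_right_mono) auto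
    finally show ?case by auto
  qed
qed

lemma integrable_circle_cis:
  assumes "integrable circle_measure (f :: real \<Rightarrow> real)"
  shows "integrable circle_measure (\<lambda>\<theta>. of_real (f \<theta>) * cis (a * \<theta>))"
proof -
  have "integrable circle_measure (\<lambda>\<theta>. cis (a * \<theta>) * of_real (f \<theta>))"
    using assms
    by (intro integrable_circle_mult_bounded[where B = 1] measurable_circle_continuous)
       (auto intro!: continuous_intros)
  then show ?thesis by (simp add: mult.commute)
qed

lemma fourier_coeff_cis:
  "fourier_coeff f n =
     1 / (2 * pi) * (\<integral>\<theta>. of_real (f \<theta>) * cis (- (of_int n) * \<theta>) \<partial>circle_measure)"
  by (simp add: fourier_coeff_def cis_conv_exp mult.assoc)

lemma integral_cis_fourier_coeff:
  "(\<integral>\<theta>. of_real (f \<theta>) * cis (of_int n * \<theta>) \<partial>circle_measure) = 2 * pi * fourier_coeff f (- n)"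
  by (simp add: fourier_coeff_cis)

section \<open>From vanishing Fourier coefficients to vanishing almost everywhere\<close>

inductive trig_polynomial :: "(real \<Rightarrow> complex) \<Rightarrow> bool" where
  monomial: "trig_polynomial (\<lambda>\<theta>. c * cis (of_int n * \<theta>))"
| add: "trig_polynomial p \<Longrightarrow> trig_polynomial q \<Longrightarrow> trig_polynomial (\<lambda>\<theta>. p \<theta> + q \<theta>)"

lemma trig_polynomial_mult:
  assumes "trig_polynomial p" "trig_polynomial q"
  shows "trig_polynomial (\<lambda>\<theta>. p \<theta> * q \<theta>)"
  using assms
proof (induction arbitrary: q)
  case (monomial c n)
  from monomial show ?case
  proof (induction)
    case (monomial c' n')
    have "(\<lambda>\<theta>. c * cis (of_int n * \<theta>) * (c' * cis (of_int n' * \<theta>)))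
        = (\<lambda>\<theta>. (c * c') * cis (of_int (n + n') * \<theta>))"
      by (auto simp: algebra_simps cis_mult[symmetric])
    then show ?case by (simp only: trig_polynomial.monomial)
  next
    case (add p q)
    then show ?case by (simp add: distrib_left trig_polynomial.add)
  qed
next
  case (add p p')
  then show ?case by (simp add: distrib_right trig_polynomial.add)
qed

lemma trig_polynomial_const: "trig_polynomial (\<lambda>_. c)"
  using trig_polynomial.monomial[of c 0] by simp

text \<open>Links Stone-Weierstrass on the unit circle of the plane with Fourier coefficients: the
  coordinates of \<open>cis \<theta>\<close> are trigonometric, and products stay
  trigonometric.\<close>

lemma trig_polynomial_real_polynomial:
  fixes g :: "complex \<Rightarrow> real"
  assumes "real_polynomial_function g"
  shows "trig_polynomial (\<lambda>\<theta>. of_real (g (cis \<theta>)))"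
  using assms
proof induction
  case (linear f)
  \<comment> \<open>Euler's formulas applied to
    \<open>cos \<theta> * f 1 + sin \<theta> * f \<i>\<close>.\<close>
  let ?c = "(of_real (f 1) - \<i> * of_real (f \<i>)) / 2"
  have "of_real (f (cis \<theta>)) = ?c * cis (of_int 1 * \<theta>) + cnj ?c * cis (of_int (-1) * \<theta>)" for \<theta>
  proof -
    have "f (cis \<theta>) = f (cos \<theta> *\<^sub>R 1 + sin \<theta> *\<^sub>R \<i>)"
      by (rule arg_cong[where f = f]) (auto simp: complex_eq_iff)
    also have "\<dots> = cos \<theta> * f 1 + sin \<theta> * f \<i>"
      using linear by (simp add: linear_simps)
    finally show ?thesis
      by (auto simp: complex_eq_iff field_simps)
  qed
  then show ?case
    by (simp only: trig_polynomial.intros)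
next
  case (const c)
  then show ?case by (rule trig_polynomial_const)
qed (auto intro: trig_polynomial.add trig_polynomial_mult)

text \<open>Integrability is carried through the induction because the integral splits over a sum
  only for integrable summands.\<close>

lemma trig_polynomial_integral_zero:
  assumes "trig_polynomial p" "integrable circle_measure (f :: real \<Rightarrow> real)"
    "\<And>n. fourier_coeff f n = 0"
  shows "integrable circle_measure (\<lambda>\<theta>. of_real (f \<theta>) * p \<theta>) \<and>
         (\<integral>\<theta>. of_real (f \<theta>) * p \<theta> \<partial>circle_measure) = 0"
  using assms(1)
proof induction
  case (monomial c n)
  have "(\<lambda>\<theta>. of_real (f \<theta>) * (c * cis (of_int n * \<theta>)))
      = (\<lambda>\<theta>. c * (of_real (f \<theta>) * cis (of_int n * \<theta>)))"
    by (simp add: algebra_simps)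
  then show ?case
    using integrable_circle_cis[OF assms(2)] assms(3) by (simp add: integral_cis_fourier_coeff)
next
  case (add p q)
  then show ?case by (simp add: distrib_left)
qed

text \<open>Uniform approximation of \<open>G\<close> on the unit circle by polynomials, against the
  integrable weight \<open>f\<close>. Writing the multiplier as \<open>G (cis \<theta>)\<close>
  makes periodicity automatic.\<close>

lemma integral_continuous_circle_zero:
  assumes f: "integrable circle_measure (f :: real \<Rightarrow> real)" "\<And>n. fourier_coeff f n = 0"
    and G: "continuous_on UNIV (G :: complex \<Rightarrow> real)"
  shows "(\<integral>\<theta>. G (cis \<theta>) * f \<theta> \<partial>circle_measure) = 0"
proof -
  have meas: "(\<lambda>\<theta>. F (cis \<theta>)) \<in> borel_measurable circle_measure"
    if "continuous_on UNIV F" for F :: "complex \<Rightarrow> real"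
    by (intro measurable_circle_continuous continuous_on_compose2[OF that])
       (auto intro!: continuous_intros)
  have int: "integrable circle_measure (\<lambda>\<theta>. F (cis \<theta>) * f \<theta>)"
    if F: "continuous_on UNIV F" for F :: "complex \<Rightarrow> real"
  proof -
    have "compact (F ` sphere 0 1)"
      using F by (intro compact_continuous_image) (auto intro: continuous_on_subset)
    then have "bounded (F ` sphere 0 1)" by (rule compact_imp_bounded)
    then obtain B where B: "\<And>z. z \<in> sphere 0 1 \<Longrightarrow> \<bar>F z\<bar> \<le> B"
      unfolding bounded_iff real_norm_def by blast
    then show ?thesis
      by (intro integrable_circle_mult_bounded[where B = B] f meas F)
         (auto intro!: B)
  qed
  define J where "J = (\<integral>\<theta>. \<bar>f \<theta>\<bar> \<partial>circle_measure)"
  have J: "J \<ge> 0" by (simp add: J_def)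
  have "\<bar>\<integral>\<theta>. G (cis \<theta>) * f \<theta> \<partial>circle_measure\<bar> \<le> 0 + e" if "e > 0" for e
  proof -
    \<comment> \<open>The \<open>+ 1\<close> keeps the tolerance defined when
      \<open>J = 0\<close>.\<close>
    define d where "d = e / (J + 1)"
    have d: "d > 0" using J that by (simp add: d_def)
    obtain g where g: "real_polynomial_function g" "\<And>z. z \<in> sphere 0 1 \<Longrightarrow> \<bar>G z - g z\<bar> < d"
      using Stone_Weierstrass_real_polynomial_function[of "sphere 0 1" G d] G d
      by (auto intro: continuous_on_subset)
    have contg: "continuous_on UNIV g"
      using g(1) by (simp add: real_polynomial_function_eq continuous_on_polymonial_function)
    have "complex_of_real (\<integral>\<theta>. g (cis \<theta>) * f \<theta> \<partial>circle_measure)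
        = (\<integral>\<theta>. of_real (f \<theta>) * of_real (g (cis \<theta>)) \<partial>circle_measure)"
      by (subst integral_complex_of_real[symmetric]) (simp add: mult.commute)
    also have "\<dots> = 0"
      using trig_polynomial_integral_zero[OF trig_polynomial_real_polynomial[OF g(1)] f] by simp
    finally have "(\<integral>\<theta>. g (cis \<theta>) * f \<theta> \<partial>circle_measure) = 0" by simp
    then have "(\<integral>\<theta>. G (cis \<theta>) * f \<theta> \<partial>circle_measure)
        = (\<integral>\<theta>. G (cis \<theta>) * f \<theta> - g (cis \<theta>) * f \<theta> \<partial>circle_measure)"
      using int[OF G] int[OF contg] by simp
    also have "\<bar>\<dots>\<bar> \<le> (\<integral>\<theta>. d * \<bar>f \<theta>\<bar> \<partial>circle_measure)"
    proof (rule integral_abs_bound[THEN order_trans], rule integral_mono)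
      show "integrable circle_measure (\<lambda>\<theta>. \<bar>G (cis \<theta>) * f \<theta> - g (cis \<theta>) * f \<theta>\<bar>)"
        using int[OF G] int[OF contg] by simp
      show "\<bar>G (cis \<theta>) * f \<theta> - g (cis \<theta>) * f \<theta>\<bar> \<le> d * \<bar>f \<theta>\<bar>" for \<theta>
        using g(2)[of "cis \<theta>"]
        by (auto simp: left_diff_distrib[symmetric] abs_mult intro!: mult_right_mono)
    qed (use f in auto)
    also have "\<dots> = d * J" by (simp add: J_def)
    also have "\<dots> \<le> e" using that J by (simp add: d_def field_simps)
    finally show ?thesis by simp
  qed
  then have "\<bar>\<integral>\<theta>. G (cis \<theta>) * f \<theta> \<partial>circle_measure\<bar> \<le> 0"
    by (rule field_le_epsilon)
  then show ?thesis by simp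
qed

text \<open>The interval is half-open because \<open>0\<close> and \<open>2 * pi\<close> are the
  same point of the circle; the endpoint is a null set and is discarded wherever this
  matters.\<close>

lemma cis_inj_Ico: "inj_on cis {0..<2*pi}"
proof (rule inj_onI)
  fix x y assume *: "x \<in> {0..<2*pi}" "y \<in> {0..<2*pi}" "cis x = cis y"
  then have "exp (\<i> * of_real x) = exp (\<i> * of_real y)" by (simp add: cis_conv_exp)
  then obtain n :: int where "\<i> * of_real x = \<i> * of_real y + (of_int (2 * n) * pi) * \<i>"
    by (auto simp: exp_eq)
  then have n: "x = y + 2 * n * pi" by (auto simp: complex_eq_iff)
  then have "\<bar>2 * n * pi\<bar> < 2 * pi" using * by auto
  then have "\<bar>of_int n\<bar> * (2 * pi) < 1 * (2 * pi)" by (simp add: abs_mult)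
  then have "\<bar>real_of_int n\<bar> < 1" by (simp only: mult_less_cancel_right) auto
  then have "n = 0" by linarith
  with n show "x = y" by simp
qed

lemma AE_circle_ne: "AE \<theta> in circle_measure. \<theta> \<noteq> a"
proof -
  have "AE \<theta> in lebesgue. \<theta> \<noteq> a"
    by (rule AE_I'[of "{a}"]) auto
  then show ?thesis
    by (subst AE_restrict_space_iff) auto
qed

lemma integral_compact_zero:
  assumes f: "integrable circle_measure (f :: real \<Rightarrow> real)" "\<And>n. fourier_coeff f n = 0"
    and K: "compact K" "K \<subseteq> {0..<2*pi}"
  shows "(\<integral>\<theta>. indicator K \<theta> * f \<theta> \<partial>circle_measure) = 0"
proof (cases "K = {}")
  case False
  define L where "L = cis ` K"
  have L: "compact L" "L \<noteq> {}"
    using K False by (auto simp: L_def intro!: compact_continuous_image continuous_intros)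
  define G where "G = (\<lambda>(k::nat) z. max 0 (1 - real k * infdist z L))"
  have contG: "continuous_on UNIV (G k)" for k
    unfolding G_def by (intro continuous_intros)
  have G01: "0 \<le> G k z" "G k z \<le> 1" for k z
    using infdist_nonneg[of z L] by (auto simp: G_def)
  have lim: "(\<lambda>k. G k (cis \<theta>)) \<longlonglongrightarrow> indicator K \<theta>" if "\<theta> \<in> {0..<2*pi}" for \<theta>
  proof (cases "\<theta> \<in> K")
    case True
    then have "infdist (cis \<theta>) L = 0" by (simp add: L_def)
    then show ?thesis using True by (simp add: G_def)
  next
    case False
    have "cis \<theta> \<notin> L"
    proof
      assume "cis \<theta> \<in> L"
      then obtain x where "x \<in> K" "cis \<theta> = cis x" by (auto simp: L_def)
      with that K False show False using cis_inj_Ico by (auto dest: inj_onD)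
    qed
    then have pos: "infdist (cis \<theta>) L > 0"
      using L compact_imp_closed[OF L(1)] in_closed_iff_infdist_zero[of L "cis \<theta>"]
        infdist_nonneg[of "cis \<theta>" L] by (auto simp: less_le)
    obtain N :: nat where N: "1 < real N * infdist (cis \<theta>) L"
      using reals_Archimedean3[OF pos] by blast
    have "G k (cis \<theta>) = 0" if "k \<ge> N" for k
    proof -
      have "real N * infdist (cis \<theta>) L \<le> real k * infdist (cis \<theta>) L"
        using that pos by (intro mult_right_mono) auto
      then show ?thesis using N by (simp add: G_def)
    qed
    then have "eventually (\<lambda>k. G k (cis \<theta>) = indicator K \<theta>) sequentially"
      using False by (auto simp: eventually_sequentially)
    then show ?thesis by (rule tendsto_eventually)
  qed
  have Kb: "K \<in> sets borel" using K(1) by (simp add: borel_compact)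
  have "(\<lambda>k. \<integral>\<theta>. G k (cis \<theta>) * f \<theta> \<partial>circle_measure)
      \<longlonglongrightarrow> (\<integral>\<theta>. indicator K \<theta> * f \<theta> \<partial>circle_measure)"
  proof (rule integral_dominated_convergence)
    show "(\<lambda>\<theta>. indicator K \<theta> * f \<theta>) \<in> borel_measurable circle_measure"
      using f Kb by (intro borel_measurable_times measurable_circle_borel[of "indicator K"]) auto
    show "(\<lambda>\<theta>. G k (cis \<theta>) * f \<theta>) \<in> borel_measurable circle_measure" for k
      using f continuous_on_compose2[OF contG continuous_on_cis[OF continuous_on_id]]
      by (intro borel_measurable_times[OF measurable_circle_continuous]) auto
    show "integrable circle_measure (\<lambda>\<theta>. \<bar>f \<theta>\<bar>)" using f by simp
    show "AE \<theta> in circle_measure. norm (G k (cis \<theta>) * f \<theta>) \<le> \<bar>f \<theta>\<bar>" for k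
      using G01 by (auto simp: abs_mult intro!: mult_left_le_one_le)
    show "AE \<theta> in circle_measure. (\<lambda>k. G k (cis \<theta>) * f \<theta>) \<longlonglongrightarrow> indicator K \<theta> * f \<theta>"
      using AE_circle_ne[of "2*pi"] AE_space
    proof eventually_elim
      case (elim \<theta>)
      then show ?case by (intro tendsto_mult lim tendsto_const) auto
    qed
  qed
  moreover have "(\<integral>\<theta>. G k (cis \<theta>) * f \<theta> \<partial>circle_measure) = 0" for k
    using integral_continuous_circle_zero[OF f contG] .
  ultimately show ?thesis by (simp add: LIMSEQ_const_iff)
qed simp

lemma fourier_coeff_uminus: "fourier_coeff (\<lambda>\<theta>. - f \<theta>) n = - fourier_coeff f n"
  by (simp add: fourier_coeff_cis)

text \<open>Up to a null set, the set where \<open>f\<close> is positive is a countable union of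
  compact sets; on each of them a positive function has integral zero, so each is null.\<close>

lemma AE_nonpos_fourier_coeff_zero:
  assumes f: "integrable circle_measure (f :: real \<Rightarrow> real)" "\<And>n. fourier_coeff f n = 0"
  shows "AE \<theta> in circle_measure. f \<theta> \<le> 0"
proof -
  define S where "S = {\<theta>\<in>{0..<2*pi}. f \<theta> > 0}"
  have fm: "f \<in> borel_measurable circle_measure" using f by auto
  have "{\<theta>\<in>space circle_measure. f \<theta> > 0} \<in> sets circle_measure"
    using fm by measurable
  then have "{\<theta>\<in>{0..2*pi}. f \<theta> > 0} \<in> sets lebesgue"
    by (auto simp: sets_restrict_space_iff)
  moreover have "S = {\<theta>\<in>{0..2*pi}. f \<theta> > 0} - {2*pi}" by (auto simp: S_def)
  ultimately have S: "S \<in> sets lebesgue" by auto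
  obtain C T where CT: "fsigma C" "T \<in> null_sets lebesgue" "C \<union> T = S"
    using lebesgue_set_almost_fsigma[OF S] by metis
  obtain K :: "nat \<Rightarrow> real set" where K: "range K \<subseteq> Collect compact" "C = \<Union>(range K)"
    using CT(1) fsigma_Union_compact by metis
  have "AE \<theta> in circle_measure. \<theta> \<notin> K n" for n
  proof -
    have Kn: "compact (K n)" "K n \<subseteq> S" using K CT by auto
    have Kb: "K n \<in> sets borel" using Kn(1) by (simp add: borel_compact)
    have "integrable circle_measure (\<lambda>\<theta>. indicator (K n) \<theta> * f \<theta>)"
      using f Kb by (intro integrable_circle_mult_bounded[where B = 1] measurable_circle_borel)
         (auto simp: indicator_def)
    moreover have "(\<integral>\<theta>. indicator (K n) \<theta> * f \<theta> \<partial>circle_measure) = 0"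
      using Kn by (intro integral_compact_zero f) (auto simp: S_def)
    moreover have "AE \<theta> in circle_measure. 0 \<le> indicator (K n) \<theta> * f \<theta>"
      using Kn by (intro AE_I2) (auto simp: indicator_def S_def)
    ultimately have "AE \<theta> in circle_measure. indicator (K n) \<theta> * f \<theta> = 0"
      using integral_nonneg_eq_0_iff_AE by blast
    then show ?thesis
    proof eventually_elim
      case (elim \<theta>)
      then show ?case using Kn by (auto simp: indicator_def S_def split: if_splits)
    qed
  qed
  then have "AE \<theta> in circle_measure. \<forall>n. \<theta> \<notin> K n" by (simp add: AE_all_countable)
  moreover have "AE \<theta> in circle_measure. \<theta> \<notin> T"
    using CT(2) by (subst AE_restrict_space_iff) (auto dest: AE_not_in)
  ultimately show ?thesis
    using AE_circle_ne[of "2*pi"] AE_space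
  proof eventually_elim
    case (elim \<theta>)
    then have "\<theta> \<notin> S" using CT K by blast
    then show ?case using elim by (auto simp: S_def)
  qed
qed

lemma AE_zero_fourier_coeff_zero:
  assumes f: "integrable circle_measure (f :: real \<Rightarrow> real)" "\<And>n. fourier_coeff f n = 0"
  shows "AE \<theta> in circle_measure. f \<theta> = 0"
proof -
  have "AE \<theta> in circle_measure. - f \<theta> \<le> 0"
    using f by (intro AE_nonpos_fourier_coeff_zero) (auto simp: fourier_coeff_uminus)
  with AE_nonpos_fourier_coeff_zero[OF f] show ?thesis
    by eventually_elim auto
qed

section \<open>Weak derivatives and Fourier coefficients\<close>

lemma cis_periodic: "cis (of_int n * (\<theta> + 2 * pi)) = cis (of_int n * \<theta>)"
proof -
  have "cis (of_int n * (\<theta> + 2 * pi)) = cis (of_int n * \<theta>) * cis (2 * pi * of_int n)"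
    by (simp add: cis_mult algebra_simps)
  then show ?thesis by simp
qed

lemma has_real_derivative_Re_cis:
  "((\<lambda>\<theta>. Re (c * cis (a * \<theta>))) has_real_derivative Re (\<i> * of_real a * c * cis (a * \<theta>)))
     (at \<theta>)"
  by (auto intro!: derivative_eq_intros simp: algebra_simps)

lemma funpow_deriv_Re_cis:
  "(deriv ^^ k) (\<lambda>\<theta>. Re (c * cis (a * \<theta>)))
     = (\<lambda>\<theta>. Re ((\<i> * of_real a) ^ k * c * cis (a * \<theta>)))"
proof (induction k)
  case (Suc k)
  have "deriv (\<lambda>\<theta>. Re ((\<i> * of_real a) ^ k * c * cis (a * \<theta>)))
      = (\<lambda>\<theta>. Re (\<i> * of_real a * ((\<i> * of_real a) ^ k * c) * cis (a * \<theta>)))"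
    by (intro ext DERIV_imp_deriv has_real_derivative_Re_cis)
  then show ?case
    by (simp only: funpow.simps comp_apply Suc.IH power_Suc mult.assoc)
qed simp

text \<open>Test functions are real-valued, so complex exponentials are tested through their real
  part; the free complex factor \<open>c\<close> covers sine and cosine at once.\<close>

lemma circle_test_function_Re_cis: "circle_test_function (\<lambda>\<theta>. Re (c * cis (of_int n * \<theta>)))"
  unfolding circle_test_function_def funpow_deriv_Re_cis periodic_def cis_periodic
  using has_real_derivative_Re_cis real_differentiable_def by blast

lemma circle_test_function_const: "circle_test_function (\<lambda>_. 1)"
  using circle_test_function_Re_cis[of 1 0] by simp

lemma continuous_on_circle_test:
  assumes "circle_test_function \<phi>"
  shows "continuous_on S ((deriv ^^ k) \<phi>)"
  using assms unfolding circle_test_function_def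
  by (intro continuous_at_imp_continuous_on) (auto intro: differentiable_imp_continuous_within)

lemma has_real_derivative_circle_test:
  assumes "circle_test_function \<phi>"
  shows "(\<phi> has_real_derivative deriv \<phi> \<theta>) (at \<theta>)"
  using assms DERIV_deriv_iff_real_differentiable unfolding circle_test_function_def
  by (metis funpow_0)

lemma integrable_circle_continuous:
  fixes f :: "real \<Rightarrow> 'a::euclidean_space"
  assumes "continuous_on UNIV f"
  shows "integrable circle_measure f"
proof -
  have "compact (f ` {0..2*pi})"
    using assms by (intro compact_continuous_image) (auto intro: continuous_on_subset)
  then have "bounded (f ` {0..2*pi})" by (rule compact_imp_bounded)
  then obtain B where B: "\<And>z. z \<in> {0..2*pi} \<Longrightarrow> norm (f z) \<le> B"
    unfolding bounded_iff by blast
  show ?thesis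
    by (rule integrable_circle_bounded[OF measurable_circle_continuous[OF assms], of B])
       (intro AE_I2, simp add: B)
qed

text \<open>Integration by parts; the boundary terms cancel because both factors are
  periodic.\<close>

lemma has_weak_deriv_Re_cis:
  "has_weak_deriv 1 (\<lambda>\<theta>. Re (c * cis (of_int n * \<theta>)))
     (\<lambda>\<theta>. Re (\<i> * of_int n * c * cis (of_int n * \<theta>)))"
  (is "has_weak_deriv 1 ?f ?g")
  unfolding has_weak_deriv_def
proof (intro conjI allI impI)
  show "integrable circle_measure ?f" "integrable circle_measure ?g"
    by (intro integrable_circle_continuous continuous_intros)+
  fix \<phi> :: "real \<Rightarrow> real" assume \<phi>: "circle_test_function \<phi>"
  have cont: "continuous_on S \<phi>" "continuous_on S (deriv \<phi>)" for S
    using continuous_on_circle_test[OF \<phi>, of S 0] continuous_on_circle_test[OF \<phi>, of S 1] by auto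
  have contp: "continuous_on UNIV (\<lambda>\<theta>. deriv \<phi> \<theta> * ?f \<theta>)" "continuous_on UNIV (\<lambda>\<theta>. \<phi> \<theta> * ?g \<theta>)"
    by (intro continuous_intros cont)+
  have per: "\<phi> (2 * pi) = \<phi> 0" "?f (2 * pi) = ?f 0"
    using \<phi> cis_periodic[of n 0] by (auto simp: circle_test_function_def periodic_def
        dest: spec[of _ 0])
  have "((\<lambda>\<theta>. deriv \<phi> \<theta> * ?f \<theta> + \<phi> \<theta> * ?g \<theta>) has_integral
      \<phi> (2 * pi) * ?f (2 * pi) - \<phi> 0 * ?f 0) {0..2*pi}"
  proof (rule fundamental_theorem_of_calculus)
    fix x
    have "((\<lambda>\<theta>. \<phi> \<theta> * ?f \<theta>) has_real_derivative deriv \<phi> x * ?f x + \<phi> x * ?g x) (at x)"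
      using DERIV_mult[OF has_real_derivative_circle_test[OF \<phi>, of x]
          has_real_derivative_Re_cis[of c "of_int n" x]] by (simp add: add.commute mult.commute)
    then show "((\<lambda>\<theta>. \<phi> \<theta> * ?f \<theta>) has_vector_derivative deriv \<phi> x * ?f x + \<phi> x * ?g x)
        (at x within {0..2*pi})"
      by (simp add: has_real_derivative_iff_has_vector_derivative
          has_vector_derivative_at_within)
  qed simp
  then have "((\<lambda>\<theta>. deriv \<phi> \<theta> * ?f \<theta> + \<phi> \<theta> * ?g \<theta>) has_integral 0) {0..2*pi}"
    by (simp only: per diff_self)
  then have "integral {0..2*pi} (\<lambda>\<theta>. deriv \<phi> \<theta> * ?f \<theta> + \<phi> \<theta> * ?g \<theta>) = 0"
    by (rule integral_unique)
  then have "(\<integral>\<theta>. deriv \<phi> \<theta> * ?f \<theta> + \<phi> \<theta> * ?g \<theta> \<partial>circle_measure) = 0"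
    using integrable_circle_continuous[OF contp(1)] integrable_circle_continuous[OF contp(2)]
    by (subst lebesgue_integral_eq_integral) auto
  then show "(\<integral>\<theta>. (deriv ^^ 1) \<phi> \<theta> *\<^sub>R ?f \<theta> \<partial>circle_measure)
      = (- 1) ^ 1 *\<^sub>R (\<integral>\<theta>. \<phi> \<theta> *\<^sub>R ?g \<theta> \<partial>circle_measure)"
    using integrable_circle_continuous[OF contp(1)] integrable_circle_continuous[OF contp(2)]
    by simp
qed

lemma integral_cis:
  "(\<integral>\<theta>. cis (of_int n * \<theta>) \<partial>circle_measure) = (if n = 0 then 2 * pi else 0)"
proof (cases "n = 0")
  case True
  then show ?thesis by (simp add: measure_restrict_space scaleR_conv_of_real)
next
  case False
  have int: "integrable circle_measure (\<lambda>\<theta>. c * cis (of_int n * \<theta>))" for c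
    by (intro integrable_circle_continuous continuous_intros)
  have "Re (c * (\<integral>\<theta>. cis (of_int n * \<theta>) \<partial>circle_measure)) = 0" for c
  proof -
    \<comment> \<open>The coefficient of a primitive: a periodic function that is a derivative has
      integral zero, as testing with the constant \<open>1\<close> shows.\<close>
    let ?c = "c / (\<i> * of_int n)"
    have c: "\<i> * of_int n * ?c = c" using False by simp
    have "(\<integral>\<theta>. Re (c * cis (of_int n * \<theta>)) \<partial>circle_measure) = 0"
      using has_weak_deriv_Re_cis[of ?c n] circle_test_function_const
      unfolding has_weak_deriv_def c by auto
    then have "Re (\<integral>\<theta>. c * cis (of_int n * \<theta>) \<partial>circle_measure) = 0"
      by (subst integral_Re[symmetric, OF int])
    then show ?thesis by (simp only: integral_mult_right_zero)
  qed
  from this[of 1] this[of "-\<i>"] show ?thesis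
    using False by (simp add: complex_eq_iff)
qed

text \<open>Testing with exponentials of frequency \<open>- n\<close>: the sign from differentiating
  them \<open>k\<close> times cancels the sign \<open>(- 1) ^ k\<close> of the weak
  derivative.\<close>

lemma fourier_coeff_weak_deriv:
  fixes f g :: "real \<Rightarrow> real"
  assumes "has_weak_deriv k f g"
  shows "fourier_coeff g n = (\<i> * of_int n) ^ k * fourier_coeff f n"
proof -
  have fi: "integrable circle_measure f" and gi: "integrable circle_measure g"
    using assms by (auto simp: has_weak_deriv_def)
  have int: "(\<integral>\<theta>. Re (c * cis (of_int (- n) * \<theta>)) * u \<theta> \<partial>circle_measure)
      = Re (c * (2 * pi * fourier_coeff u n))" if "integrable circle_measure u" for c u
  proof -
    have "(\<integral>\<theta>. Re (c * cis (of_int (- n) * \<theta>)) * u \<theta> \<partial>circle_measure)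
        = (\<integral>\<theta>. Re (c * (of_real (u \<theta>) * cis (of_int (- n) * \<theta>))) \<partial>circle_measure)"
      by (intro Bochner_Integration.integral_cong) (auto simp: algebra_simps)
    also have "\<dots> = Re (\<integral>\<theta>. c * (of_real (u \<theta>) * cis (of_int (- n) * \<theta>)) \<partial>circle_measure)"
      using integrable_circle_cis[OF that] by (intro integral_Re integrable_mult_right)
    also have "\<dots> = Re (c * (2 * pi * fourier_coeff u n))"
      unfolding integral_mult_right_zero integral_cis_fourier_coeff by simp
    finally show ?thesis .
  qed
  have "Re (c * (- 1) ^ k * (2 * pi * fourier_coeff g n))
      = Re ((\<i> * of_real (of_int (- n))) ^ k * c * (2 * pi * fourier_coeff f n))" for c
  proof -
    have "(\<integral>\<theta>. (deriv ^^ k) (\<lambda>\<theta>. Re (c * cis (of_int (- n) * \<theta>))) \<theta> *\<^sub>R f \<theta> \<partial>circle_measure)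
        = (- 1) ^ k *\<^sub>R (\<integral>\<theta>. Re (c * cis (of_int (- n) * \<theta>)) *\<^sub>R g \<theta> \<partial>circle_measure)"
      using assms circle_test_function_Re_cis[of c "- n"] unfolding has_weak_deriv_def by blast
    then have "Re ((\<i> * of_real (of_int (- n))) ^ k * c * (2 * pi * fourier_coeff f n))
        = (- 1) ^ k * Re (c * (2 * pi * fourier_coeff g n))"
      unfolding funpow_deriv_Re_cis real_scaleR_def int[OF fi] int[OF gi] .
    then show ?thesis
      by (cases "even k") auto
  qed
  \<comment> \<open>The factor \<open>(- 1) ^ k\<close> removes the sign on the left; the additional
    factor \<open>\<i>\<close> turns the identity of real parts into one of imaginary parts.\<close>
  from this[of "(-1)^k"] this[of "\<i> * (-1)^k"]
  have "fourier_coeff g n * (2*pi) = (- 1) ^ k * (\<i> * of_real (of_int (- n))) ^ k * fourier_coeff f n * (2*pi)"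
    by (cases "even k") (auto simp: complex_eq_iff algebra_simps)
  also have "(- 1) ^ k * (\<i> * of_real (of_int (- n))) ^ k = (\<i> * of_int n) ^ k"
    by (simp flip: power_mult_distrib)
  finally show ?thesis by simp
qed

lemma fourier_coeff_add:
  assumes "integrable circle_measure f" "integrable circle_measure g"
  shows "fourier_coeff (\<lambda>\<theta>. f \<theta> + g \<theta>) n = fourier_coeff f n + fourier_coeff g n"
  using integrable_circle_cis[OF assms(1), of "- of_int n"]
    integrable_circle_cis[OF assms(2), of "- of_int n"]
  by (simp add: fourier_coeff_cis distrib_right add_divide_distrib)

lemma fourier_coeff_diff:
  assumes "integrable circle_measure f" "integrable circle_measure g"
  shows "fourier_coeff (\<lambda>\<theta>. f \<theta> - g \<theta>) n = fourier_coeff f n - fourier_coeff g n"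
  using integrable_circle_cis[OF assms(1), of "- of_int n"]
    integrable_circle_cis[OF assms(2), of "- of_int n"]
  by (simp add: fourier_coeff_cis left_diff_distrib diff_divide_distrib)

lemma fourier_coeff_cmult: "fourier_coeff (\<lambda>\<theta>. c * f \<theta>) n = of_real c * fourier_coeff f n"
  by (simp add: fourier_coeff_cis mult.assoc)

lemma fourier_coeff_minus: "fourier_coeff f (- n) = cnj (fourier_coeff f n)"
  by (simp add: fourier_coeff_cis cis_cnj flip: Bochner_Integration.integral_cnj)

lemma norm_fourier_coeff_le:
  "norm (fourier_coeff f n) \<le> 1 / (2 * pi) * (\<integral>\<theta>. \<bar>f \<theta>\<bar> \<partial>circle_measure)"
proof -
  have "norm (\<integral>\<theta>. of_real (f \<theta>) * cis (- (of_int n) * \<theta>) \<partial>circle_measure)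
      \<le> (\<integral>\<theta>. norm (of_real (f \<theta>) * cis (- (of_int n) * \<theta>)) \<partial>circle_measure)"
    by (rule integral_norm_bound)
  also have "\<dots> = (\<integral>\<theta>. \<bar>f \<theta>\<bar> \<partial>circle_measure)" by (simp add: norm_mult)
  finally show ?thesis by (simp add: fourier_coeff_cis norm_mult divide_right_mono norm_divide)
qed

lemma AE_eq_fourier_coeff:
  assumes "integrable circle_measure (f :: real \<Rightarrow> real)" "integrable circle_measure g"
    "\<And>n. fourier_coeff f n = fourier_coeff g n"
  shows "AE \<theta> in circle_measure. f \<theta> = g \<theta>"
  using AE_zero_fourier_coeff_zero[of "\<lambda>\<theta>. f \<theta> - g \<theta>"] assms by (simp add: fourier_coeff_diff)

section \<open>Almost everywhere uniqueness of weak derivatives\<close>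

lemma integrable_circle_test_mult:
  fixes u :: "real \<Rightarrow> 'a::euclidean_space"
  assumes \<phi>: "circle_test_function \<phi>" and u: "integrable circle_measure u"
  shows "integrable circle_measure (\<lambda>\<theta>. (deriv ^^ j) \<phi> \<theta> *\<^sub>R u \<theta>)"
proof -
  have c: "continuous_on S ((deriv ^^ j) \<phi>)" for S
    by (rule continuous_on_circle_test[OF \<phi>])
  have "compact ((deriv ^^ j) \<phi> ` {0..2*pi})"
    by (intro compact_continuous_image c) auto
  then have "bounded ((deriv ^^ j) \<phi> ` {0..2*pi})" by (rule compact_imp_bounded)
  then obtain B where B: "\<And>z. z \<in> {0..2*pi} \<Longrightarrow> \<bar>(deriv ^^ j) \<phi> z\<bar> \<le> B"
    unfolding bounded_iff real_norm_def by blast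
  show ?thesis
  proof (rule Bochner_Integration.integrable_bound)
    show "integrable circle_measure (\<lambda>\<theta>. B * norm (u \<theta>))" using u by auto
    show "(\<lambda>\<theta>. (deriv ^^ j) \<phi> \<theta> *\<^sub>R u \<theta>) \<in> borel_measurable circle_measure"
      using u by (intro borel_measurable_scaleR[OF measurable_circle_continuous[OF c]]) auto
    show "AE \<theta> in circle_measure. norm ((deriv ^^ j) \<phi> \<theta> *\<^sub>R u \<theta>) \<le> norm (B * norm (u \<theta>))"
    proof (rule AE_I2)
      fix \<theta> assume "\<theta> \<in> space circle_measure"
      then have "\<bar>(deriv ^^ j) \<phi> \<theta>\<bar> * norm (u \<theta>) \<le> B * norm (u \<theta>)"
        using B[of \<theta>] by (intro mult_right_mono) auto
      then show "norm ((deriv ^^ j) \<phi> \<theta> *\<^sub>R u \<theta>) \<le> norm (B * norm (u \<theta>))" by auto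
    qed
  qed
qed

text \<open>Reduces vector values to real ones. Complex values occur in the theorem, since
  \<open>first_modes\<close> is complex-valued.\<close>

lemma has_weak_deriv_inner:
  fixes f g :: "real \<Rightarrow> 'a::euclidean_space"
  assumes "has_weak_deriv k f g"
  shows "has_weak_deriv k (\<lambda>\<theta>. f \<theta> \<bullet> b) (\<lambda>\<theta>. g \<theta> \<bullet> b)"
  unfolding has_weak_deriv_def
proof (intro conjI allI impI)
  have int: "integrable circle_measure f" "integrable circle_measure g"
    using assms by (auto simp: has_weak_deriv_def)
  then show "integrable circle_measure (\<lambda>\<theta>. f \<theta> \<bullet> b)" "integrable circle_measure (\<lambda>\<theta>. g \<theta> \<bullet> b)"
    by auto
  fix \<phi> :: "real \<Rightarrow> real" assume \<phi>: "circle_test_function \<phi>"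
  note i = integrable_circle_test_mult[OF \<phi>]
  have "(\<integral>\<theta>. (deriv ^^ k) \<phi> \<theta> *\<^sub>R f \<theta> \<partial>circle_measure) \<bullet> b
      = ((- 1) ^ k *\<^sub>R (\<integral>\<theta>. \<phi> \<theta> *\<^sub>R g \<theta> \<partial>circle_measure)) \<bullet> b"
    using assms \<phi> by (auto simp: has_weak_deriv_def)
  then show "(\<integral>\<theta>. (deriv ^^ k) \<phi> \<theta> *\<^sub>R (f \<theta> \<bullet> b) \<partial>circle_measure)
      = (- 1) ^ k *\<^sub>R (\<integral>\<theta>. \<phi> \<theta> *\<^sub>R (g \<theta> \<bullet> b) \<partial>circle_measure)"
    using i[OF int(1), of k] i[OF int(2), of 0]
    by (simp add: integral_inner_left[symmetric] del: integral_inner_left)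
qed

text \<open>In each component both candidates have the Fourier coefficients dictated by
  \<open>f\<close>. This makes integrals of the chosen \<open>weak_deriv\<close> computable from any
  explicit weak derivative.\<close>

lemma has_weak_deriv_unique:
  fixes f g g' :: "real \<Rightarrow> 'a::euclidean_space"
  assumes "has_weak_deriv k f g" "has_weak_deriv k f g'"
  shows "AE \<theta> in circle_measure. g \<theta> = g' \<theta>"
proof -
  have "AE \<theta> in circle_measure. g \<theta> \<bullet> b = g' \<theta> \<bullet> b" for b
    using has_weak_deriv_inner[OF assms(1), of b] has_weak_deriv_inner[OF assms(2), of b]
    by (intro AE_eq_fourier_coeff) (auto simp: has_weak_deriv_def
        fourier_coeff_weak_deriv[OF has_weak_deriv_inner[OF assms(1)]]
        fourier_coeff_weak_deriv[OF has_weak_deriv_inner[OF assms(2)]])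
  then have "AE \<theta> in circle_measure. \<forall>b\<in>Basis. g \<theta> \<bullet> b = g' \<theta> \<bullet> b"
    by (intro AE_ball_countable[THEN iffD2]) (auto intro: countable_finite)
  then show ?thesis
    by eventually_elim (auto intro: euclidean_eqI)
qed

lemma has_weak_deriv_weak_deriv:
  assumes "has_weak_deriv k f g"
  shows "has_weak_deriv k f (weak_deriv k f)"
  unfolding weak_deriv_def using assms by (rule someI[where P = "has_weak_deriv k f"])

lemma AE_weak_deriv_eq:
  assumes "has_weak_deriv k f g"
  shows "AE \<theta> in circle_measure. weak_deriv k f \<theta> = g \<theta>"
  by (rule has_weak_deriv_unique[OF has_weak_deriv_weak_deriv[OF assms] assms])

lemma has_weak_deriv_0: "integrable circle_measure f \<Longrightarrow> has_weak_deriv 0 f f"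
  by (simp add: has_weak_deriv_def)

section \<open>Bessel and Parseval\<close>

lemma has_weak_deriv_add:
  fixes f f' g g' :: "real \<Rightarrow> 'a::euclidean_space"
  assumes "has_weak_deriv k f f'" "has_weak_deriv k g g'"
  shows "has_weak_deriv k (\<lambda>\<theta>. f \<theta> + g \<theta>) (\<lambda>\<theta>. f' \<theta> + g' \<theta>)"
  unfolding has_weak_deriv_def
proof (intro conjI allI impI)
  have int: "integrable circle_measure f" "integrable circle_measure g"
    "integrable circle_measure f'" "integrable circle_measure g'"
    using assms by (auto simp: has_weak_deriv_def)
  then show "integrable circle_measure (\<lambda>\<theta>. f \<theta> + g \<theta>)"
    "integrable circle_measure (\<lambda>\<theta>. f' \<theta> + g' \<theta>)" by auto
  fix \<phi> :: "real \<Rightarrow> real" assume \<phi>: "circle_test_function \<phi>"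
  have "(\<integral>\<theta>. (deriv ^^ k) \<phi> \<theta> *\<^sub>R f \<theta> \<partial>circle_measure) = (-1)^k *\<^sub>R (\<integral>\<theta>. \<phi> \<theta> *\<^sub>R f' \<theta> \<partial>circle_measure)"
    "(\<integral>\<theta>. (deriv ^^ k) \<phi> \<theta> *\<^sub>R g \<theta> \<partial>circle_measure) = (-1)^k *\<^sub>R (\<integral>\<theta>. \<phi> \<theta> *\<^sub>R g' \<theta> \<partial>circle_measure)"
    using assms \<phi> by (auto simp: has_weak_deriv_def)
  then show "(\<integral>\<theta>. (deriv ^^ k) \<phi> \<theta> *\<^sub>R (f \<theta> + g \<theta>) \<partial>circle_measure)
      = (- 1) ^ k *\<^sub>R (\<integral>\<theta>. \<phi> \<theta> *\<^sub>R (f' \<theta> + g' \<theta>) \<partial>circle_measure)"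
    using integrable_circle_test_mult[OF \<phi> int(1), of k] integrable_circle_test_mult[OF \<phi> int(2), of k]
      integrable_circle_test_mult[OF \<phi> int(3), of 0] integrable_circle_test_mult[OF \<phi> int(4), of 0]
    by (simp add: scaleR_add_right)
qed

lemma has_weak_deriv_scaleR:
  fixes f f' :: "real \<Rightarrow> 'a::euclidean_space"
  assumes "has_weak_deriv k f f'"
  shows "has_weak_deriv k (\<lambda>\<theta>. c *\<^sub>R f \<theta>) (\<lambda>\<theta>. c *\<^sub>R f' \<theta>)"
proof -
  have "(\<integral>\<theta>. u \<theta> *\<^sub>R c *\<^sub>R v \<theta> \<partial>circle_measure) = c *\<^sub>R (\<integral>\<theta>. u \<theta> *\<^sub>R v \<theta> \<partial>circle_measure)"
    for u and v :: "real \<Rightarrow> 'a"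
    by (subst integral_scaleR_right[symmetric]) (simp add: scaleR_left_commute[of _ c] del: scaleR_scaleR)
  then show ?thesis
    using assms unfolding has_weak_deriv_def by (simp add: scaleR_left_commute[of _ c] del: scaleR_scaleR)
qed

lemma has_weak_deriv_diff:
  fixes f f' g g' :: "real \<Rightarrow> 'a::euclidean_space"
  assumes "has_weak_deriv k f f'" "has_weak_deriv k g g'"
  shows "has_weak_deriv k (\<lambda>\<theta>. f \<theta> - g \<theta>) (\<lambda>\<theta>. f' \<theta> - g' \<theta>)"
  using has_weak_deriv_add[OF assms(1) has_weak_deriv_scaleR[OF assms(2), of "-1"]] by simp

lemma has_weak_deriv_of_real:
  assumes "has_weak_deriv k f g"
  shows "has_weak_deriv k (\<lambda>\<theta>. complex_of_real (f \<theta>)) (\<lambda>\<theta>. complex_of_real (g \<theta>))"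
  using assms by (auto simp: has_weak_deriv_def scaleR_conv_of_real
      simp flip: of_real_mult) (simp_all add: of_real_mult)

lemma has_weak_deriv_1_const: "has_weak_deriv 1 (\<lambda>_. c :: real) (\<lambda>_. 0)"
  using has_weak_deriv_Re_cis[of "of_real c" 0] by simp

section \<open>Square integrable functions and Bessel's inequality\<close>

abbreviation square_integrable :: "(real \<Rightarrow> real) \<Rightarrow> bool" where
  "square_integrable f \<equiv>
     f \<in> borel_measurable circle_measure \<and> integrable circle_measure (\<lambda>\<theta>. (f \<theta>)\<^sup>2)"

lemma square_integrable_integrable:
  assumes "square_integrable f"
  shows "integrable circle_measure f"
proof (rule Bochner_Integration.integrable_bound)
  show "integrable circle_measure (\<lambda>\<theta>. 1 + (f \<theta>)\<^sup>2)"
    using assms by (intro Bochner_Integration.integrable_add) auto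
  have "\<bar>f \<theta>\<bar> \<le> 1 + (f \<theta>)\<^sup>2" for \<theta>
    using sum_squares_bound[of 1 "\<bar>f \<theta>\<bar>"] by simp
  then show "AE \<theta> in circle_measure. norm (f \<theta>) \<le> norm (1 + (f \<theta>)\<^sup>2)"
    by (auto intro!: AE_I2 simp: abs_of_nonneg)
qed (use assms in auto)

lemma square_integrable_mult:
  assumes "square_integrable f" "square_integrable g"
  shows "integrable circle_measure (\<lambda>\<theta>. f \<theta> * g \<theta>)"
proof (rule Bochner_Integration.integrable_bound)
  show "integrable circle_measure (\<lambda>\<theta>. (f \<theta>)\<^sup>2 + (g \<theta>)\<^sup>2)" using assms by simp
  have "\<bar>f \<theta> * g \<theta>\<bar> \<le> (f \<theta>)\<^sup>2 + (g \<theta>)\<^sup>2" for \<theta>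
    using sum_squares_bound[of "\<bar>f \<theta>\<bar>" "\<bar>g \<theta>\<bar>"]
      mult_nonneg_nonneg[OF abs_ge_zero[of "f \<theta>"] abs_ge_zero[of "g \<theta>"]]
    unfolding abs_mult power2_abs by linarith
  then show "AE \<theta> in circle_measure. norm (f \<theta> * g \<theta>) \<le> norm ((f \<theta>)\<^sup>2 + (g \<theta>)\<^sup>2)"
    by (auto intro!: AE_I2 simp: abs_of_nonneg)
qed (use assms in auto)

lemma square_integrable_add:
  assumes "square_integrable f" "square_integrable g"
  shows "square_integrable (\<lambda>\<theta>. f \<theta> + g \<theta>)"
  using assms square_integrable_mult[OF assms] by (auto simp: power2_sum mult.assoc)

lemma square_integrable_cmult:
  assumes "square_integrable f"
  shows "square_integrable (\<lambda>\<theta>. c * f \<theta>)"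
  using assms by (auto simp: power_mult_distrib)

lemma square_integrable_diff:
  assumes "square_integrable f" "square_integrable g"
  shows "square_integrable (\<lambda>\<theta>. f \<theta> - g \<theta>)"
  using square_integrable_add[OF assms(1) square_integrable_cmult[OF assms(2), of "-1"]] by simp

lemma square_integrable_continuous:
  assumes "continuous_on UNIV f"
  shows "square_integrable f"
  using assms by (auto intro!: measurable_circle_continuous integrable_circle_continuous continuous_intros)

lemma square_integrable_cong_AE:
  assumes "AE \<theta> in circle_measure. f \<theta> = g \<theta>" "square_integrable f"
    "g \<in> borel_measurable circle_measure"
  shows "square_integrable g"
proof -
  have "AE \<theta> in circle_measure. (f \<theta>)\<^sup>2 = (g \<theta>)\<^sup>2" using assms(1) by eventually_elim simp
  then show ?thesis
    using assms(2,3) integrable_cong_AE[of "\<lambda>\<theta>. (f \<theta>)\<^sup>2" circle_measure "\<lambda>\<theta>. (g \<theta>)\<^sup>2"] by auto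
qed

text \<open>Expand \<open>\<bar>f - P\<bar>\<^sup>2 \<ge> 0\<close> for the Fourier partial sum
  \<open>P\<close> over \<open>S\<close>; the mixed integral and the integral of
  \<open>P * cnj P\<close> have the same value.\<close>

lemma bessel_inequality:
  assumes f: "square_integrable f" and S: "finite S"
  shows "2 * pi * (\<Sum>n\<in>S. (norm (fourier_coeff f n))\<^sup>2) \<le> (\<integral>\<theta>. (f \<theta>)\<^sup>2 \<partial>circle_measure)"
proof -
  have fi: "integrable circle_measure f" by (rule square_integrable_integrable[OF f])
  define P where "P = (\<lambda>\<theta>. \<Sum>n\<in>S. fourier_coeff f n * cis (of_int n * \<theta>))"
  have cP: "continuous_on UNIV P" unfolding P_def by (intro continuous_intros)
  have cnjP: "cnj (P \<theta>) = (\<Sum>n\<in>S. cnj (fourier_coeff f n) * cis (of_int (- n) * \<theta>))" for \<theta>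
    by (simp add: P_def cis_cnj)
  have fP: "integrable circle_measure (\<lambda>\<theta>. of_real (f \<theta>) * cnj (P \<theta>)) \<and>
      (\<integral>\<theta>. of_real (f \<theta>) * cnj (P \<theta>) \<partial>circle_measure)
        = of_real (2 * pi * (\<Sum>n\<in>S. (norm (fourier_coeff f n))\<^sup>2))"
  proof -
    have eq: "(\<lambda>\<theta>. of_real (f \<theta>) * cnj (P \<theta>)) =
        (\<lambda>\<theta>. \<Sum>n\<in>S. cnj (fourier_coeff f n) * (of_real (f \<theta>) * cis (of_int (- n) * \<theta>)))"
      unfolding cnjP by (auto simp: sum_distrib_left mult_ac)
    have int: "integrable circle_measure
        (\<lambda>\<theta>. cnj (fourier_coeff f n) * (of_real (f \<theta>) * cis (of_int (- n) * \<theta>)))" for n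
      by (intro integrable_mult_right integrable_circle_cis fi)
    have "(\<integral>\<theta>. of_real (f \<theta>) * cnj (P \<theta>) \<partial>circle_measure)
        = (\<Sum>n\<in>S. \<integral>\<theta>. cnj (fourier_coeff f n) *
            (of_real (f \<theta>) * cis (of_int (- n) * \<theta>)) \<partial>circle_measure)"
      unfolding eq by (rule Bochner_Integration.integral_sum) (rule int)
    also have "\<dots> = (\<Sum>n\<in>S. cnj (fourier_coeff f n) * (2 * pi * fourier_coeff f n))"
      by (simp only: integral_mult_right_zero integral_cis_fourier_coeff minus_minus)
    also have "\<dots> = of_real (2 * pi * (\<Sum>n\<in>S. (norm (fourier_coeff f n))\<^sup>2))"
      by (simp add: sum_distrib_left complex_norm_square mult_ac del: of_real_power)
    finally show ?thesis
      unfolding eq by (intro conjI Bochner_Integration.integrable_sum int)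
  qed
  have PP: "(\<integral>\<theta>. P \<theta> * cnj (P \<theta>) \<partial>circle_measure)
      = of_real (2 * pi * (\<Sum>n\<in>S. (norm (fourier_coeff f n))\<^sup>2))"
  proof -
    have eq: "P \<theta> * cnj (P \<theta>) = (\<Sum>n\<in>S. \<Sum>m\<in>S.
        (fourier_coeff f n * cnj (fourier_coeff f m)) * cis (of_int (n - m) * \<theta>))" for \<theta>
    proof -
      have "cis (of_int n * \<theta>) * cis (of_int (- m) * \<theta>) = cis (of_int (n - m) * \<theta>)" for n m
        by (simp add: cis_mult left_diff_distrib)
      then show ?thesis
        unfolding cnjP unfolding P_def sum_product by (intro sum.cong refl) (simp add: mult_ac)
    qed
    have int: "integrable circle_measure
        (\<lambda>\<theta>. (fourier_coeff f n * cnj (fourier_coeff f m)) * cis (of_int (n - m) * \<theta>))" for n m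
      by (intro integrable_circle_continuous continuous_intros)
    have "(\<integral>\<theta>. P \<theta> * cnj (P \<theta>) \<partial>circle_measure)
        = (\<Sum>n\<in>S. \<Sum>m\<in>S. (fourier_coeff f n * cnj (fourier_coeff f m)) *
            (\<integral>\<theta>. cis (of_int (n - m) * \<theta>) \<partial>circle_measure))"
    proof -
      have "(\<integral>\<theta>. P \<theta> * cnj (P \<theta>) \<partial>circle_measure)
          = (\<Sum>n\<in>S. \<integral>\<theta>. (\<Sum>m\<in>S. (fourier_coeff f n * cnj (fourier_coeff f m)) *
              cis (of_int (n - m) * \<theta>)) \<partial>circle_measure)"
        unfolding eq
        by (rule Bochner_Integration.integral_sum)
           (rule Bochner_Integration.integrable_sum, rule int)
      also have "\<dots> = (\<Sum>n\<in>S. \<Sum>m\<in>S. \<integral>\<theta>. (fourier_coeff f n * cnj (fourier_coeff f m)) *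
              cis (of_int (n - m) * \<theta>) \<partial>circle_measure)"
        by (rule sum.cong[OF refl], rule Bochner_Integration.integral_sum) (rule int)
      finally show ?thesis by (simp only: integral_mult_right_zero)
    qed
    also have "\<dots> = (\<Sum>n\<in>S. \<Sum>m\<in>S. if m = n then of_real (2 * pi * (norm (fourier_coeff f n))\<^sup>2) else 0)"
      unfolding integral_cis
      by (intro sum.cong refl) (simp add: complex_norm_square del: of_real_power)
    also have "\<dots> = of_real (2 * pi * (\<Sum>n\<in>S. (norm (fourier_coeff f n))\<^sup>2))"
      using S by (simp add: sum_distrib_left)
    finally show ?thesis .
  qed
  \<comment> \<open>The real part of \<open>Q\<close> is the square of \<open>f\<close> minus the
    squared modulus of \<open>f - P\<close>.\<close>
  define Q where "Q = (\<lambda>\<theta>. 2 * (of_real (f \<theta>) * cnj (P \<theta>)) - P \<theta> * cnj (P \<theta>))"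
  have i1: "integrable circle_measure (\<lambda>\<theta>. 2 * (of_real (f \<theta>) * cnj (P \<theta>)))"
    using fP by (intro integrable_mult_right) blast
  have i2: "integrable circle_measure (\<lambda>\<theta>. P \<theta> * cnj (P \<theta>))"
    by (intro integrable_circle_continuous continuous_intros cP)
  have Qi: "integrable circle_measure Q"
    unfolding Q_def by (rule Bochner_Integration.integrable_diff[OF i1 i2])
  have "(\<integral>\<theta>. Q \<theta> \<partial>circle_measure) = 2 * (\<integral>\<theta>. of_real (f \<theta>) * cnj (P \<theta>) \<partial>circle_measure)
      - (\<integral>\<theta>. P \<theta> * cnj (P \<theta>) \<partial>circle_measure)"
    unfolding Q_def by (simp only: Bochner_Integration.integral_diff[OF i1 i2] integral_mult_right_zero)
  also have "\<dots> = of_real (2 * pi * (\<Sum>n\<in>S. (norm (fourier_coeff f n))\<^sup>2))"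
    unfolding PP conjunct2[OF fP] by simp
  finally have "(\<integral>\<theta>. Q \<theta> \<partial>circle_measure) = of_real (2 * pi * (\<Sum>n\<in>S. (norm (fourier_coeff f n))\<^sup>2))" .
  then have "2 * pi * (\<Sum>n\<in>S. (norm (fourier_coeff f n))\<^sup>2) = Re (\<integral>\<theta>. Q \<theta> \<partial>circle_measure)"
    by (simp only: Re_complex_of_real)
  also have "\<dots> = (\<integral>\<theta>. Re (Q \<theta>) \<partial>circle_measure)" by (rule integral_Re[OF Qi, symmetric])
  also have "\<dots> \<le> (\<integral>\<theta>. (f \<theta>)\<^sup>2 \<partial>circle_measure)"
  proof (rule integral_mono)
    show "integrable circle_measure (\<lambda>\<theta>. Re (Q \<theta>))" using Qi by simp
    show "integrable circle_measure (\<lambda>\<theta>. (f \<theta>)\<^sup>2)" using f by simp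
    fix \<theta>
    have "0 \<le> (f \<theta> - Re (P \<theta>))\<^sup>2 + (Im (P \<theta>))\<^sup>2" by simp
    then show "Re (Q \<theta>) \<le> (f \<theta>)\<^sup>2"
      by (simp add: Q_def power2_eq_square algebra_simps)
  qed
  finally show ?thesis .
qed

section \<open>Absolutely convergent Fourier series and Parseval's identity\<close>

definition fourier_series :: "(int \<Rightarrow> complex) \<Rightarrow> real \<Rightarrow> complex" where
  "fourier_series a \<theta> = (\<Sum>\<^sub>\<infinity>n. a n * cis (of_int n * \<theta>))"

lemma fourier_series_uniform:
  assumes "(\<lambda>n. norm (a n)) summable_on UNIV"
  shows "uniform_limit UNIV (\<lambda>S \<theta>. \<Sum>n\<in>S. a n * cis (of_int n * \<theta>)) (fourier_series a)
     (finite_subsets_at_top UNIV)"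
  unfolding fourier_series_def[abs_def]
  by (rule Weierstrass_m_test_general[OF _ assms]) (simp add: norm_mult)

lemma continuous_fourier_series:
  assumes "(\<lambda>n. norm (a n)) summable_on UNIV"
  shows "continuous_on UNIV (fourier_series a)"
  by (rule uniform_limit_theorem[OF _ fourier_series_uniform[OF assms]])
     (auto intro!: always_eventually continuous_intros)

lemma norm_fourier_series_le:
  assumes "(\<lambda>n. norm (a n)) summable_on UNIV"
  shows "norm (fourier_series a \<theta>) \<le> (\<Sum>\<^sub>\<infinity>n. norm (a n))"
  unfolding fourier_series_def
  using norm_infsum_bound[of "\<lambda>n. a n * cis (of_int n * \<theta>)" UNIV] assms
  by (simp add: norm_mult)

text \<open>Absolute summability makes the partial sums converge uniformly, so they may be
  integrated termwise against any integrable \<open>k\<close>, with no square integrability asked of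
  \<open>k\<close>.\<close>

lemma integral_fourier_series:
  fixes k :: "real \<Rightarrow> complex"
  assumes a: "(\<lambda>n. norm (a n)) summable_on UNIV" and k: "integrable circle_measure k"
  shows "((\<lambda>n. a n * (\<integral>\<theta>. cis (of_int n * \<theta>) * k \<theta> \<partial>circle_measure)) has_sum
     (\<integral>\<theta>. fourier_series a \<theta> * k \<theta> \<partial>circle_measure)) UNIV"
proof -
  let ?F = "finite_subsets_at_top (UNIV :: int set)"
  define P where "P = (\<lambda>S \<theta>. \<Sum>n\<in>S. a n * cis (of_int n * \<theta>))"
  have cP: "continuous_on UNIV (P S)" for S unfolding P_def by (intro continuous_intros)
  have bd: "integrable circle_measure (\<lambda>\<theta>. G \<theta> * k \<theta>)" if G: "continuous_on UNIV G" for G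
  proof -
    have "compact (G ` {0..2*pi})"
      using G by (intro compact_continuous_image) (auto intro: continuous_on_subset)
    then have "bounded (G ` {0..2*pi})" by (rule compact_imp_bounded)
    then obtain B where B: "\<And>z. z \<in> {0..2*pi} \<Longrightarrow> norm (G z) \<le> B"
      unfolding bounded_iff by blast
    show ?thesis
      by (rule integrable_circle_mult_bounded[OF k measurable_circle_continuous[OF G], of B],
          intro AE_I2, simp add: B)
  qed
  have eq: "(\<integral>\<theta>. P S \<theta> * k \<theta> \<partial>circle_measure)
      = (\<Sum>n\<in>S. a n * (\<integral>\<theta>. cis (of_int n * \<theta>) * k \<theta> \<partial>circle_measure))" for S
  proof -
    have "(\<lambda>\<theta>. P S \<theta> * k \<theta>) = (\<lambda>\<theta>. \<Sum>n\<in>S. a n * (cis (of_int n * \<theta>) * k \<theta>))"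
      by (simp add: P_def sum_distrib_right mult.assoc)
    moreover have "integrable circle_measure (\<lambda>\<theta>. a n * (cis (of_int n * \<theta>) * k \<theta>))" for n
      by (intro integrable_mult_right bd continuous_intros)
    ultimately show ?thesis by (simp add: Bochner_Integration.integral_sum)
  qed
  define J where "J = (\<integral>\<theta>. norm (k \<theta>) \<partial>circle_measure)"
  have J: "J \<ge> 0" by (simp add: J_def)
  have "((\<lambda>S. \<integral>\<theta>. P S \<theta> * k \<theta> \<partial>circle_measure) \<longlongrightarrow>
      (\<integral>\<theta>. fourier_series a \<theta> * k \<theta> \<partial>circle_measure)) ?F"
  proof (rule tendstoI)
    fix e :: real assume e: "e > 0"
    define d where "d = e / (J + 1)"
    have d: "d > 0" using J e by (simp add: d_def)
    have "\<forall>\<^sub>F S in ?F. \<forall>\<theta>\<in>UNIV. dist (P S \<theta>) (fourier_series a \<theta>) < d"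
      using uniform_limitD[OF fourier_series_uniform[OF a] d] by (simp add: P_def)
    then show "\<forall>\<^sub>F S in ?F. dist (\<integral>\<theta>. P S \<theta> * k \<theta> \<partial>circle_measure)
        (\<integral>\<theta>. fourier_series a \<theta> * k \<theta> \<partial>circle_measure) < e"
    proof eventually_elim
      case (elim S)
      have "norm ((\<integral>\<theta>. P S \<theta> * k \<theta> \<partial>circle_measure) - (\<integral>\<theta>. fourier_series a \<theta> * k \<theta> \<partial>circle_measure))
          = norm (\<integral>\<theta>. P S \<theta> * k \<theta> - fourier_series a \<theta> * k \<theta> \<partial>circle_measure)"
        using bd[OF cP] bd[OF continuous_fourier_series[OF a]] by simp
      also have "\<dots> \<le> (\<integral>\<theta>. d * norm (k \<theta>) \<partial>circle_measure)"
      proof (rule integral_norm_bound[THEN order_trans], rule integral_mono)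
        show "integrable circle_measure (\<lambda>\<theta>. norm (P S \<theta> * k \<theta> - fourier_series a \<theta> * k \<theta>))"
          using bd[OF cP] bd[OF continuous_fourier_series[OF a]] by simp
        show "norm (P S \<theta> * k \<theta> - fourier_series a \<theta> * k \<theta>) \<le> d * norm (k \<theta>)" for \<theta>
          using elim by (auto simp: left_diff_distrib[symmetric] norm_mult dist_norm less_imp_le
              intro!: mult_right_mono)
      qed (use k in auto)
      also have "\<dots> = d * J" by (simp add: J_def)
      also have "\<dots> < e" using e J by (simp add: d_def field_simps)
      finally show ?case by (simp add: dist_norm)
    qed
  qed
  then show ?thesis by (simp add: has_sum_def eq)
qed

text \<open>Termwise integration shows that the series has the coefficients of \<open>f\<close>;
  uniqueness does the rest.\<close>

lemma AE_eq_fourier_series: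
  assumes f: "integrable circle_measure (f :: real \<Rightarrow> real)"
    and a: "(\<lambda>n. norm (fourier_coeff f n)) summable_on UNIV"
  shows "AE \<theta> in circle_measure. f \<theta> = Re (fourier_series (fourier_coeff f) \<theta>)"
proof (rule AE_eq_fourier_coeff[OF f])
  let ?s = "fourier_series (fourier_coeff f)"
  have cs: "continuous_on UNIV ?s" by (rule continuous_fourier_series[OF a])
  show "integrable circle_measure (\<lambda>\<theta>. Re (?s \<theta>))"
    by (intro integrable_circle_continuous continuous_intros cs)
  have I: "(\<integral>\<theta>. ?s \<theta> * cis (of_int m * \<theta>) \<partial>circle_measure) = 2 * pi * fourier_coeff f (- m)" for m
  proof -
    have "((\<lambda>n. fourier_coeff f n * (\<integral>\<theta>. cis (of_int n * \<theta>) * cis (of_int m * \<theta>) \<partial>circle_measure))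
        has_sum (\<integral>\<theta>. ?s \<theta> * cis (of_int m * \<theta>) \<partial>circle_measure)) UNIV"
      by (intro integral_fourier_series a integrable_circle_continuous continuous_intros)
    moreover have "(\<integral>\<theta>. cis (of_int n * \<theta>) * cis (of_int m * \<theta>) \<partial>circle_measure)
        = (if n = - m then 2 * pi else 0)" for n
    proof -
      have "(\<lambda>\<theta>. cis (of_int n * \<theta>) * cis (of_int m * \<theta>)) = (\<lambda>\<theta>. cis (of_int (n + m) * \<theta>))"
        by (simp add: cis_mult algebra_simps)
      then show ?thesis by (simp only: integral_cis) auto
    qed
    ultimately have "((\<lambda>n. fourier_coeff f n * (if n = - m then 2 * pi else 0))
        has_sum (\<integral>\<theta>. ?s \<theta> * cis (of_int m * \<theta>) \<partial>circle_measure)) UNIV"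
      by simp
    moreover have "((\<lambda>n. fourier_coeff f n * of_real (if n = - m then 2 * pi else 0))
        has_sum (fourier_coeff f (- m) * (2 * pi))) UNIV"
      by (rule has_sum_finite_neutralI[of "{- m}"]) auto
    ultimately show ?thesis using has_sum_unique by (fastforce simp: mult.commute)
  qed
  fix m
  have i: "integrable circle_measure (\<lambda>\<theta>. ?s \<theta> * cis (of_int m * \<theta>))" for m
    by (intro integrable_circle_continuous continuous_intros cs)
  let ?g = "\<lambda>\<theta>. cnj (?s \<theta> * cis (of_int m * \<theta>))"
  have i': "integrable circle_measure ?g" by (rule integrable_cnj[OF i])
  \<comment> \<open>The real part is the average of the series and its conjugate, and both halves
    contribute the same coefficient because \<open>f\<close> is real.\<close>
  have "(\<integral>\<theta>. of_real (Re (?s \<theta>)) * cis (of_int (- m) * \<theta>) \<partial>circle_measure)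
      = (\<integral>\<theta>. (?s \<theta> * cis (of_int (- m) * \<theta>) + ?g \<theta>) / 2 \<partial>circle_measure)"
    by (intro Bochner_Integration.integral_cong refl) (simp add: cis_cnj complex_eq_iff field_simps)
  also have "\<dots> = ((\<integral>\<theta>. ?s \<theta> * cis (of_int (- m) * \<theta>) \<partial>circle_measure)
      + (\<integral>\<theta>. ?g \<theta> \<partial>circle_measure)) / 2"
    unfolding integral_divide_zero by (simp only: Bochner_Integration.integral_add[OF i i'])
  also have "(\<integral>\<theta>. ?g \<theta> \<partial>circle_measure) = cnj (\<integral>\<theta>. ?s \<theta> * cis (of_int m * \<theta>) \<partial>circle_measure)"
    by (rule Bochner_Integration.integral_cnj)
  also have "\<dots> = 2 * pi * fourier_coeff f m"
    unfolding I by (simp add: fourier_coeff_minus)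
  also have "(\<integral>\<theta>. ?s \<theta> * cis (of_int (- m) * \<theta>) \<partial>circle_measure) = 2 * pi * fourier_coeff f m"
    unfolding I by simp
  finally show "fourier_coeff f m = fourier_coeff (\<lambda>\<theta>. Re (?s \<theta>)) m"
    unfolding integral_cis_fourier_coeff by simp
qed

lemma AE_bound_fourier_coeff:
  assumes f: "integrable circle_measure (f :: real \<Rightarrow> real)"
    and a: "(\<lambda>n. norm (fourier_coeff f n)) summable_on UNIV"
  shows "AE \<theta> in circle_measure. \<bar>f \<theta>\<bar> \<le> (\<Sum>\<^sub>\<infinity>n. norm (fourier_coeff f n))"
  using AE_eq_fourier_series[OF assms]
proof eventually_elim
  case (elim \<theta>)
  then show ?case
    using norm_fourier_series_le[OF a, of \<theta>] abs_Re_le_cmod[of "fourier_series (fourier_coeff f) \<theta>"]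
    by linarith
qed

text \<open>The asymmetric hypotheses fit the dissipation identity, where \<open>f\<close> becomes
  the velocity of an \<open>H\<^sup>4\<close> function and \<open>k\<close> the flux. Representing
  \<open>f\<close> by its uniformly convergent series takes the place of completeness in
  \<open>L\<^sub>2\<close>.\<close>

lemma parseval:
  fixes f k :: "real \<Rightarrow> real"
  assumes f: "integrable circle_measure f"
    and a: "(\<lambda>n. norm (fourier_coeff f n)) summable_on UNIV"
    and k: "integrable circle_measure k"
  shows "((\<lambda>n. 2 * pi * Re (fourier_coeff f n * cnj (fourier_coeff k n))) has_sum
     (\<integral>\<theta>. f \<theta> * k \<theta> \<partial>circle_measure)) UNIV"
proof -
  let ?s = "fourier_series (fourier_coeff f)"
  have cs: "continuous_on UNIV ?s" by (rule continuous_fourier_series[OF a])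
  have ki: "integrable circle_measure (\<lambda>\<theta>. complex_of_real (k \<theta>))" using k by simp
  have "((\<lambda>n. fourier_coeff f n * (\<integral>\<theta>. cis (of_int n * \<theta>) * of_real (k \<theta>) \<partial>circle_measure))
      has_sum (\<integral>\<theta>. ?s \<theta> * of_real (k \<theta>) \<partial>circle_measure)) UNIV"
    by (rule integral_fourier_series[OF a ki])
  moreover have "(\<integral>\<theta>. cis (of_int n * \<theta>) * of_real (k \<theta>) \<partial>circle_measure)
      = of_real (2 * pi) * cnj (fourier_coeff k n)" for n
    using integral_cis_fourier_coeff[of k n] by (simp add: fourier_coeff_minus mult.commute)
  ultimately have "((\<lambda>n. Re (fourier_coeff f n * (of_real (2 * pi) * cnj (fourier_coeff k n))))
      has_sum Re (\<integral>\<theta>. ?s \<theta> * of_real (k \<theta>) \<partial>circle_measure)) UNIV"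
    by (intro has_sum_Re) simp
  moreover have "Re (\<integral>\<theta>. ?s \<theta> * of_real (k \<theta>) \<partial>circle_measure) = (\<integral>\<theta>. f \<theta> * k \<theta> \<partial>circle_measure)"
  proof -
    have "integrable circle_measure (\<lambda>\<theta>. ?s \<theta> * of_real (k \<theta>))"
      using a by (intro integrable_circle_mult_bounded[OF ki measurable_circle_continuous[OF cs],
            of "\<Sum>\<^sub>\<infinity>n. norm (fourier_coeff f n)"] AE_I2 norm_fourier_series_le)
    then have "Re (\<integral>\<theta>. ?s \<theta> * of_real (k \<theta>) \<partial>circle_measure)
        = (\<integral>\<theta>. Re (?s \<theta> * of_real (k \<theta>)) \<partial>circle_measure)" by (simp only: integral_Re)
    also have "\<dots> = (\<integral>\<theta>. f \<theta> * k \<theta> \<partial>circle_measure)"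
    proof (rule integral_cong_AE)
      show "(\<lambda>\<theta>. Re (?s \<theta> * of_real (k \<theta>))) \<in> borel_measurable circle_measure"
        using measurable_circle_continuous[OF cs] k by measurable
      show "(\<lambda>\<theta>. f \<theta> * k \<theta>) \<in> borel_measurable circle_measure" using f k by measurable
      show "AE \<theta> in circle_measure. Re (?s \<theta> * of_real (k \<theta>)) = f \<theta> * k \<theta>"
        using AE_eq_fourier_series[OF f a] by eventually_elim simp
    qed
    finally show ?thesis .
  qed
  ultimately show ?thesis by (simp add: mult_ac)
qed

section \<open>Sobolev spaces on the circle\<close>

lemma sobolev_weak_deriv:
  fixes f :: "real \<Rightarrow> real"
  assumes "f \<in> sobolev k 2" "j \<le> k"
  shows "has_weak_deriv j f (weak_deriv j f)" "square_integrable (weak_deriv j f)"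
proof -
  obtain g where g: "has_weak_deriv j f g" "integrable circle_measure (\<lambda>\<theta>. norm (g \<theta>) powr 2)"
    using assms by (auto simp: sobolev_def)
  show w: "has_weak_deriv j f (weak_deriv j f)"
    by (rule has_weak_deriv_weak_deriv[OF g(1)])
  have "square_integrable g"
    using g by (auto simp: has_weak_deriv_def)
  moreover have "weak_deriv j f \<in> borel_measurable circle_measure"
    using w by (simp add: has_weak_deriv_def borel_measurable_integrable)
  ultimately show "square_integrable (weak_deriv j f)"
    by (rule square_integrable_cong_AE[OF has_weak_deriv_unique[OF g(1) w]])
qed

lemma sobolevI:
  fixes f :: "real \<Rightarrow> real"
  assumes "periodic f"
    "\<And>j. j \<le> k \<Longrightarrow> has_weak_deriv j f (g j)" "\<And>j. j \<le> k \<Longrightarrow> square_integrable (g j)"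
  shows "f \<in> sobolev k 2"
  unfolding sobolev_def mem_Collect_eq
proof (intro conjI allI impI)
  fix j assume "j \<le> k"
  then show "\<exists>g. has_weak_deriv j f g \<and> integrable circle_measure (\<lambda>\<theta>. norm (g \<theta>) powr 2)"
    using assms(2,3) by (intro exI[of _ "g j"]) simp
qed (rule assms)

lemma sobolev_mono: "f \<in> sobolev k p \<Longrightarrow> j \<le> k \<Longrightarrow> f \<in> sobolev j p"
  by (auto simp: sobolev_def)

lemma sobolev_square_integrable:
  fixes f :: "real \<Rightarrow> real"
  assumes "f \<in> sobolev k 2"
  shows "square_integrable f"
proof -
  note w = sobolev_weak_deriv[OF assms le0]
  have f: "integrable circle_measure f" using w(1) by (simp add: has_weak_deriv_def)
  have "AE \<theta> in circle_measure. weak_deriv 0 f \<theta> = f \<theta>"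
    by (rule AE_weak_deriv_eq[OF has_weak_deriv_0[OF f]])
  then show ?thesis
    using w(2) borel_measurable_integrable[OF f] by (rule square_integrable_cong_AE)
qed

lemma sobolev_integrable:
  fixes f :: "real \<Rightarrow> real"
  assumes "f \<in> sobolev k 2"
  shows "integrable circle_measure f"
  by (rule square_integrable_integrable[OF sobolev_square_integrable[OF assms]])

lemma sobolev_add:
  fixes f g :: "real \<Rightarrow> real"
  assumes "f \<in> sobolev k 2" "g \<in> sobolev k 2"
  shows "(\<lambda>\<theta>. f \<theta> + g \<theta>) \<in> sobolev k 2"
proof (rule sobolevI)
  show "periodic (\<lambda>\<theta>. f \<theta> + g \<theta>)" using assms by (simp add: sobolev_def periodic_def)
  fix j assume j: "j \<le> k"
  note W = sobolev_weak_deriv[OF assms(1) j] sobolev_weak_deriv[OF assms(2) j]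
  show "has_weak_deriv j (\<lambda>\<theta>. f \<theta> + g \<theta>) (\<lambda>\<theta>. weak_deriv j f \<theta> + weak_deriv j g \<theta>)"
    by (rule has_weak_deriv_add[OF W(1,3)])
  show "square_integrable (\<lambda>\<theta>. weak_deriv j f \<theta> + weak_deriv j g \<theta>)"
    by (rule square_integrable_add[OF W(2,4)])
qed

lemma sobolev_cmult:
  fixes f :: "real \<Rightarrow> real"
  assumes "f \<in> sobolev k 2"
  shows "(\<lambda>\<theta>. c * f \<theta>) \<in> sobolev k 2"
proof (rule sobolevI)
  show "periodic (\<lambda>\<theta>. c * f \<theta>)" using assms by (simp add: sobolev_def periodic_def)
  fix j assume j: "j \<le> k"
  note W = sobolev_weak_deriv[OF assms j]
  show "has_weak_deriv j (\<lambda>\<theta>. c * f \<theta>) (\<lambda>\<theta>. c * weak_deriv j f \<theta>)"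
    using has_weak_deriv_scaleR[OF W(1), of c] by simp
  show "square_integrable (\<lambda>\<theta>. c * weak_deriv j f \<theta>)"
    by (rule square_integrable_cmult[OF W(2)])
qed

lemma sobolev_diff:
  fixes f g :: "real \<Rightarrow> real"
  assumes "f \<in> sobolev k 2" "g \<in> sobolev k 2"
  shows "(\<lambda>\<theta>. f \<theta> - g \<theta>) \<in> sobolev k 2"
  using sobolev_add[OF assms(1) sobolev_cmult[OF assms(2), of "-1"]] by simp

lemma sobolev_norm_square_integrals:
  fixes f :: "real \<Rightarrow> real"
  shows "sobolev_norm k 2 f = sqrt (\<Sum>j\<le>k. \<integral>\<theta>. (weak_deriv j f \<theta>)\<^sup>2 \<partial>circle_measure)"
  by (simp add: sobolev_norm_def powr_half_sqrt sum_nonneg)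

lemma sobolev_norm_mono:
  fixes f :: "real \<Rightarrow> real"
  assumes "j \<le> k"
  shows "sobolev_norm j 2 f \<le> sobolev_norm k 2 f"
  unfolding sobolev_norm_square_integrals using assms
  by (intro real_sqrt_le_mono sum_mono2) auto

lemma sobolev_norm_nonneg: "0 \<le> sobolev_norm k p f"
  by (simp add: sobolev_norm_def)

text \<open>Frees the norm from the choice made by \<open>weak_deriv\<close>: any explicit weak
  derivative may be inserted.\<close>

lemma sobolev_norm_1:
  fixes f g :: "real \<Rightarrow> real"
  assumes "integrable circle_measure f" "has_weak_deriv 1 f g"
  shows "(sobolev_norm 1 2 f)\<^sup>2
    = (\<integral>\<theta>. (f \<theta>)\<^sup>2 \<partial>circle_measure) + (\<integral>\<theta>. (g \<theta>)\<^sup>2 \<partial>circle_measure)"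
proof -
  have *: "(\<integral>\<theta>. (weak_deriv j f \<theta>)\<^sup>2 \<partial>circle_measure) = (\<integral>\<theta>. (u \<theta>)\<^sup>2 \<partial>circle_measure)"
    if u: "has_weak_deriv j f u" for j u
  proof (rule integral_cong_AE)
    show "AE \<theta> in circle_measure. (weak_deriv j f \<theta>)\<^sup>2 = (u \<theta>)\<^sup>2"
      using AE_weak_deriv_eq[OF u] by eventually_elim simp
  qed (use u has_weak_deriv_weak_deriv[OF u] in \<open>auto simp: has_weak_deriv_def\<close>)
  have "(\<Sum>j\<le>1. \<integral>\<theta>. (weak_deriv j f \<theta>)\<^sup>2 \<partial>circle_measure)
      = (\<integral>\<theta>. (f \<theta>)\<^sup>2 \<partial>circle_measure) + (\<integral>\<theta>. (g \<theta>)\<^sup>2 \<partial>circle_measure)"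
    by (simp add: *[OF assms(2), unfolded One_nat_def] *[OF has_weak_deriv_0[OF assms(1)]])
  moreover have "0 \<le> (\<Sum>j\<le>1. \<integral>\<theta>. (weak_deriv j f \<theta>)\<^sup>2 \<partial>circle_measure)"
    by (intro sum_nonneg) simp
  ultimately show ?thesis by (simp only: sobolev_norm_square_integrals real_sqrt_pow2)
qed

lemma sobolev_norm_1':
  fixes f :: "real \<Rightarrow> real"
  assumes "f \<in> sobolev 1 2"
  shows "(sobolev_norm 1 2 f)\<^sup>2
    = (\<integral>\<theta>. (f \<theta>)\<^sup>2 \<partial>circle_measure) + (\<integral>\<theta>. (weak_deriv 1 f \<theta>)\<^sup>2 \<partial>circle_measure)"
  by (rule sobolev_norm_1[OF sobolev_integrable[OF assms] sobolev_weak_deriv(1)[OF assms order_refl]])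

text \<open>The weighted arithmetic-geometric inequality divides by the two norms. It is applied
  with strict upper bounds \<open>A\<close> and \<open>B\<close>, which are positive even if
  \<open>F\<close> or \<open>G\<close> vanishes, and the bounds are then let down to
  \<open>F\<close> and \<open>G\<close>.\<close>

lemma square_integral_cauchy_schwarz:
  assumes f: "square_integrable f" and g: "square_integrable g"
    and F: "(\<integral>\<theta>. (f \<theta>)\<^sup>2 \<partial>circle_measure) \<le> F\<^sup>2" "0 \<le> F"
    and G: "(\<integral>\<theta>. (g \<theta>)\<^sup>2 \<partial>circle_measure) \<le> G\<^sup>2" "0 \<le> G"
  shows "(\<integral>\<theta>. \<bar>f \<theta> * g \<theta>\<bar> \<partial>circle_measure) \<le> F * G"
proof -
  have bound: "(\<integral>\<theta>. \<bar>f \<theta> * g \<theta>\<bar> \<partial>circle_measure) \<le> A * B"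
    if "F < A" "G < B" for A B
  proof -
    have AB: "A > 0" "B > 0" using that F G by auto
    have "(\<integral>\<theta>. \<bar>f \<theta> * g \<theta>\<bar> \<partial>circle_measure)
        \<le> (\<integral>\<theta>. (B / (2 * A)) * (f \<theta>)\<^sup>2 + (A / (2 * B)) * (g \<theta>)\<^sup>2 \<partial>circle_measure)"
    proof (rule integral_mono)
      show "integrable circle_measure (\<lambda>\<theta>. \<bar>f \<theta> * g \<theta>\<bar>)"
        using square_integrable_mult[OF f g] by simp
      show "integrable circle_measure (\<lambda>\<theta>. (B / (2 * A)) * (f \<theta>)\<^sup>2 + (A / (2 * B)) * (g \<theta>)\<^sup>2)"
        using f g by (intro Bochner_Integration.integrable_add integrable_mult_right) auto
      fix \<theta>
      have "0 \<le> (B * \<bar>f \<theta>\<bar> - A * \<bar>g \<theta>\<bar>)\<^sup>2 / (2 * A * B)" using AB by simp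
      also have "\<dots> = (B / (2 * A)) * (f \<theta>)\<^sup>2 + (A / (2 * B)) * (g \<theta>)\<^sup>2 - \<bar>f \<theta> * g \<theta>\<bar>"
        using AB by (simp add: power2_diff power_mult_distrib abs_mult field_simps power2_eq_square)
      finally show "\<bar>f \<theta> * g \<theta>\<bar> \<le> (B / (2 * A)) * (f \<theta>)\<^sup>2 + (A / (2 * B)) * (g \<theta>)\<^sup>2" by simp
    qed
    also have "\<dots> = (B / (2 * A)) * (\<integral>\<theta>. (f \<theta>)\<^sup>2 \<partial>circle_measure)
        + (A / (2 * B)) * (\<integral>\<theta>. (g \<theta>)\<^sup>2 \<partial>circle_measure)"
      using f g by (subst Bochner_Integration.integral_add) auto
    also have "\<dots> \<le> (B / (2 * A)) * A\<^sup>2 + (A / (2 * B)) * B\<^sup>2"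
      using AB that F power_mono[of F A 2] G power_mono[of G B 2]
      by (intro add_mono mult_left_mono) (auto intro: order_trans)
    also have "\<dots> = A * B" using AB by (simp add: power2_eq_square field_simps)
    finally show ?thesis .
  qed
  have "((\<lambda>e. (F + e) * (G + e)) \<longlongrightarrow> (F + 0) * (G + 0)) (at_right 0)"
    by (intro tendsto_intros)
  moreover have "\<forall>\<^sub>F e in at_right 0. (\<integral>\<theta>. \<bar>f \<theta> * g \<theta>\<bar> \<partial>circle_measure) \<le> (F + e) * (G + e)"
    unfolding eventually_at_right_field by (intro exI[of _ 1]) (auto intro!: bound)
  ultimately show ?thesis
    by (intro tendsto_lowerbound[where F = "at_right 0"]) auto
qed

text \<open>Polar form of half the integral of \<open>f'\<^sup>2 - f\<^sup>2\<close>, a functional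
  whose \<open>L\<^sub>2\<close> gradient is \<open>- (f + f'')\<close>. For
  \<open>\<partial>\<^sub>th = - \<partial>\<^sub>\<theta>F\<close> its time derivative is therefore
  minus the integral of \<open>(f' + f''') * F\<close>, which explains the argument of
  \<open>psi\<close> in the flux.\<close>

definition energy_form :: "(real \<Rightarrow> real) \<Rightarrow> (real \<Rightarrow> real) \<Rightarrow> real" where
  "energy_form f g = ((\<integral>\<theta>. weak_deriv 1 f \<theta> * weak_deriv 1 g \<theta> \<partial>circle_measure)
     - (\<integral>\<theta>. f \<theta> * g \<theta> \<partial>circle_measure)) / 2"

lemma energy_form_commute: "energy_form f g = energy_form g f"
  by (simp add: energy_form_def mult.commute)

lemma energy_form_add_left:
  assumes f: "f \<in> sobolev 1 2" and f': "f' \<in> sobolev 1 2" and g: "g \<in> sobolev 1 2"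
  shows "energy_form (\<lambda>\<theta>. f \<theta> + f' \<theta>) g = energy_form f g + energy_form f' g"
proof -
  note D = sobolev_weak_deriv[OF f order_refl] sobolev_weak_deriv[OF f' order_refl]
    sobolev_weak_deriv[OF g order_refl]
  note S = sobolev_square_integrable[OF f] sobolev_square_integrable[OF f']
    sobolev_square_integrable[OF g]
  have "(\<integral>\<theta>. weak_deriv 1 (\<lambda>\<theta>. f \<theta> + f' \<theta>) \<theta> * weak_deriv 1 g \<theta> \<partial>circle_measure)
     = (\<integral>\<theta>. weak_deriv 1 f \<theta> * weak_deriv 1 g \<theta> + weak_deriv 1 f' \<theta> * weak_deriv 1 g \<theta> \<partial>circle_measure)"
  proof (rule integral_cong_AE)
    show "AE \<theta> in circle_measure. weak_deriv 1 (\<lambda>\<theta>. f \<theta> + f' \<theta>) \<theta> * weak_deriv 1 g \<theta>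
        = weak_deriv 1 f \<theta> * weak_deriv 1 g \<theta> + weak_deriv 1 f' \<theta> * weak_deriv 1 g \<theta>"
      using AE_weak_deriv_eq[OF has_weak_deriv_add[OF D(1) D(3)]]
      by eventually_elim (simp add: distrib_right)
    show "(\<lambda>\<theta>. weak_deriv 1 (\<lambda>\<theta>. f \<theta> + f' \<theta>) \<theta> * weak_deriv 1 g \<theta>) \<in> borel_measurable circle_measure"
      using sobolev_weak_deriv(2)[OF sobolev_add[OF f f'] order_refl] D(6)
      by (intro borel_measurable_times) auto
    show "(\<lambda>\<theta>. weak_deriv 1 f \<theta> * weak_deriv 1 g \<theta> + weak_deriv 1 f' \<theta> * weak_deriv 1 g \<theta>)
        \<in> borel_measurable circle_measure"
      using D by (intro borel_measurable_times borel_measurable_add) auto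
  qed
  then show ?thesis
    using square_integrable_mult[OF D(2) D(6)] square_integrable_mult[OF D(4) D(6)]
      square_integrable_mult[OF S(1) S(3)] square_integrable_mult[OF S(2) S(3)]
    by (simp add: energy_form_def distrib_right add_divide_distrib diff_divide_distrib)
qed

lemma energy_form_cmult_left:
  assumes f: "f \<in> sobolev 1 2" and g: "g \<in> sobolev 1 2"
  shows "energy_form (\<lambda>\<theta>. c * f \<theta>) g = c * energy_form f g"
proof -
  note D = sobolev_weak_deriv[OF f order_refl] sobolev_weak_deriv[OF g order_refl]
  have "(\<integral>\<theta>. weak_deriv 1 (\<lambda>\<theta>. c * f \<theta>) \<theta> * weak_deriv 1 g \<theta> \<partial>circle_measure)
     = (\<integral>\<theta>. c * (weak_deriv 1 f \<theta> * weak_deriv 1 g \<theta>) \<partial>circle_measure)"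
  proof (rule integral_cong_AE)
    show "AE \<theta> in circle_measure. weak_deriv 1 (\<lambda>\<theta>. c * f \<theta>) \<theta> * weak_deriv 1 g \<theta>
        = c * (weak_deriv 1 f \<theta> * weak_deriv 1 g \<theta>)"
      using AE_weak_deriv_eq[OF has_weak_deriv_scaleR[OF D(1), of c]]
      by eventually_elim simp
    show "(\<lambda>\<theta>. weak_deriv 1 (\<lambda>\<theta>. c * f \<theta>) \<theta> * weak_deriv 1 g \<theta>) \<in> borel_measurable circle_measure"
      using sobolev_weak_deriv(2)[OF sobolev_cmult[OF f] order_refl] D(4)
      by (intro borel_measurable_times) auto
    show "(\<lambda>\<theta>. c * (weak_deriv 1 f \<theta> * weak_deriv 1 g \<theta>)) \<in> borel_measurable circle_measure"
      using D by (intro borel_measurable_times) auto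
  qed
  then show ?thesis by (simp add: energy_form_def right_diff_distrib mult.assoc)
qed

lemma energy_form_diff_left:
  assumes f: "f \<in> sobolev 1 2" and f': "f' \<in> sobolev 1 2" and g: "g \<in> sobolev 1 2"
  shows "energy_form (\<lambda>\<theta>. f \<theta> - f' \<theta>) g = energy_form f g - energy_form f' g"
  using energy_form_add_left[OF f sobolev_cmult[OF f', of "-1"] g] energy_form_cmult_left[OF f' g, of "-1"]
  by simp

lemma energy_form_bound:
  assumes f: "f \<in> sobolev 1 2" and g: "g \<in> sobolev 1 2"
  shows "\<bar>energy_form f g\<bar> \<le> sobolev_norm 1 2 f * sobolev_norm 1 2 g"
proof -
  note D = sobolev_weak_deriv(2)[OF f order_refl] sobolev_weak_deriv(2)[OF g order_refl]
  note S = sobolev_square_integrable[OF f] sobolev_square_integrable[OF g]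
  have le: "(\<integral>\<theta>. (u \<theta>)\<^sup>2 \<partial>circle_measure) \<le> (sobolev_norm 1 2 u)\<^sup>2"
    "(\<integral>\<theta>. (weak_deriv 1 u \<theta>)\<^sup>2 \<partial>circle_measure) \<le> (sobolev_norm 1 2 u)\<^sup>2"
    if "u \<in> sobolev 1 2" for u
    unfolding sobolev_norm_1'[OF that] by simp_all
  have "\<bar>\<integral>\<theta>. f \<theta> * g \<theta> \<partial>circle_measure\<bar> \<le> sobolev_norm 1 2 f * sobolev_norm 1 2 g"
    by (rule order_trans[OF integral_abs_bound square_integral_cauchy_schwarz])
       (intro S le f g sobolev_norm_nonneg)+
  moreover have "\<bar>\<integral>\<theta>. weak_deriv 1 f \<theta> * weak_deriv 1 g \<theta> \<partial>circle_measure\<bar>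
      \<le> sobolev_norm 1 2 f * sobolev_norm 1 2 g"
    by (rule order_trans[OF integral_abs_bound square_integral_cauchy_schwarz])
       (intro D le f g sobolev_norm_nonneg)+
  moreover have "\<bar>(x - y) / 2\<bar> \<le> z" if "\<bar>y\<bar> \<le> z" "\<bar>x\<bar> \<le> z" for x y z :: real
    using that by auto
  ultimately show ?thesis unfolding energy_form_def by blast
qed

lemma energy_form_tendsto:
  assumes u: "\<forall>\<^sub>F s in F. u s \<in> sobolev 1 2" "u0 \<in> sobolev 1 2"
      "((\<lambda>s. sobolev_norm 1 2 (\<lambda>\<theta>. u s \<theta> - u0 \<theta>)) \<longlongrightarrow> 0) F"
    and w: "\<forall>\<^sub>F s in F. w s \<in> sobolev 1 2" "w0 \<in> sobolev 1 2"
      "((\<lambda>s. sobolev_norm 1 2 (\<lambda>\<theta>. w s \<theta> - w0 \<theta>)) \<longlongrightarrow> 0) F"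
  shows "((\<lambda>s. energy_form (u s) (w s)) \<longlongrightarrow> energy_form u0 w0) F"
proof -
  let ?N = "sobolev_norm 1 2"
  let ?du = "\<lambda>s \<theta>. u s \<theta> - u0 \<theta>" and ?dw = "\<lambda>s \<theta>. w s \<theta> - w0 \<theta>"
  have "((\<lambda>s. ?N (?du s) * ?N (?dw s) + ?N (?du s) * ?N w0 + ?N (?dw s) * ?N u0)
      \<longlongrightarrow> 0 * 0 + 0 * ?N w0 + 0 * ?N u0) F"
    by (intro tendsto_intros u w)
  then have lim: "((\<lambda>s. ?N (?du s) * ?N (?dw s) + ?N (?du s) * ?N w0 + ?N (?dw s) * ?N u0) \<longlongrightarrow> 0) F"
    by simp
  have "\<forall>\<^sub>F s in F. norm (energy_form (u s) (w s) - energy_form u0 w0)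
      \<le> ?N (?du s) * ?N (?dw s) + ?N (?du s) * ?N w0 + ?N (?dw s) * ?N u0"
    using u(1) w(1)
  proof eventually_elim
    case (elim s)
    note S = sobolev_diff[OF elim(1) u(2)] sobolev_diff[OF elim(2) w(2)]
    have "energy_form (u s) (w s) - energy_form u0 w0
        = energy_form (?du s) (?dw s) + energy_form (?du s) w0 + energy_form (?dw s) u0"
      using elim u(2) w(2) S
      by (simp add: energy_form_diff_left energy_form_commute[of "u s" "?dw s"]
          energy_form_commute[of u0 "?dw s"] energy_form_commute[of "w s" "u s"]
          energy_form_commute[of "w s" u0] energy_form_commute[of "w0" "u s"]
          energy_form_commute[of w0 u0])
    then show ?case
      using energy_form_bound[OF S(1) S(2)] energy_form_bound[OF S(1) w(2)]
        energy_form_bound[OF S(2) u(2)] by simp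
  qed
  then have "((\<lambda>s. energy_form (u s) (w s) - energy_form u0 w0) \<longlongrightarrow> 0) F"
    using lim by (rule Lim_null_comparison)
  then show ?thesis by (simp add: LIM_zero_iff)
qed

lemma norm_fourier_coeff_le_sobolev:
  assumes f: "f \<in> sobolev 1 2"
  shows "norm (fourier_coeff f n) \<le> sobolev_norm 1 2 f"
proof -
  have "2 * pi * (norm (fourier_coeff f n))\<^sup>2 \<le> (sobolev_norm 1 2 f)\<^sup>2"
    using bessel_inequality[OF sobolev_square_integrable[OF f], of "{n}"] sobolev_norm_1'[OF f]
      Bochner_Integration.integral_nonneg[of circle_measure "\<lambda>\<theta>. (weak_deriv 1 f \<theta>)\<^sup>2"]
    by (simp add: add_increasing2 del: One_nat_def)
  moreover have "1 * (norm (fourier_coeff f n))\<^sup>2 \<le> 2 * pi * (norm (fourier_coeff f n))\<^sup>2"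
    using pi_gt3 by (intro mult_right_mono) auto
  ultimately have "(norm (fourier_coeff f n))\<^sup>2 \<le> (sobolev_norm 1 2 f)\<^sup>2" by linarith
  then show ?thesis by (rule power2_le_imp_le) (rule sobolev_norm_nonneg)
qed

lemma fourier_coeff_tendsto:
  assumes u: "\<forall>\<^sub>F s in F. u s \<in> sobolev 1 2" "u0 \<in> sobolev 1 2"
      "((\<lambda>s. sobolev_norm 1 2 (\<lambda>\<theta>. u s \<theta> - u0 \<theta>)) \<longlongrightarrow> 0) F"
  shows "((\<lambda>s. fourier_coeff (u s) n) \<longlongrightarrow> fourier_coeff u0 n) F"
proof -
  have "\<forall>\<^sub>F s in F. norm (fourier_coeff (u s) n - fourier_coeff u0 n)
      \<le> sobolev_norm 1 2 (\<lambda>\<theta>. u s \<theta> - u0 \<theta>)"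
    using u(1)
  proof eventually_elim
    case (elim s)
    then show ?case
      using norm_fourier_coeff_le_sobolev[OF sobolev_diff[OF elim u(2)], of n]
        sobolev_integrable[OF elim] sobolev_integrable[OF u(2)]
      by (simp add: fourier_coeff_diff)
  qed
  then have "((\<lambda>s. fourier_coeff (u s) n - fourier_coeff u0 n) \<longlongrightarrow> 0) F"
    using u(3) by (rule Lim_null_comparison)
  then show ?thesis by (simp add: LIM_zero_iff)
qed

section \<open>Absolute summability of Fourier coefficients of \<open>H\<^sup>1\<close>
  functions\<close>

lemma summable_on_inverse_square_int: "(\<lambda>n::int. 1 / (of_int n)\<^sup>2 :: real) summable_on UNIV"
proof -
  \<comment> \<open>The term at \<open>0\<close> is \<open>1 / 0 = 0\<close>, so no index has to be
    excluded.\<close>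
  have nat: "(\<lambda>k::nat. 1 / (real k)\<^sup>2) summable_on UNIV"
    using inverse_power_summable[of 2, where 'a = real]
    by (intro norm_summable_imp_summable_on) (simp add: field_simps)
  have 1: "(\<lambda>n::int. 1 / (of_int n)\<^sup>2 :: real) summable_on (range int)"
    by (subst summable_on_reindex) (use nat in \<open>auto simp: o_def\<close>)
  have "(\<lambda>n::int. 1 / (of_int n)\<^sup>2 :: real) summable_on (range (\<lambda>k. - int k))"
    by (subst summable_on_reindex) (use nat in \<open>auto simp: o_def inj_on_def\<close>)
  then have 2: "(\<lambda>n::int. 1 / (of_int n)\<^sup>2 :: real) summable_on {..<0}"
    by (rule summable_on_subset_banach) (auto simp: image_iff elim: neg_int_cases)
  have "(\<lambda>n::int. 1 / (of_int n)\<^sup>2 :: real) summable_on (range int \<union> {..<0})"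
    by (rule summable_on_Un_disjoint[OF 1 2]) auto
  moreover have "range int \<union> {..<0} = UNIV"
    by (auto simp: image_iff) (metis nonneg_int_cases not_less)
  ultimately show ?thesis by simp
qed

text \<open>The value is \<open>pi\<^sup>2 / 3\<close>: twice the sum over the positive integers,
  the term at \<open>0\<close> being \<open>0\<close>.\<close>

definition inverse_square_sum :: real where
  "inverse_square_sum = (\<Sum>\<^sub>\<infinity>n::int. 1 / (of_int n)\<^sup>2)"

lemma inverse_square_sum_nonneg: "0 \<le> inverse_square_sum"
  unfolding inverse_square_sum_def by (rule infsum_nonneg) simp

text \<open>Cauchy-Schwarz on \<open>1 / n\<close> times \<open>n * f\<^sub>n\<close>, with Bessel
  for the second factor. Stated for any \<open>g\<close> with the coefficients of a derivative, so
  that it serves derivatives of every order and the remainder alike.\<close>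

lemma fourier_coeff_abs_summable:
  fixes f g :: "real \<Rightarrow> real"
  assumes g: "square_integrable g"
    and fg: "\<And>n. fourier_coeff g n = \<i> * of_int n * fourier_coeff f n"
  shows "(\<lambda>n. norm (fourier_coeff f n)) summable_on UNIV"
    and "(\<Sum>\<^sub>\<infinity>n. norm (fourier_coeff f n)) \<le> norm (fourier_coeff f 0)
      + sqrt inverse_square_sum * sqrt (\<integral>\<theta>. (g \<theta>)\<^sup>2 \<partial>circle_measure)"
proof -
  let ?a = "\<lambda>n. norm (fourier_coeff f n)"
  let ?B = "?a 0 + sqrt inverse_square_sum * sqrt (\<integral>\<theta>. (g \<theta>)\<^sup>2 \<partial>circle_measure)"
  have bound: "sum ?a S \<le> ?B" if S: "finite S" for S
  proof -
    \<comment> \<open>The index \<open>0\<close> is split off because the coefficients of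
      \<open>g\<close> carry no information about it.\<close>
    have "sum ?a S \<le> sum ?a (insert 0 (S - {0}))"
      using S by (intro sum_mono2) auto
    also have "\<dots> = ?a 0 + sum ?a (S - {0})" using S by (subst sum.insert) auto
    also have "sum ?a (S - {0}) = (\<Sum>n\<in>S - {0}. \<bar>1 / of_int n\<bar> * \<bar>norm (fourier_coeff g n)\<bar>)"
      by (intro sum.cong refl) (auto simp: fg norm_mult)
    also have "\<dots> \<le> L2_set (\<lambda>n. 1 / of_int n) (S - {0}) * L2_set (\<lambda>n. norm (fourier_coeff g n)) (S - {0})"
      by (rule L2_set_mult_ineq)
    also have "\<dots> \<le> sqrt inverse_square_sum * sqrt (\<integral>\<theta>. (g \<theta>)\<^sup>2 \<partial>circle_measure)"
    proof (intro mult_mono)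
      have "(\<Sum>n\<in>S - {0}. (1 / of_int n :: real)\<^sup>2) \<le> inverse_square_sum"
        unfolding inverse_square_sum_def power_divide power_one
        using S by (intro finite_sum_le_infsum summable_on_inverse_square_int) auto
      then show "L2_set (\<lambda>n. 1 / of_int n) (S - {0}) \<le> sqrt inverse_square_sum"
        by (simp add: L2_set_def)
      have "1 * (\<Sum>n\<in>S - {0}. (norm (fourier_coeff g n))\<^sup>2)
          \<le> 2 * pi * (\<Sum>n\<in>S - {0}. (norm (fourier_coeff g n))\<^sup>2)"
        using pi_gt3 by (intro mult_right_mono sum_nonneg) auto
      also have "\<dots> \<le> (\<integral>\<theta>. (g \<theta>)\<^sup>2 \<partial>circle_measure)"
        using S by (intro bessel_inequality g) auto
      finally show "L2_set (\<lambda>n. norm (fourier_coeff g n)) (S - {0}) \<le> sqrt (\<integral>\<theta>. (g \<theta>)\<^sup>2 \<partial>circle_measure)"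
        by (simp add: L2_set_def)
    qed (auto simp: L2_set_nonneg inverse_square_sum_nonneg)
    finally show ?thesis by simp
  qed
  show s: "?a summable_on UNIV"
    using bound by (intro nonneg_bdd_above_summable_on) (auto intro!: bdd_aboveI2[where M = ?B])
  show "(\<Sum>\<^sub>\<infinity>n. ?a n) \<le> ?B"
    by (rule infsum_le_finite_sums[OF s]) (rule bound)
qed

lemma sobolev_fourier_coeff_abs_summable:
  fixes f :: "real \<Rightarrow> real"
  assumes f: "f \<in> sobolev k 2" and j: "j < k"
  shows "(\<lambda>n. norm (fourier_coeff (weak_deriv j f) n)) summable_on UNIV"
proof (rule fourier_coeff_abs_summable)
  show "square_integrable (weak_deriv (Suc j) f)"
    using j by (intro sobolev_weak_deriv[OF f]) auto
  show "fourier_coeff (weak_deriv (Suc j) f) n = \<i> * of_int n * fourier_coeff (weak_deriv j f) n" for n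
    using j fourier_coeff_weak_deriv[OF sobolev_weak_deriv(1)[OF f], of "Suc j" n]
      fourier_coeff_weak_deriv[OF sobolev_weak_deriv(1)[OF f], of j n]
    by (simp add: mult_ac)
qed

text \<open>A spectral gap turned into an inequality of integrals: equality is needed only for
  \<open>f\<close>, while for \<open>g\<close> Bessel suffices, so the coefficients of
  \<open>g\<close> may fail to be summable.\<close>

lemma parseval_square_le:
  assumes f: "square_integrable f"
    and a: "(\<lambda>n. norm (fourier_coeff f n)) summable_on UNIV"
    and g: "square_integrable g"
    and le: "\<And>n. 2 * norm (fourier_coeff f n) \<le> norm (fourier_coeff g n)"
  shows "4 * (\<integral>\<theta>. (f \<theta>)\<^sup>2 \<partial>circle_measure) \<le> (\<integral>\<theta>. (g \<theta>)\<^sup>2 \<partial>circle_measure)"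
proof -
  have fi: "integrable circle_measure f" by (rule square_integrable_integrable[OF f])
  have "((\<lambda>n. 2 * pi * (norm (fourier_coeff f n))\<^sup>2) has_sum (\<integral>\<theta>. (f \<theta>)\<^sup>2 \<partial>circle_measure)) UNIV"
    using parseval[OF fi a fi] by (simp add: power2_eq_square[of "f _"] complex_mult_cnj cmod_power2)
  then have "(\<integral>\<theta>. (f \<theta>)\<^sup>2 \<partial>circle_measure) \<le> (\<integral>\<theta>. (g \<theta>)\<^sup>2 \<partial>circle_measure) / 4"
  proof (rule has_sum_le_finite_sums)
    fix S :: "int set" assume S: "finite S"
    have "(\<Sum>n\<in>S. 2 * pi * (norm (fourier_coeff f n))\<^sup>2)
        \<le> (\<Sum>n\<in>S. 2 * pi * ((norm (fourier_coeff g n))\<^sup>2 / 4))"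
    proof (intro sum_mono mult_left_mono)
      fix n
      have "(2 * norm (fourier_coeff f n))\<^sup>2 \<le> (norm (fourier_coeff g n))\<^sup>2"
        using le[of n] by (intro power_mono) auto
      then show "(norm (fourier_coeff f n))\<^sup>2 \<le> (norm (fourier_coeff g n))\<^sup>2 / 4"
        by (simp add: power_mult_distrib)
    qed auto
    also have "\<dots> = 2 * pi * (\<Sum>n\<in>S. (norm (fourier_coeff g n))\<^sup>2) / 4"
      by (simp add: sum_distrib_left sum_divide_distrib)
    also have "\<dots> \<le> (\<integral>\<theta>. (g \<theta>)\<^sup>2 \<partial>circle_measure) / 4"
      using bessel_inequality[OF g S] by simp
    finally show "(\<Sum>n\<in>S. 2 * pi * (norm (fourier_coeff f n))\<^sup>2)
        \<le> (\<integral>\<theta>. (g \<theta>)\<^sup>2 \<partial>circle_measure) / 4" .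
  qed
  then show ?thesis by simp
qed

section \<open>Energy and dissipation\<close>

lemma integral_mult_Re_cis:
  assumes u: "integrable circle_measure (u :: real \<Rightarrow> real)"
  shows "(\<integral>\<theta>. u \<theta> * Re (c * cis (of_int n * \<theta>)) \<partial>circle_measure)
    = 2 * pi * Re (c * fourier_coeff u (- n))"
proof -
  have "(\<integral>\<theta>. u \<theta> * Re (c * cis (of_int n * \<theta>)) \<partial>circle_measure)
      = (\<integral>\<theta>. Re (c * (of_real (u \<theta>) * cis (of_int n * \<theta>))) \<partial>circle_measure)"
    by (intro Bochner_Integration.integral_cong) (auto simp: algebra_simps)
  also have "\<dots> = Re (\<integral>\<theta>. c * (of_real (u \<theta>) * cis (of_int n * \<theta>)) \<partial>circle_measure)"
    by (intro integral_Re integrable_mult_right integrable_circle_cis u)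
  also have "\<dots> = 2 * pi * Re (c * fourier_coeff u (- n))"
    unfolding integral_mult_right_zero integral_cis_fourier_coeff by (simp add: algebra_simps)
  finally show ?thesis .
qed

lemma fourier_coeff_Re_cis:
  "fourier_coeff (\<lambda>\<theta>. Re (c * cis (of_int m * \<theta>))) n
    = (if n = m then c / 2 else 0) + (if n = - m then cnj c / 2 else 0)"
proof -
  have eq: "of_real (Re (c * cis (of_int m * \<theta>))) * cis (- (of_int n) * \<theta>)
      = c / 2 * cis (of_int (m - n) * \<theta>) + cnj c / 2 * cis (of_int (- m - n) * \<theta>)" for \<theta>
  proof -
    have "of_real (Re z) = z / 2 + cnj z / 2" for z by (simp add: complex_eq_iff)
    moreover have "cis (of_int m * \<theta>) * cis (- (of_int n) * \<theta>) = cis (of_int (m - n) * \<theta>)"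
      "cis (- (of_int m * \<theta>)) * cis (- (of_int n) * \<theta>) = cis (of_int (- m - n) * \<theta>)"
      by (simp_all add: cis_mult algebra_simps)
    ultimately show ?thesis
      by (simp only: complex_cnj_mult cis_cnj distrib_right times_divide_eq_left mult.assoc)
  qed
  have i: "integrable circle_measure (\<lambda>\<theta>. a * cis (of_int k * \<theta>))" for a k
    by (intro integrable_circle_continuous continuous_intros)
  show ?thesis
    unfolding fourier_coeff_cis eq Bochner_Integration.integral_add[OF i i]
      integral_mult_right_zero integral_cis by (simp add: add_divide_distrib)
qed

section \<open>Splitting off the mean and the modes \<open>n = 1, -1\<close>\<close>

lemma fourier_coeff_const: "fourier_coeff (\<lambda>_. c) n = (if n = 0 then of_real c else 0)"
  using fourier_coeff_Re_cis[of "of_real c" 0 n] by simp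

lemma fourier_coeff_0: "fourier_coeff f 0 = of_real (Re (fourier_coeff f 0))"
  using fourier_coeff_minus[of f 0] by (simp add: complex_eq_iff)

text \<open>For real \<open>f\<close> the modes \<open>1\<close> and \<open>-1\<close> are complex
  conjugates, so their sum is twice the real part of one of them.\<close>

abbreviation first_mode :: "(real \<Rightarrow> real) \<Rightarrow> real \<Rightarrow> real" where
  "first_mode f \<theta> \<equiv> Re (2 * fourier_coeff f 1 * cis (of_int 1 * \<theta>))"

lemma continuous_first_mode: "continuous_on UNIV (first_mode f)"
  by (intro continuous_intros)

lemma fourier_coeff_first_mode:
  "fourier_coeff (first_mode f) n = (if n = 1 \<or> n = -1 then fourier_coeff f n else 0)"
  unfolding fourier_coeff_Re_cis using fourier_coeff_minus[of f 1] by auto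

text \<open>Pythagoras; each of the modes \<open>1\<close> and \<open>-1\<close> carries
  \<open>2 * pi * (norm (fourier_coeff f 1))\<^sup>2\<close>.\<close>

lemma integral_remove_first_mode:
  assumes f: "square_integrable f"
  shows "(\<integral>\<theta>. (f \<theta> - first_mode f \<theta>)\<^sup>2 \<partial>circle_measure)
    = (\<integral>\<theta>. (f \<theta>)\<^sup>2 \<partial>circle_measure) - 4 * pi * (norm (fourier_coeff f 1))\<^sup>2"
proof -
  let ?m = "first_mode f"
  have m: "square_integrable ?m" by (rule square_integrable_continuous[OF continuous_first_mode])
  note i = conjunct2[OF f] square_integrable_mult[OF f m] square_integrable_mult[OF m m]
  have "(f \<theta> - ?m \<theta>)\<^sup>2 = (f \<theta>)\<^sup>2 - 2 * (f \<theta> * ?m \<theta>) + ?m \<theta> * ?m \<theta>" for \<theta>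
    by (simp add: power2_eq_square algebra_simps del: times_complex.sel)
  then have "(\<integral>\<theta>. (f \<theta> - ?m \<theta>)\<^sup>2 \<partial>circle_measure)
      = (\<integral>\<theta>. (f \<theta>)\<^sup>2 - 2 * (f \<theta> * ?m \<theta>) + ?m \<theta> * ?m \<theta> \<partial>circle_measure)"
    by (simp only:)
  also have "\<dots> = (\<integral>\<theta>. (f \<theta>)\<^sup>2 \<partial>circle_measure) - 2 * (\<integral>\<theta>. f \<theta> * ?m \<theta> \<partial>circle_measure)
      + (\<integral>\<theta>. ?m \<theta> * ?m \<theta> \<partial>circle_measure)"
    by (simp only: Bochner_Integration.integral_add[OF Bochner_Integration.integrable_diff[OF
          i(1) integrable_mult_right[OF i(2)]] i(3)]
        Bochner_Integration.integral_diff[OF i(1) integrable_mult_right[OF i(2)]]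
        integral_mult_right_zero)
  also have "(\<integral>\<theta>. f \<theta> * ?m \<theta> \<partial>circle_measure) = 4 * pi * (norm (fourier_coeff f 1))\<^sup>2"
    unfolding integral_mult_Re_cis[OF square_integrable_integrable[OF f]] fourier_coeff_minus
      cmod_power2 by (simp add: power2_eq_square algebra_simps)
  also have "(\<integral>\<theta>. ?m \<theta> * ?m \<theta> \<partial>circle_measure) = 4 * pi * (norm (fourier_coeff f 1))\<^sup>2"
    unfolding integral_mult_Re_cis[OF square_integrable_integrable[OF m]] fourier_coeff_first_mode
      cmod_power2 by (simp add: fourier_coeff_minus power2_eq_square algebra_simps)
  finally show ?thesis by simp
qed

lemma integral_remove_mean:
  assumes f: "square_integrable f"
  shows "(\<integral>\<theta>. (f \<theta> - Re (fourier_coeff f 0))\<^sup>2 \<partial>circle_measure)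
    = (\<integral>\<theta>. (f \<theta>)\<^sup>2 \<partial>circle_measure) - 2 * pi * (Re (fourier_coeff f 0))\<^sup>2"
proof -
  define c where "c = Re (fourier_coeff f 0)"
  have fi: "integrable circle_measure f" by (rule square_integrable_integrable[OF f])
  have "(\<integral>\<theta>. (f \<theta> - c)\<^sup>2 \<partial>circle_measure)
      = (\<integral>\<theta>. (f \<theta>)\<^sup>2 - (2 * c) * f \<theta> + c\<^sup>2 \<partial>circle_measure)"
    by (intro Bochner_Integration.integral_cong refl) (simp add: power2_eq_square algebra_simps)
  also have "\<dots> = (\<integral>\<theta>. (f \<theta>)\<^sup>2 \<partial>circle_measure) - (2 * c) * (\<integral>\<theta>. f \<theta> \<partial>circle_measure) + 2 * pi * c\<^sup>2"
    using f fi by (simp add: measure_restrict_space)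
  also have "(\<integral>\<theta>. f \<theta> \<partial>circle_measure) = 2 * pi * c"
    using integral_mult_Re_cis[OF fi, of 1 0] by (simp add: c_def)
  finally show ?thesis unfolding c_def[symmetric] by (simp add: power2_eq_square algebra_simps)
qed

definition remainder :: "(real \<Rightarrow> real) \<Rightarrow> real \<Rightarrow> real" where
  "remainder f \<theta> = f \<theta> - Re (fourier_coeff f 0) - first_mode f \<theta>"

text \<open>An explicit weak derivative of \<open>remainder f\<close>. No mean is subtracted because
  a derivative has mean zero, and removing the first modes commutes with differentiation.\<close>

definition remainder_deriv :: "(real \<Rightarrow> real) \<Rightarrow> real \<Rightarrow> real" where
  "remainder_deriv f \<theta> = weak_deriv 1 f \<theta> - first_mode (weak_deriv 1 f) \<theta>"

text \<open>A mean \<open>m\<close> contributes \<open>- pi * m\<^sup>2\<close> to the energy form;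
  adding it back leaves a functional of the modes \<open>\<bar>n\<bar> \<ge> 2\<close> alone. Along
  a solution the mean is constant, so the correction does not affect the time derivative.\<close>

definition energy :: "(real \<Rightarrow> real) \<Rightarrow> real" where
  "energy f = energy_form f f + pi * (Re (fourier_coeff f 0))\<^sup>2"

context
  fixes f :: "real \<Rightarrow> real"
  assumes f: "f \<in> sobolev 1 2"
begin

lemma fourier_coeff_weak_deriv_1:
  "fourier_coeff (weak_deriv 1 f) n = \<i> * of_int n * fourier_coeff f n"
  using fourier_coeff_weak_deriv[OF sobolev_weak_deriv(1)[OF f order_refl]] by simp

lemma has_weak_deriv_remainder: "has_weak_deriv 1 (remainder f) (remainder_deriv f)"
proof -
  have "has_weak_deriv 1 (\<lambda>\<theta>. f \<theta> - Re (fourier_coeff f 0) - first_mode f \<theta>)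
      (\<lambda>\<theta>. weak_deriv 1 f \<theta> - 0
         - Re (\<i> * of_int 1 * (2 * fourier_coeff f 1) * cis (of_int 1 * \<theta>)))"
    by (intro has_weak_deriv_diff has_weak_deriv_Re_cis has_weak_deriv_1_const
        sobolev_weak_deriv[OF f order_refl])
  moreover have "2 * fourier_coeff (weak_deriv 1 f) 1 = \<i> * of_int 1 * (2 * fourier_coeff f 1)"
    unfolding fourier_coeff_weak_deriv_1 by simp
  ultimately show ?thesis
    by (simp only: remainder_def[abs_def] remainder_deriv_def[abs_def] diff_0_right)
qed

lemma square_integrable_remainder:
  shows "square_integrable (remainder f)" and "square_integrable (remainder_deriv f)"
proof -
  show "square_integrable (remainder f)"
    unfolding remainder_def[abs_def]
    by (rule square_integrable_diff[OF square_integrable_diff[OF sobolev_square_integrable[OF f]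
          square_integrable_continuous[OF continuous_on_const]]
        square_integrable_continuous[OF continuous_first_mode]])
  show "square_integrable (remainder_deriv f)"
    unfolding remainder_deriv_def[abs_def]
    by (rule square_integrable_diff[OF sobolev_weak_deriv(2)[OF f order_refl]
        square_integrable_continuous[OF continuous_first_mode]])
qed

text \<open>The first modes contribute equally to the integrals of \<open>f\<^sup>2\<close> and of
  its squared derivative, since the frequency has modulus one, and cancel in the difference.\<close>

lemma energy_remainder:
  "energy f = ((\<integral>\<theta>. (remainder_deriv f \<theta>)\<^sup>2 \<partial>circle_measure)
     - (\<integral>\<theta>. (remainder f \<theta>)\<^sup>2 \<partial>circle_measure)) / 2"
proof -
  let ?g = "\<lambda>\<theta>. f \<theta> - Re (fourier_coeff f 0)"
  note fs = sobolev_square_integrable[OF f]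
  have g: "square_integrable ?g"
    by (rule square_integrable_diff[OF fs square_integrable_continuous[OF continuous_on_const]])
  have g1: "fourier_coeff ?g 1 = fourier_coeff f 1"
    using fourier_coeff_diff[OF sobolev_integrable[OF f] integrable_circle_const, of "Re (fourier_coeff f 0)" 1]
    by (simp add: fourier_coeff_const)
  have "(\<integral>\<theta>. (remainder f \<theta>)\<^sup>2 \<partial>circle_measure)
      = (\<integral>\<theta>. (f \<theta>)\<^sup>2 \<partial>circle_measure) - 2 * pi * (Re (fourier_coeff f 0))\<^sup>2
        - 4 * pi * (norm (fourier_coeff f 1))\<^sup>2"
    using integral_remove_first_mode[OF g] unfolding g1 integral_remove_mean[OF fs]
    by (simp only: remainder_def)
  moreover have "(\<integral>\<theta>. (remainder_deriv f \<theta>)\<^sup>2 \<partial>circle_measure)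
      = (\<integral>\<theta>. (weak_deriv 1 f \<theta>)\<^sup>2 \<partial>circle_measure) - 4 * pi * (norm (fourier_coeff f 1))\<^sup>2"
    using integral_remove_first_mode[OF sobolev_weak_deriv(2)[OF f order_refl]]
    unfolding remainder_deriv_def fourier_coeff_weak_deriv_1
    by (simp only: norm_mult norm_ii of_int_1 norm_one mult_1)
  ultimately show ?thesis
    by (simp add: energy_def energy_form_def power2_eq_square[of "f _"]
        power2_eq_square[of "weak_deriv _ f _"] field_simps)
qed

lemma fourier_coeff_remainder:
  "fourier_coeff (remainder f) n = (if \<bar>n\<bar> \<le> 1 then 0 else fourier_coeff f n)"
proof -
  let ?c = "Re (fourier_coeff f 0)"
  have i: "integrable circle_measure (\<lambda>\<theta>. f \<theta> - ?c)"
    using sobolev_integrable[OF f] by simp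
  have "fourier_coeff (remainder f) n
      = fourier_coeff f n - fourier_coeff (\<lambda>_. ?c) n - fourier_coeff (first_mode f) n"
    unfolding remainder_def[abs_def]
      fourier_coeff_diff[OF i integrable_circle_continuous[OF continuous_first_mode]]
      fourier_coeff_diff[OF sobolev_integrable[OF f] integrable_circle_const] ..
  moreover have "\<bar>n\<bar> \<le> 1 \<longleftrightarrow> n = 0 \<or> n = 1 \<or> n = -1" by auto
  ultimately show ?thesis
    unfolding fourier_coeff_first_mode fourier_coeff_const using fourier_coeff_0[of f] by auto
qed

lemma fourier_coeff_remainder_deriv:
  "fourier_coeff (remainder_deriv f) n = \<i> * of_int n * fourier_coeff (remainder f) n"
  using fourier_coeff_weak_deriv[OF has_weak_deriv_remainder] by simp

lemma summable_remainder: "(\<lambda>n. norm (fourier_coeff (remainder f) n)) summable_on UNIV"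
  by (rule fourier_coeff_abs_summable(1)[OF square_integrable_remainder(2)
        fourier_coeff_remainder_deriv])

text \<open>The constant is the square of the smallest remaining frequency,
  \<open>\<bar>n\<bar> = 2\<close>.\<close>

lemma remainder_wirtinger:
  "4 * (\<integral>\<theta>. (remainder f \<theta>)\<^sup>2 \<partial>circle_measure) \<le> (\<integral>\<theta>. (remainder_deriv f \<theta>)\<^sup>2 \<partial>circle_measure)"
proof (rule parseval_square_le[OF square_integrable_remainder(1) summable_remainder
      square_integrable_remainder(2)])
  fix n
  show "2 * norm (fourier_coeff (remainder f) n) \<le> norm (fourier_coeff (remainder_deriv f) n)"
  proof (cases "\<bar>n\<bar> \<le> 1")
    case False
    then have "2 * norm (fourier_coeff (remainder f) n) \<le> \<bar>of_int n\<bar> * norm (fourier_coeff (remainder f) n)"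
      by (intro mult_right_mono) auto
    then show ?thesis by (simp add: fourier_coeff_remainder_deriv norm_mult)
  qed (simp add: fourier_coeff_remainder_deriv fourier_coeff_remainder)
qed

lemma energy_nonneg: "0 \<le> energy f"
  and remainder_deriv_energy: "(\<integral>\<theta>. (remainder_deriv f \<theta>)\<^sup>2 \<partial>circle_measure) \<le> 3 * energy f"
  and remainder_energy: "(\<integral>\<theta>. (remainder f \<theta>)\<^sup>2 \<partial>circle_measure) \<le> energy f"
proof -
  have "0 \<le> (\<integral>\<theta>. (remainder f \<theta>)\<^sup>2 \<partial>circle_measure)" by simp
  \<comment> \<open>Here \<open>r\<close> and \<open>R\<close> are the squared
    \<open>L\<^sub>2\<close> norms of the remainder and of its derivative;
    \<open>4 * r \<le> R\<close> makes their difference coercive.\<close>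
  moreover have "0 \<le> (R - r) / 2 \<and> R \<le> 3 * ((R - r) / 2) \<and> r \<le> (R - r) / 2"
    if "0 \<le> r" "4 * r \<le> R" for r R :: real
    using that by auto
  ultimately have "0 \<le> energy f
      \<and> (\<integral>\<theta>. (remainder_deriv f \<theta>)\<^sup>2 \<partial>circle_measure) \<le> 3 * energy f
      \<and> (\<integral>\<theta>. (remainder f \<theta>)\<^sup>2 \<partial>circle_measure) \<le> energy f"
    using remainder_wirtinger unfolding energy_remainder by blast
  then show "0 \<le> energy f"
    "(\<integral>\<theta>. (remainder_deriv f \<theta>)\<^sup>2 \<partial>circle_measure) \<le> 3 * energy f"
    "(\<integral>\<theta>. (remainder f \<theta>)\<^sup>2 \<partial>circle_measure) \<le> energy f"
    by blast+
qed

text \<open>The first modes are bounded directly, the remainder by the sum of its coefficients and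
  hence by its energy. The right-hand side is the quantity that the bootstrap keeps below
  \<open>hbar / 2\<close>.\<close>

lemma AE_deviation_bound:
  "AE \<theta> in circle_measure. \<bar>f \<theta> - Re (fourier_coeff f 0)\<bar>
     \<le> 2 * norm (fourier_coeff f 1) + sqrt (3 * inverse_square_sum) * sqrt (energy f)"
  using AE_bound_fourier_coeff[OF square_integrable_integrable[OF square_integrable_remainder(1)]
      summable_remainder]
proof eventually_elim
  case (elim \<theta>)
  have "(\<Sum>\<^sub>\<infinity>n. norm (fourier_coeff (remainder f) n))
      \<le> sqrt inverse_square_sum * sqrt (\<integral>\<theta>. (remainder_deriv f \<theta>)\<^sup>2 \<partial>circle_measure)"
    using fourier_coeff_abs_summable(2)[OF square_integrable_remainder(2)
        fourier_coeff_remainder_deriv] by (simp add: fourier_coeff_remainder)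
  also have "\<dots> \<le> sqrt inverse_square_sum * sqrt (3 * energy f)"
    by (intro mult_left_mono real_sqrt_le_mono remainder_deriv_energy)
       (simp add: inverse_square_sum_nonneg)
  finally have "\<bar>remainder f \<theta>\<bar> \<le> sqrt (3 * inverse_square_sum) * sqrt (energy f)"
    using elim by (simp add: real_sqrt_mult mult_ac)
  moreover have "\<bar>first_mode f \<theta>\<bar> \<le> 2 * norm (fourier_coeff f 1)"
    using abs_Re_le_cmod[of "2 * fourier_coeff f 1 * cis (of_int 1 * \<theta>)"]
    by (simp only: norm_mult norm_cis mult_1_right) simp
  moreover have "f \<theta> - Re (fourier_coeff f 0) = remainder f \<theta> + first_mode f \<theta>"
    by (simp add: remainder_def)
  ultimately show ?case by linarith
qed

text \<open>The bounds by \<open>energy f\<close> and \<open>3 * energy f\<close> add up to four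
  energies; the factor \<open>2\<close> is the constant \<open>C\<close> of the theorem.\<close>

lemma sobolev_norm_remainder:
  "sobolev_norm 1 2 (remainder f) \<le> 2 * sqrt (energy f)"
proof -
  have "(sobolev_norm 1 2 (remainder f))\<^sup>2 \<le> 4 * energy f"
    using remainder_energy remainder_deriv_energy
      sobolev_norm_1[OF square_integrable_integrable[OF square_integrable_remainder(1)]
        has_weak_deriv_remainder] by linarith
  also have "\<dots> = (2 * sqrt (energy f))\<^sup>2" using energy_nonneg by (simp add: power_mult_distrib)
  finally show ?thesis by (rule power2_le_imp_le) (simp add: energy_nonneg)
qed

end

section \<open>The dissipation identity and the spectral gap\<close>

abbreviation velocity :: "(real \<Rightarrow> real) \<Rightarrow> real \<Rightarrow> real" where
  "velocity f \<theta> \<equiv> weak_deriv 1 f \<theta> + weak_deriv 3 f \<theta>"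

context
  fixes f :: "real \<Rightarrow> real"
  assumes f: "f \<in> sobolev 4 2"
begin

lemma sobolev_4_1: "f \<in> sobolev 1 2"
  by (rule sobolev_mono[OF f]) simp

lemma velocity_square_integrable: "square_integrable (velocity f)"
  by (rule square_integrable_add[OF sobolev_weak_deriv(2)[OF f] sobolev_weak_deriv(2)[OF f]]) auto

lemma fourier_coeff_velocity_add:
  "fourier_coeff (velocity f) n = fourier_coeff (weak_deriv 1 f) n + fourier_coeff (weak_deriv 3 f) n"
  by (rule fourier_coeff_add[OF square_integrable_integrable[OF sobolev_weak_deriv(2)[OF f]]
        square_integrable_integrable[OF sobolev_weak_deriv(2)[OF f]]]) auto

text \<open>The symbol vanishes exactly at \<open>n = 0, 1, -1\<close>, the modes that the energy
  does not see.\<close>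

lemma fourier_coeff_velocity:
  "fourier_coeff (velocity f) n = \<i> * of_int n * (1 - (of_int n)\<^sup>2) * fourier_coeff f n"
proof -
  have "fourier_coeff (weak_deriv 3 f) n = (\<i> * of_int n) ^ 3 * fourier_coeff f n"
    by (rule fourier_coeff_weak_deriv[OF sobolev_weak_deriv(1)[OF f]]) simp
  then show ?thesis
    unfolding fourier_coeff_velocity_add fourier_coeff_weak_deriv_1[OF sobolev_4_1]
    by (simp add: power3_eq_cube power2_eq_square algebra_simps)
qed

text \<open>The fourth derivative of \<open>f\<close> is spent here: it makes the coefficients of
  the third derivative summable, so that the velocity is bounded almost everywhere and Parseval
  applies to it.\<close>

lemma summable_velocity: "(\<lambda>n. norm (fourier_coeff (velocity f) n)) summable_on UNIV"
proof (rule summable_on_comparison_test)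
  show "(\<lambda>n. norm (fourier_coeff (weak_deriv 1 f) n) + norm (fourier_coeff (weak_deriv 3 f) n))
      summable_on UNIV"
    by (intro summable_on_add sobolev_fourier_coeff_abs_summable[OF f]) auto
  show "norm (fourier_coeff (velocity f) n)
      \<le> norm (fourier_coeff (weak_deriv 1 f) n) + norm (fourier_coeff (weak_deriv 3 f) n)" for n
    unfolding fourier_coeff_velocity_add by (rule norm_triangle_ineq)
qed auto

text \<open>The spectral gap that gives exponential decay. The velocity is compared with
  \<open>remainder_deriv\<close>, whose squared norm is at least twice the energy; the factor
  \<open>4\<close> of \<open>parseval_square_le\<close> makes the total \<open>8\<close>.\<close>

lemma energy_le_velocity: "8 * energy f \<le> (\<integral>\<theta>. (velocity f \<theta>)\<^sup>2 \<partial>circle_measure)"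
proof -
  note f1 = sobolev_4_1
  have "4 * (\<integral>\<theta>. (remainder_deriv f \<theta>)\<^sup>2 \<partial>circle_measure) \<le> (\<integral>\<theta>. (velocity f \<theta>)\<^sup>2 \<partial>circle_measure)"
  proof (rule parseval_square_le[OF square_integrable_remainder(2)[OF f1] _ velocity_square_integrable])
    show "(\<lambda>n. norm (fourier_coeff (remainder_deriv f) n)) summable_on UNIV"
    proof (rule summable_on_comparison_test)
      show "(\<lambda>n. norm (fourier_coeff (weak_deriv 1 f) n)) summable_on UNIV"
        by (rule sobolev_fourier_coeff_abs_summable[OF f]) simp
      show "norm (fourier_coeff (remainder_deriv f) n) \<le> norm (fourier_coeff (weak_deriv 1 f) n)" for n
        unfolding fourier_coeff_remainder_deriv[OF f1] fourier_coeff_remainder[OF f1]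
          fourier_coeff_weak_deriv_1[OF f1] by simp
    qed auto
    fix n
    show "2 * norm (fourier_coeff (remainder_deriv f) n) \<le> norm (fourier_coeff (velocity f) n)"
    proof (cases "\<bar>n\<bar> \<le> 1")
      case False
      \<comment> \<open>In fact \<open>n\<^sup>2 - 1 \<ge> 3\<close> here; it is relaxed to the
        factor \<open>2\<close> expected by \<open>parseval_square_le\<close>.\<close>
      then have "2\<^sup>2 \<le> \<bar>n\<bar>\<^sup>2" by (intro power_mono) auto
      then have "2 + 1 \<le> n\<^sup>2" by simp
      then have "(of_int (2 + 1) :: real) \<le> of_int (n\<^sup>2)" by (simp only: of_int_le_iff)
      then have "2 \<le> \<bar>1 - (of_int n :: real)\<^sup>2\<bar>" by simp
      then have "2 * (\<bar>of_int n\<bar> * norm (fourier_coeff f n))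
          \<le> \<bar>1 - (of_int n :: real)\<^sup>2\<bar> * (\<bar>of_int n\<bar> * norm (fourier_coeff f n))"
        by (intro mult_right_mono) auto
      moreover have "norm (1 - (of_int n :: complex)\<^sup>2) = \<bar>1 - (of_int n :: real)\<^sup>2\<bar>"
        using norm_of_real[of "1 - (of_int n :: real)\<^sup>2", where 'a = complex] by simp
      ultimately show ?thesis using False
        unfolding fourier_coeff_remainder_deriv[OF f1] fourier_coeff_remainder[OF f1]
          fourier_coeff_velocity by (simp add: norm_mult mult_ac)
    qed (simp add: fourier_coeff_remainder_deriv[OF f1] fourier_coeff_remainder[OF f1])
  qed
  moreover have "2 * energy f \<le> (\<integral>\<theta>. (remainder_deriv f \<theta>)\<^sup>2 \<partial>circle_measure)"
    unfolding energy_remainder[OF f1] by simp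
  ultimately show ?thesis by linarith
qed

text \<open>Two integrations by parts performed on coefficients: the weight
  \<open>n\<^sup>2 - 1\<close> of the energy times the factor \<open>n\<close> from the equation is
  the symbol of the velocity. No derivative of \<open>F\<close> is taken.\<close>

lemma energy_form_dissipation:
  assumes d: "d \<in> sobolev 4 2" and F: "integrable circle_measure F"
    and eq: "\<And>n. fourier_coeff d n = - \<i> * of_int n * fourier_coeff F n"
  shows "2 * energy_form f d = - (\<integral>\<theta>. velocity f \<theta> * F \<theta> \<partial>circle_measure)"
proof -
  have d1: "d \<in> sobolev 1 2" by (rule sobolev_mono[OF d]) simp
  note w = sobolev_weak_deriv(2)[OF sobolev_4_1 order_refl] sobolev_weak_deriv(2)[OF d1 order_refl]
  have s0: "(\<lambda>n. norm (fourier_coeff f n)) summable_on UNIV"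
    by (rule fourier_coeff_abs_summable(1)[OF w(1) fourier_coeff_weak_deriv_1[OF sobolev_4_1]])
  have s1: "(\<lambda>n. norm (fourier_coeff (weak_deriv 1 f) n)) summable_on UNIV"
    by (rule sobolev_fourier_coeff_abs_summable[OF f]) simp
  have "((\<lambda>n. 2 * pi * Re (fourier_coeff (weak_deriv 1 f) n * cnj (fourier_coeff (weak_deriv 1 d) n))
        - 2 * pi * Re (fourier_coeff f n * cnj (fourier_coeff d n)))
      has_sum ((\<integral>\<theta>. weak_deriv 1 f \<theta> * weak_deriv 1 d \<theta> \<partial>circle_measure)
        - (\<integral>\<theta>. f \<theta> * d \<theta> \<partial>circle_measure))) UNIV"
    using has_sum_add[OF parseval[OF square_integrable_integrable[OF w(1)] s1
          square_integrable_integrable[OF w(2)]]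
        has_sum_uminusI[OF parseval[OF sobolev_integrable[OF sobolev_4_1] s0
          sobolev_integrable[OF d1]]]]
    by (simp only: add_uminus_conv_diff)
  moreover have "2 * pi * Re (fourier_coeff (weak_deriv 1 f) n * cnj (fourier_coeff (weak_deriv 1 d) n))
        - 2 * pi * Re (fourier_coeff f n * cnj (fourier_coeff d n))
      = - (2 * pi * Re (fourier_coeff (velocity f) n * cnj (fourier_coeff F n)))" for n
    unfolding fourier_coeff_weak_deriv_1[OF sobolev_4_1] fourier_coeff_weak_deriv_1[OF d1]
      fourier_coeff_velocity eq
    by (simp add: algebra_simps power2_eq_square)
  moreover have "(\<integral>\<theta>. weak_deriv 1 f \<theta> * weak_deriv 1 d \<theta> \<partial>circle_measure)
        - (\<integral>\<theta>. f \<theta> * d \<theta> \<partial>circle_measure) = 2 * energy_form f d"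
    by (simp add: energy_form_def)
  ultimately have "((\<lambda>n. - (2 * pi * Re (fourier_coeff (velocity f) n * cnj (fourier_coeff F n))))
      has_sum (2 * energy_form f d)) UNIV"
    by (simp only:)
  moreover have "((\<lambda>n. - (2 * pi * Re (fourier_coeff (velocity f) n * cnj (fourier_coeff F n))))
      has_sum (- (\<integral>\<theta>. velocity f \<theta> * F \<theta> \<partial>circle_measure))) UNIV"
    by (rule has_sum_uminusI[OF parseval[OF square_integrable_integrable[OF velocity_square_integrable]
        summable_velocity F]])
  ultimately show ?thesis by (rule has_sum_unique)
qed

end

section \<open>Bounds on the flux while \<open>f\<close> stays between positive constants\<close>

lemma flux_eq:
  "flux \<alpha> \<sigma> f \<theta> =
     f \<theta> powr (\<alpha> + 2) * (((velocity f \<theta>)\<^sup>2 + \<sigma>\<^sup>2) powr ((\<alpha> - 1) / 2) * velocity f \<theta>)"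
  by (simp add: flux_def psi_def)

context
  fixes \<alpha> \<sigma> a b :: real and f :: "real \<Rightarrow> real"
  assumes \<alpha>: "1 < \<alpha>" and \<sigma>: "0 < \<sigma>" and a: "0 < a" and f: "f \<in> sobolev 4 2"
    and ab: "AE \<theta> in circle_measure. a \<le> f \<theta> \<and> f \<theta> \<le> b"
begin

lemma flux_measurable: "flux \<alpha> \<sigma> f \<in> borel_measurable circle_measure"
proof -
  have v: "velocity f \<in> borel_measurable circle_measure"
    using velocity_square_integrable[OF f] by blast
  have fm: "f \<in> borel_measurable circle_measure"
    using sobolev_square_integrable[OF f] by blast
  show ?thesis
    unfolding flux_eq[abs_def] using v fm by measurable
qed

lemma velocity_AE_bound:
  obtains V where "0 \<le> V" "AE \<theta> in circle_measure. \<bar>velocity f \<theta>\<bar> \<le> V"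
proof
  show "0 \<le> (\<Sum>\<^sub>\<infinity>n. norm (fourier_coeff (velocity f) n))" by (rule infsum_nonneg) simp
  show "AE \<theta> in circle_measure. \<bar>velocity f \<theta>\<bar> \<le> (\<Sum>\<^sub>\<infinity>n. norm (fourier_coeff (velocity f) n))"
    by (rule AE_bound_fourier_coeff[OF square_integrable_integrable[OF velocity_square_integrable[OF f]]
          summable_velocity[OF f]])
qed

lemma flux_integrable: "integrable circle_measure (flux \<alpha> \<sigma> f)"
proof -
  obtain V where V: "0 \<le> V" "AE \<theta> in circle_measure. \<bar>velocity f \<theta>\<bar> \<le> V"
    by (rule velocity_AE_bound)
  have "AE \<theta> in circle_measure. norm (flux \<alpha> \<sigma> f \<theta>)
      \<le> b powr (\<alpha> + 2) * ((V\<^sup>2 + \<sigma>\<^sup>2) powr ((\<alpha> - 1) / 2) * V)"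
    using V(2) ab
  proof eventually_elim
    case (elim \<theta>)
    have "f \<theta> powr (\<alpha> + 2) \<le> b powr (\<alpha> + 2)"
      using elim a \<alpha> by (intro powr_mono2) auto
    moreover have "(velocity f \<theta>)\<^sup>2 \<le> V\<^sup>2" using elim V(1) by (simp add: abs_le_square_iff[symmetric])
    then have "((velocity f \<theta>)\<^sup>2 + \<sigma>\<^sup>2) powr ((\<alpha> - 1) / 2) \<le> (V\<^sup>2 + \<sigma>\<^sup>2) powr ((\<alpha> - 1) / 2)"
      using \<alpha> by (intro powr_mono2) auto
    ultimately have "f \<theta> powr (\<alpha> + 2) * (((velocity f \<theta>)\<^sup>2 + \<sigma>\<^sup>2) powr ((\<alpha> - 1) / 2) * \<bar>velocity f \<theta>\<bar>)
        \<le> b powr (\<alpha> + 2) * ((V\<^sup>2 + \<sigma>\<^sup>2) powr ((\<alpha> - 1) / 2) * V)"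
      using elim by (intro mult_mono) auto
    then show ?case unfolding flux_eq by (simp add: abs_mult)
  qed
  then show ?thesis by (rule integrable_circle_bounded[OF flux_measurable])
qed

lemma velocity_flux_integrable: "integrable circle_measure (\<lambda>\<theta>. velocity f \<theta> * flux \<alpha> \<sigma> f \<theta>)"
proof -
  obtain V where V: "0 \<le> V" "AE \<theta> in circle_measure. \<bar>velocity f \<theta>\<bar> \<le> V"
    by (rule velocity_AE_bound)
  show ?thesis
    using velocity_square_integrable[OF f] V(2)
    by (intro integrable_circle_mult_bounded[OF flux_integrable, of _ V]) auto
qed

text \<open>As \<open>\<alpha> > 1\<close>, the power in \<open>psi\<close> increases with the
  velocity, so its value at zero velocity, \<open>\<sigma> powr (\<alpha> - 1)\<close>, is a lower
  bound. It is positive only because of the regularisation.\<close>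

lemma dissipation_ge:
  "a powr (\<alpha> + 2) * \<sigma> powr (\<alpha> - 1) * (\<integral>\<theta>. (velocity f \<theta>)\<^sup>2 \<partial>circle_measure)
    \<le> (\<integral>\<theta>. velocity f \<theta> * flux \<alpha> \<sigma> f \<theta> \<partial>circle_measure)"
proof -
  have "(\<integral>\<theta>. a powr (\<alpha> + 2) * \<sigma> powr (\<alpha> - 1) * (velocity f \<theta>)\<^sup>2 \<partial>circle_measure)
    \<le> (\<integral>\<theta>. velocity f \<theta> * flux \<alpha> \<sigma> f \<theta> \<partial>circle_measure)"
  proof (rule integral_mono_AE[OF _ velocity_flux_integrable])
    show "integrable circle_measure (\<lambda>\<theta>. a powr (\<alpha> + 2) * \<sigma> powr (\<alpha> - 1) * (velocity f \<theta>)\<^sup>2)"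
      by (rule integrable_mult_right) (use velocity_square_integrable[OF f] in blast)
    show "AE \<theta> in circle_measure. a powr (\<alpha> + 2) * \<sigma> powr (\<alpha> - 1) * (velocity f \<theta>)\<^sup>2
        \<le> velocity f \<theta> * flux \<alpha> \<sigma> f \<theta>"
      using ab
    proof eventually_elim
      case (elim \<theta>)
      have "(\<sigma>\<^sup>2) powr ((\<alpha> - 1) / 2) \<le> ((velocity f \<theta>)\<^sup>2 + \<sigma>\<^sup>2) powr ((\<alpha> - 1) / 2)"
        using \<alpha> by (intro powr_mono2) auto
      moreover have "(\<sigma>\<^sup>2) powr ((\<alpha> - 1) / 2) = \<sigma> powr (\<alpha> - 1)"
      proof -
        have "\<sigma>\<^sup>2 = \<sigma> powr 2" "2 * ((\<alpha> - 1) / 2) = \<alpha> - 1" using \<sigma> by simp_all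
        then show ?thesis by (simp only: powr_powr)
      qed
      ultimately have "a powr (\<alpha> + 2) * \<sigma> powr (\<alpha> - 1) * (velocity f \<theta>)\<^sup>2
          \<le> f \<theta> powr (\<alpha> + 2) * ((velocity f \<theta>)\<^sup>2 + \<sigma>\<^sup>2) powr ((\<alpha> - 1) / 2) * (velocity f \<theta>)\<^sup>2"
        using elim a \<alpha> by (intro mult_right_mono mult_mono powr_mono2) auto
      then show ?case unfolding flux_eq by (simp add: power2_eq_square[of "velocity f \<theta>"] mult_ac del: One_nat_def)
    qed
  qed
  then show ?thesis by (simp only: integral_mult_right_zero)
qed

text \<open>
  For small velocities the flux is linearly bounded by the velocity, for large ones it is
  bounded by the density of the dissipation.
\<close>

lemma flux_L1_bound:
  "(\<integral>\<theta>. \<bar>flux \<alpha> \<sigma> f \<theta>\<bar> \<partial>circle_measure)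
    \<le> b powr (\<alpha> + 2) * (1 + \<sigma>\<^sup>2) powr ((\<alpha> - 1) / 2) * (\<integral>\<theta>. \<bar>velocity f \<theta>\<bar> \<partial>circle_measure)
      + (\<integral>\<theta>. velocity f \<theta> * flux \<alpha> \<sigma> f \<theta> \<partial>circle_measure)"
proof -
  define L where "L = b powr (\<alpha> + 2) * (1 + \<sigma>\<^sup>2) powr ((\<alpha> - 1) / 2)"
  have v: "integrable circle_measure (\<lambda>\<theta>. L * \<bar>velocity f \<theta>\<bar>)"
    using square_integrable_integrable[OF velocity_square_integrable[OF f]]
    by (intro integrable_mult_right integrable_abs)
  have "(\<integral>\<theta>. \<bar>flux \<alpha> \<sigma> f \<theta>\<bar> \<partial>circle_measure)
      \<le> (\<integral>\<theta>. L * \<bar>velocity f \<theta>\<bar> + velocity f \<theta> * flux \<alpha> \<sigma> f \<theta> \<partial>circle_measure)"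
  proof (rule integral_mono_AE[OF integrable_abs[OF flux_integrable]
        Bochner_Integration.integrable_add[OF v velocity_flux_integrable]])
    show "AE \<theta> in circle_measure. \<bar>flux \<alpha> \<sigma> f \<theta>\<bar>
        \<le> L * \<bar>velocity f \<theta>\<bar> + velocity f \<theta> * flux \<alpha> \<sigma> f \<theta>"
      using ab
    proof eventually_elim
      case (elim \<theta>)
      define g where "g = f \<theta> powr (\<alpha> + 2) * ((velocity f \<theta>)\<^sup>2 + \<sigma>\<^sup>2) powr ((\<alpha> - 1) / 2)"
      define w where "w = velocity f \<theta>"
      have g: "g \<ge> 0" by (simp add: g_def)
      have flux: "flux \<alpha> \<sigma> f \<theta> = g * w"
        by (simp add: flux_eq g_def w_def mult.assoc)
      have "\<bar>g * w\<bar> \<le> L * \<bar>w\<bar> + w * (g * w)"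
      proof (cases "\<bar>w\<bar> \<le> 1")
        case True
        then have w1: "(velocity f \<theta>)\<^sup>2 \<le> 1" unfolding w_def abs_square_le_1 .
        have "((velocity f \<theta>)\<^sup>2 + \<sigma>\<^sup>2) powr ((\<alpha> - 1) / 2) \<le> (1 + \<sigma>\<^sup>2) powr ((\<alpha> - 1) / 2)"
          using \<alpha> w1 by (intro powr_mono2 add_mono order_refl) auto
        then have "g \<le> L"
          unfolding g_def L_def using elim a \<alpha> by (intro mult_mono[OF powr_mono2]) auto
        then have "g * \<bar>w\<bar> \<le> L * \<bar>w\<bar>" by (intro mult_right_mono) auto
        moreover have "0 \<le> w * (g * w)" using g by (simp add: mult.left_commute)
        ultimately show ?thesis using g by (simp add: abs_mult)
      next
        case False
        then have "\<bar>w\<bar> * 1 \<le> \<bar>w\<bar> * \<bar>w\<bar>" by (intro mult_left_mono) auto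
        then have "g * \<bar>w\<bar> \<le> g * (w * w)" using g by (intro mult_left_mono) auto
        moreover have "0 \<le> L * \<bar>w\<bar>" by (simp add: L_def)
        ultimately show ?thesis using g by (simp add: abs_mult mult_ac)
      qed
      then show ?case by (simp only: flux w_def)
    qed
  qed
  also have "\<dots> = L * (\<integral>\<theta>. \<bar>velocity f \<theta>\<bar> \<partial>circle_measure)
      + (\<integral>\<theta>. velocity f \<theta> * flux \<alpha> \<sigma> f \<theta> \<partial>circle_measure)"
    by (simp only: Bochner_Integration.integral_add[OF v velocity_flux_integrable] integral_mult_right_zero)
  finally show ?thesis by (simp only: L_def)
qed

text \<open>By the equation, the coefficient at \<open>n = 1\<close> has the size of the speed of
  the first modes. The linear part of the preceding bound becomes \<open>sqrt D\<close> by
  Cauchy-Schwarz and \<open>dissipation_ge\<close>; the large velocities are paid for by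
  \<open>D\<close> itself.\<close>

lemma norm_fourier_coeff_flux:
  defines "D \<equiv> \<integral>\<theta>. velocity f \<theta> * flux \<alpha> \<sigma> f \<theta> \<partial>circle_measure"
    and "\<kappa> \<equiv> a powr (\<alpha> + 2) * \<sigma> powr (\<alpha> - 1)"
    and "L \<equiv> b powr (\<alpha> + 2) * (1 + \<sigma>\<^sup>2) powr ((\<alpha> - 1) / 2)"
  shows "norm (fourier_coeff (flux \<alpha> \<sigma> f) n) \<le> (L * sqrt (2 * pi / \<kappa>) + 1) * (sqrt D + D)"
proof -
  have \<kappa>: "\<kappa> > 0" using a \<sigma> by (simp add: \<kappa>_def)
  have L: "L \<ge> 0" by (simp add: L_def)
  define I where "I = (\<integral>\<theta>. (velocity f \<theta>)\<^sup>2 \<partial>circle_measure)"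
  have I: "I \<ge> 0" by (simp add: I_def)
  have D: "\<kappa> * I \<le> D" unfolding D_def \<kappa>_def I_def by (rule dissipation_ge)
  then have D0: "D \<ge> 0" using I \<kappa> by (meson mult_nonneg_nonneg order_trans less_imp_le)
  have one: "square_integrable (\<lambda>_. 1)" by (rule square_integrable_continuous) simp
  have "(\<integral>\<theta>. \<bar>velocity f \<theta> * 1\<bar> \<partial>circle_measure) \<le> sqrt I * sqrt (2 * pi)"
    by (rule square_integral_cauchy_schwarz[OF velocity_square_integrable[OF f] one])
       (simp_all add: I measure_restrict_space I_def[symmetric] del: One_nat_def)
  also have "\<dots> \<le> sqrt (D / \<kappa>) * sqrt (2 * pi)"
    using D \<kappa> by (intro mult_right_mono real_sqrt_le_mono) (auto simp: field_simps)
  also have "\<dots> = sqrt (2 * pi / \<kappa>) * sqrt D"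
    by (simp add: real_sqrt_divide real_sqrt_mult)
  finally have v: "(\<integral>\<theta>. \<bar>velocity f \<theta>\<bar> \<partial>circle_measure) \<le> sqrt (2 * pi / \<kappa>) * sqrt D" by simp
  have "norm (fourier_coeff (flux \<alpha> \<sigma> f) n) \<le> 1 / (2 * pi) * (\<integral>\<theta>. \<bar>flux \<alpha> \<sigma> f \<theta>\<bar> \<partial>circle_measure)"
    by (rule norm_fourier_coeff_le)
  also have "\<dots> \<le> 1 * (\<integral>\<theta>. \<bar>flux \<alpha> \<sigma> f \<theta>\<bar> \<partial>circle_measure)"
    using pi_gt3 by (intro mult_right_mono) auto
  also have "\<dots> \<le> L * (\<integral>\<theta>. \<bar>velocity f \<theta>\<bar> \<partial>circle_measure) + D"
    unfolding L_def D_def mult_1 by (rule flux_L1_bound)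
  also have "\<dots> \<le> L * (sqrt (2 * pi / \<kappa>) * sqrt D) + D"
    using L v by (intro add_mono mult_left_mono) auto
  also have "\<dots> \<le> (L * sqrt (2 * pi / \<kappa>) + 1) * (sqrt D + D)"
  proof -
    have "0 \<le> L * sqrt (2 * pi / \<kappa>) * D" "0 \<le> sqrt D" using L \<kappa> D0 by auto
    then show ?thesis by (simp add: algebra_simps)
  qed
  finally show ?thesis .
qed

end

section \<open>From almost every time to every time, and the bootstrap\<close>

lemma AE_open_dense:
  fixes T :: real
  assumes AE: "AE t in lebesgue_on {0<..<T}. R t" and U: "open U" "t \<in> U" "t \<in> {0<..<T}"
  shows "\<exists>s\<in>U \<inter> {0<..<T}. R s"
proof (rule ccontr)
  assume no: "\<not> ?thesis"
  obtain N where N: "N \<in> null_sets (lebesgue_on {0<..<T})" "{s\<in>{0<..<T}. \<not> R s} \<subseteq> N"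
    using AE by (auto simp: eventually_ae_filter)
  then have "N \<in> null_sets lebesgue" by (simp add: null_sets_restrict_space)
  moreover have "U \<inter> {0<..<T} \<subseteq> N" using no N(2) by blast
  ultimately have "negligible (U \<inter> {0<..<T})"
    using negligible_iff_null_sets negligible_subset by blast
  moreover have "open (U \<inter> {0<..<T})" "U \<inter> {0<..<T} \<noteq> {}"
    using U by (auto intro: open_Int)
  ultimately show False using open_not_negligible by blast
qed

text \<open>A violation would persist on a nonempty open set, which is not negligible. Monotonicity
  arguments need the differential inequalities at every time of \<open>U\<close>.\<close>

lemma AE_continuous_le:
  fixes T :: real and G :: "real \<Rightarrow> real"
  assumes AE: "AE t in lebesgue_on {0<..<T}. t \<in> U \<longrightarrow> G t \<le> 0" and U: "open U"
    and G: "continuous_on {0<..<T} G" and t: "t \<in> U" "t \<in> {0<..<T}"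
  shows "G t \<le> 0"
proof (rule ccontr)
  assume "\<not> G t \<le> 0"
  have "open {s\<in>{0<..<T}. G s \<in> {0<..}}"
    using continuous_open_preimage[OF G open_greaterThanLessThan open_greaterThan, of 0]
    by (simp add: vimage_def Int_def conj_commute)
  then have "\<exists>s\<in>(U \<inter> {s\<in>{0<..<T}. G s \<in> {0<..}}) \<inter> {0<..<T}. s \<in> U \<longrightarrow> G s \<le> 0"
    using t U \<open>\<not> G t \<le> 0\<close> by (intro AE_open_dense[OF AE, of _ t]) auto
  then show False by auto
qed

text \<open>
  A bootstrap: as long as \<open>z\<close> and \<open>E\<close> are small, \<open>E\<close> decays exponentially, and the path
  traced by \<open>z\<close> has length \<open>O(\<epsilon>)\<close> because the dissipation \<open>- E'\<close> is integrable
  against \<open>exp (\<mu> t)\<close>.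
\<close>

lemma exponential_decay_bootstrap:
  fixes E E' :: "real \<Rightarrow> real" and z z' :: "real \<Rightarrow> complex" and T \<epsilon> \<mu> K S \<delta> :: real
  assumes contE: "continuous_on {0..<T} E" and contz: "continuous_on {0..<T} z"
    and derE: "\<And>t. t \<in> {0<..<T} \<Longrightarrow> (E has_real_derivative E' t) (at t)"
    and derRe: "\<And>t. t \<in> {0<..<T} \<Longrightarrow> ((\<lambda>t. Re (z t)) has_real_derivative Re (z' t)) (at t)"
    and derIm: "\<And>t. t \<in> {0<..<T} \<Longrightarrow> ((\<lambda>t. Im (z t)) has_real_derivative Im (z' t)) (at t)"
    and E0: "\<And>t. t \<in> {0..<T} \<Longrightarrow> 0 \<le> E t"
    and decay: "\<And>t. t \<in> {0<..<T} \<Longrightarrow> 2 * norm (z t) + S * sqrt (E t) < \<delta> \<Longrightarrow>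
      E' t \<le> - (2 * \<mu> * E t) \<and> norm (z' t) \<le> K * (sqrt (- E' t) - E' t)"
    and init: "E 0 \<le> \<epsilon>\<^sup>2" "norm (z 0) \<le> \<epsilon>"
    and pos: "0 < \<epsilon>" "\<epsilon> \<le> 1" "0 < \<mu>" "0 \<le> K" "0 \<le> S"
    and small: "\<epsilon> * (4 * (1 + 3 * K + K / (2 * \<mu>)) + S) < \<delta>"
    and t: "t \<in> {0..<T}"
  shows "E t \<le> \<epsilon>\<^sup>2 * exp (- (\<mu> * t))"
proof -
  define G where "G = (\<lambda>t. 2 * norm (z t) + S * sqrt (E t))"
  define M where "M = 3 * K + K / (2 * \<mu>)"
  define Q where "Q = (\<lambda>t. exp (\<mu> * t) * E t)"
  have derQ: "(Q has_real_derivative exp (\<mu> * u) * (\<mu> * E u + E' u)) (at u)"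
    if "u \<in> {0<..<T}" for u
    unfolding Q_def using derE[OF that]
    by (auto intro!: derivative_eq_intros simp: algebra_simps)
  have contG: "continuous_on {0..<T} G"
    unfolding G_def by (intro continuous_intros contE contz)
  have contQ: "continuous_on {0..<T} Q"
    unfolding Q_def by (intro continuous_intros contE)
  \<comment> \<open>Continuous induction: the bound before time \<open>s\<close> yields the strict
    bound at \<open>s\<close> itself. For \<open>s = 0\<close> its hypothesis is void.\<close>
  have step: "Q s \<le> \<epsilon>\<^sup>2 \<and> G s < \<delta>"
    if s: "s \<in> {0..<T}" and G: "\<And>u. 0 < u \<Longrightarrow> u < s \<Longrightarrow> G u < \<delta>" for s
  proof -
    have sub: "{0..s} \<subseteq> {0..<T}" using s by auto
    \<comment> \<open>The decay hypothesis has rate \<open>2 * \<mu>\<close>, but only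
      \<open>\<mu>\<close> is claimed: half of the dissipation absorbs the derivative of the weight
      in \<open>Q\<close>, the other half remains to control the path of \<open>z\<close>.\<close>
    have dec: "\<mu> * E u + E' u \<le> E' u / 2 \<and> E' u \<le> 0
        \<and> norm (z' u) \<le> K * (sqrt (- E' u) - E' u)" if u: "0 < u" "u < s" for u
    proof -
      have "u \<in> {0<..<T}" "u \<in> {0..<T}" using u s by auto
      with decay[of u] G[OF u] E0[of u] pos
      have "E' u \<le> - (2 * \<mu> * E u)" "norm (z' u) \<le> K * (sqrt (- E' u) - E' u)" "0 \<le> \<mu> * E u"
        by (auto simp: G_def)
      then show ?thesis by auto
    qed
    have Q: "Q s \<le> Q 0"
    proof (cases "s = 0")
      case False
      show ?thesis
      proof (rule DERIV_nonpos_imp_decreasing_open[of 0 s Q])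
        fix u assume u: "0 < u" "u < s"
        then have "exp (\<mu> * u) * (\<mu> * E u + E' u) \<le> 0"
          using dec[OF u] by (intro mult_nonneg_nonpos) auto
        then show "\<exists>y. (Q has_real_derivative y) (at u) \<and> y \<le> 0"
          using derQ[of u] u s by auto
      qed (use False s continuous_on_subset[OF contQ sub] in auto)
    qed simp
    also have "Q 0 \<le> \<epsilon>\<^sup>2" using init by (simp add: Q_def)
    finally have Qs: "Q s \<le> \<epsilon>\<^sup>2" .
    have Qs0: "0 \<le> Q s" using E0[OF s] by (simp add: Q_def)
    \<comment> \<open>One-sided, hence applied to the real and imaginary parts and to their
      negatives.\<close>
    have path: "x s \<le> x 0 + \<epsilon> * M"
      if derx: "\<And>u. u \<in> {0<..<T} \<Longrightarrow> (x has_real_derivative x' u) (at u)"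
        and x': "\<And>u. \<bar>x' u\<bar> \<le> norm (z' u)" and contx: "continuous_on {0..<T} x"
      for x x' :: "real \<Rightarrow> real"
    proof (cases "s = 0")
      case True
      then show ?thesis using pos by (simp add: M_def)
    next
      case False
      \<comment> \<open>A Lyapunov function for the path: \<open>Q\<close> decreases at least at the
        rate \<open>e * D / 2\<close> and the last term at the rate
        \<open>K * \<epsilon> / (2 * e)\<close>, which together outweigh the growth of
        \<open>x\<close>.\<close>
      define W where "W = (\<lambda>u. x u + K * (1 / \<epsilon> + 2) * Q u + K * \<epsilon> / (2 * \<mu>) * exp (- (\<mu> * u)))"
      have "W s \<le> W 0"
      proof (rule DERIV_nonpos_imp_decreasing_open[of 0 s W])
        fix u assume u: "0 < u" "u < s"
        define D where "D = - E' u"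
        define e where "e = exp (\<mu> * u)"
        have D: "D \<ge> 0" and zD: "norm (z' u) \<le> K * (sqrt D + D)"
          using dec[OF u] by (auto simp: D_def)
        have e: "e \<ge> 1" using u pos by (simp add: e_def)
        have "(W has_real_derivative x' u + K * (1 / \<epsilon> + 2) * (e * (\<mu> * E u + E' u))
            - K * \<epsilon> / 2 * (1 / e)) (at u)"
          unfolding W_def e_def using derx[of u] derQ[of u] u s pos
          by (auto intro!: derivative_eq_intros simp: exp_minus field_simps)
        moreover have "x' u + K * (1 / \<epsilon> + 2) * (e * (\<mu> * E u + E' u)) - K * \<epsilon> / 2 * (1 / e) \<le> 0"
        proof -
          \<comment> \<open>The weight \<open>e / \<epsilon>\<close> in this arithmetic-geometric
            inequality makes both parts of order \<open>\<epsilon>\<close> after integration: the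
            weighted dissipation has integral \<open>O(\<epsilon>\<^sup>2)\<close>, and
            \<open>\<epsilon> / e\<close> is integrable in time.\<close>
          have "0 \<le> (e * sqrt D - \<epsilon>)\<^sup>2 / (2 * \<epsilon> * e)" using pos e by simp
          also have "\<dots> = e * D / (2 * \<epsilon>) + \<epsilon> / (2 * e) - sqrt D"
            using pos e D by (simp add: power2_diff power_mult_distrib field_simps power2_eq_square)
          finally have sq: "sqrt D \<le> e * D / (2 * \<epsilon>) + \<epsilon> / (2 * e)" by simp
          have "D * 1 \<le> D * e" using D e by (intro mult_left_mono) auto
          moreover have "(1 / \<epsilon> + 2) * (e * D / 2) + \<epsilon> / 2 * (1 / e)
              = e * D / (2 * \<epsilon>) + D * e + \<epsilon> / (2 * e)"
            using pos e by (simp add: field_simps)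
          ultimately have "sqrt D + D \<le> (1 / \<epsilon> + 2) * (e * D / 2) + \<epsilon> / 2 * (1 / e)"
            using sq by linarith
          then have "K * (sqrt D + D) \<le> K * ((1 / \<epsilon> + 2) * (e * D / 2) + \<epsilon> / 2 * (1 / e))"
            using pos by (intro mult_left_mono)
          moreover have "K * (1 / \<epsilon> + 2) * (e * (\<mu> * E u + E' u)) \<le> K * (1 / \<epsilon> + 2) * (e * (- D / 2))"
            using dec[OF u] pos e by (intro mult_left_mono) (auto simp: D_def)
          moreover have "x' u \<le> norm (z' u)" using x'[of u] by linarith
          moreover have "K * ((1 / \<epsilon> + 2) * (e * D / 2) + \<epsilon> / 2 * (1 / e))
              = - (K * (1 / \<epsilon> + 2) * (e * (- D / 2))) + K * \<epsilon> / 2 * (1 / e)"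
            by (simp add: algebra_simps)
          ultimately show ?thesis using zD by linarith
        qed
        ultimately show "\<exists>y. (W has_real_derivative y) (at u) \<and> y \<le> 0" by blast
      next
        show "continuous_on {0..s} W"
          unfolding W_def
          by (intro continuous_intros continuous_on_subset[OF contx sub] continuous_on_subset[OF contQ sub])
      qed (use False s in auto)
      moreover have "x s \<le> W s" using pos Qs0 by (simp add: W_def)
      moreover have "W 0 \<le> x 0 + \<epsilon> * M"
      proof -
        \<comment> \<open>Here \<open>\<epsilon> \<le> 1\<close> makes the quadratic term linear;
          the terms \<open>\<epsilon>\<close> and \<open>2 * \<epsilon>\<close> give the
          \<open>3 * K\<close> in \<open>M\<close>.\<close>
        have "K * (1 / \<epsilon> + 2) * Q 0 \<le> K * (1 / \<epsilon> + 2) * \<epsilon>\<^sup>2"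
          using pos \<open>Q 0 \<le> \<epsilon>\<^sup>2\<close> by (intro mult_left_mono) auto
        also have "\<dots> = K * (\<epsilon> + 2 * (\<epsilon> * \<epsilon>))" using pos by (simp add: field_simps power2_eq_square)
        also have "\<dots> \<le> K * (\<epsilon> + 2 * (\<epsilon> * 1))"
          using pos by (intro mult_left_mono add_mono) auto
        finally show ?thesis by (simp add: W_def M_def algebra_simps)
      qed
      ultimately show ?thesis by linarith
    qed
    have cRe: "continuous_on {0..<T} (\<lambda>u. Re (z u))" and cIm: "continuous_on {0..<T} (\<lambda>u. Im (z u))"
      by (intro continuous_intros contz)+
    have "Re (z s) \<le> Re (z 0) + \<epsilon> * M" "Im (z s) \<le> Im (z 0) + \<epsilon> * M"
      by (rule path[OF derRe abs_Re_le_cmod cRe] path[OF derIm abs_Im_le_cmod cIm]; assumption)+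
    moreover have "- Re (z s) \<le> - Re (z 0) + \<epsilon> * M" "- Im (z s) \<le> - Im (z 0) + \<epsilon> * M"
      by (rule path[OF DERIV_minus[OF derRe] _ continuous_on_minus[OF cRe]]
            path[OF DERIV_minus[OF derIm] _ continuous_on_minus[OF cIm]];
          simp add: abs_Re_le_cmod abs_Im_le_cmod)+
    moreover have "\<bar>Re (z 0)\<bar> \<le> \<epsilon>" "\<bar>Im (z 0)\<bar> \<le> \<epsilon>"
      using abs_Re_le_cmod[of "z 0"] abs_Im_le_cmod[of "z 0"] init(2) by linarith+
    moreover have "\<bar>y\<bar> \<le> \<epsilon> + \<epsilon> * M"
      if "y \<le> y0 + \<epsilon> * M" "- y \<le> - y0 + \<epsilon> * M" "\<bar>y0\<bar> \<le> \<epsilon>" for y y0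
      using that by linarith
    ultimately have "\<bar>Re (z s)\<bar> \<le> \<epsilon> + \<epsilon> * M" "\<bar>Im (z s)\<bar> \<le> \<epsilon> + \<epsilon> * M" by blast+
    \<comment> \<open>Bounding the modulus by the two parts doubles the constant, which gives the
      factor \<open>4\<close> in \<open>small\<close>.\<close>
    then have "2 * norm (z s) \<le> 2 * ((\<epsilon> + \<epsilon> * M) + (\<epsilon> + \<epsilon> * M))"
      by (intro mult_left_mono order_trans[OF cmod_le add_mono]) auto
    moreover have "S * sqrt (E s) \<le> S * \<epsilon>"
    proof -
      have "1 * E s \<le> exp (\<mu> * s) * E s" using E0[OF s] s pos by (intro mult_right_mono) auto
      then have "E s \<le> \<epsilon>\<^sup>2" using Qs by (simp add: Q_def)
      then have "sqrt (E s) \<le> \<epsilon>" using pos real_sqrt_le_mono[of "E s" "\<epsilon>\<^sup>2"] by simp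
      then show ?thesis using pos by (intro mult_left_mono) auto
    qed
    ultimately have "G s \<le> 2 * ((\<epsilon> + \<epsilon> * M) + (\<epsilon> + \<epsilon> * M)) + S * \<epsilon>"
      unfolding G_def by (rule add_mono)
    also have "\<dots> = \<epsilon> * (4 * (1 + 3 * K + K / (2 * \<mu>)) + S)" by (simp add: M_def algebra_simps)
    also have "\<dots> < \<delta>" by (rule small)
    finally show ?thesis using Qs by blast
  qed
  have "G u < \<delta>" if u: "u \<in> {0..<T}" for u
  proof (rule ccontr)
    assume "\<not> G u < \<delta>"
    \<comment> \<open>The least element of this compact set is the first time at which the bound
      fails, and \<open>step\<close> excludes it.\<close>
    define B where "B = {s \<in> {0..u}. G s \<in> {\<delta>..}}"
    have "continuous_on {0..u} G" using contG u by (auto intro: continuous_on_subset)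
    then have "closed B" unfolding B_def
      using continuous_closed_preimage[of "{0..u}" G "{\<delta>..}"] by (simp add: vimage_def Int_def conj_commute)
    then have "compact B" using compact_Int_closed[of "{0..u}" B] by (simp add: B_def Int_absorb1 subset_iff)
    moreover have "B \<noteq> {}" using u \<open>\<not> G u < \<delta>\<close> by (auto simp: B_def)
    ultimately obtain s where s: "s \<in> B" "\<forall>r\<in>B. s \<le> r"
      using compact_attains_inf[of B] by metis
    have "G r < \<delta>" if r: "0 < r" "r < s" for r
    proof (rule ccontr)
      assume "\<not> G r < \<delta>"
      then have "r \<in> B" using s(1) r by (simp add: B_def)
      then show False using s(2) r by auto
    qed
    then have "G s < \<delta>" using step[of s] s(1) u by (auto simp: B_def)
    then show False using s(1) by (simp add: B_def)
  qed
  then have "Q t \<le> \<epsilon>\<^sup>2" using step[OF t] t by auto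
  have "E t = Q t * exp (- (\<mu> * t))" by (simp add: Q_def exp_minus)
  also have "\<dots> \<le> \<epsilon>\<^sup>2 * exp (- (\<mu> * t))"
    using \<open>Q t \<le> \<epsilon>\<^sup>2\<close> by (rule mult_right_mono) simp
  finally show ?thesis .
qed

text \<open>From \<open>1 + x \<le> exp x\<close> and
  \<open>\<epsilon> powr (\<alpha> - 1) \<le> 1\<close>; with
  \<open>c = \<mu> * (\<alpha> - 1)\<close> the outer power turns \<open>exp (c * t)\<close> into
  exactly \<open>exp (\<mu> * t)\<close>.\<close>

lemma Lambda_ge_exp:
  assumes "1 < \<alpha>" "0 \<le> t" "0 < \<epsilon>" "\<epsilon> \<le> 1" "0 < \<mu>"
  shows "\<epsilon> * exp (- (\<mu> * t)) \<le> Lambda \<alpha> (\<mu> * (\<alpha> - 1)) \<epsilon> t"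
proof -
  define c where "c = \<mu> * (\<alpha> - 1)"
  have c: "c > 0" using assms by (simp add: c_def)
  have "\<epsilon> powr (\<alpha> - 1) \<le> 1" using assms by (simp add: powr_le1)
  then have "c * \<epsilon> powr (\<alpha> - 1) * t \<le> c * 1 * t"
    using c assms by (intro mult_right_mono mult_left_mono) auto
  also have "1 + c * 1 * t \<le> exp (c * t)" using exp_ge_add_one_self[of "c * t"] by simp
  finally have le: "1 + c * \<epsilon> powr (\<alpha> - 1) * t \<le> exp (c * t)" by simp
  have pos: "0 < 1 + c * \<epsilon> powr (\<alpha> - 1) * t" using c assms by (simp add: add_pos_nonneg)
  have "(1 + c * \<epsilon> powr (\<alpha> - 1) * t) powr (1 / (\<alpha> - 1)) \<le> exp (c * t) powr (1 / (\<alpha> - 1))"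
    using le pos assms by (intro powr_mono2) auto
  also have "\<dots> = exp (\<mu> * t)" using assms by (simp add: exp_powr_real c_def)
  finally have "\<epsilon> / exp (\<mu> * t) \<le> \<epsilon> / (1 + c * \<epsilon> powr (\<alpha> - 1) * t) powr (1 / (\<alpha> - 1))"
    using pos assms by (intro divide_left_mono) auto
  then show ?thesis by (simp add: Lambda_def c_def exp_minus divide_inverse)
qed

section \<open>Solutions of the regularised problem\<close>

lemma has_weak_deriv_zero: "has_weak_deriv k (\<lambda>_. 0 :: real) (\<lambda>_. 0)"
  by (simp add: has_weak_deriv_def)

lemma sobolev_norm_zero: "sobolev_norm k p (\<lambda>_. 0 :: real) = 0"
proof -
  have "(\<integral>\<theta>. norm (weak_deriv j (\<lambda>_. 0 :: real) \<theta>) powr p \<partial>circle_measure) = 0" for j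
  proof (rule integral_eq_zero_AE)
    show "AE \<theta> in circle_measure. norm (weak_deriv j (\<lambda>_. 0 :: real) \<theta>) powr p = 0"
      using AE_weak_deriv_eq[OF has_weak_deriv_zero[of j]] by eventually_elim simp
  qed
  then show ?thesis by (simp add: sobolev_norm_def)
qed

lemma sobolev_zero: "(\<lambda>_. 0 :: real) \<in> sobolev k p"
  unfolding sobolev_def mem_Collect_eq periodic_def
  using has_weak_deriv_zero by (auto intro!: exI[of _ "\<lambda>_. 0"])

lemma sobolev_Re_cis:
  assumes "0 < p"
  shows "(\<lambda>\<theta>. Re (c * cis (of_int n * \<theta>))) \<in> sobolev 1 p"
  unfolding sobolev_def mem_Collect_eq
proof (intro conjI allI impI)
  show "periodic (\<lambda>\<theta>. Re (c * cis (of_int n * \<theta>)))"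
    unfolding periodic_def cis_periodic by simp
  fix j :: nat assume "j \<le> 1"
  have int: "integrable circle_measure (\<lambda>\<theta>. norm (Re (d * cis (of_int n * \<theta>))) powr p)" for d
    using assms
    by (intro integrable_circle_continuous continuous_on_powr' continuous_intros) auto
  have "has_weak_deriv 0 (\<lambda>\<theta>. Re (c * cis (of_int n * \<theta>))) (\<lambda>\<theta>. Re (c * cis (of_int n * \<theta>)))"
    by (intro has_weak_deriv_0 integrable_circle_continuous continuous_intros)
  then show "\<exists>g. has_weak_deriv j (\<lambda>\<theta>. Re (c * cis (of_int n * \<theta>))) g
      \<and> integrable circle_measure (\<lambda>\<theta>. norm (g \<theta>) powr p)"
    using int[of c] int[of "\<i> * of_int n * c"] has_weak_deriv_Re_cis[of c n] \<open>j \<le> 1\<close>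
    by (cases "j = 0") (blast, metis One_nat_def le_Suc_eq le_zero_eq)
qed

text \<open>Test functions localised in time. They take two values only, so the constant sequence
  witnesses strong measurability.\<close>

lemma sobolev_Lp_indicator:
  assumes A: "A \<in> sets (lebesgue_on {0<..<T})" and \<eta>: "\<eta> \<in> sobolev k p"
  shows "sobolev_Lp {0<..<T} k p (\<lambda>t. if t \<in> A then \<eta> else (\<lambda>_. 0 :: real))"
    (is "sobolev_Lp ?I k p ?\<phi>")
  unfolding sobolev_Lp_def
proof (intro conjI exI[of _ "\<lambda>_. ?\<phi>"] allI)
  have mem: "?\<phi> t \<in> sobolev k p" for t using \<eta> sobolev_zero[of k p] by simp
  then show "AE t in lebesgue_on ?I. ?\<phi> t \<in> sobolev k p" "\<forall>t\<in>?I. ?\<phi> t \<in> sobolev k p" by auto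
  show "simple_function (lebesgue_on ?I) ?\<phi>"
    using A by (intro simple_function_If_set simple_function_const) auto
  show "AE t in lebesgue_on ?I. (\<lambda>n. sobolev_norm k p (\<lambda>\<theta>. ?\<phi> t \<theta> - ?\<phi> t \<theta>)) \<longlonglongrightarrow> 0"
    by (simp add: sobolev_norm_zero)
  have fin: "finite_measure (lebesgue_on ?I)" by (rule finite_measure_lebesgue_on) simp
  have "integrable (lebesgue_on ?I) (\<lambda>t. indicator A t * sobolev_norm k p \<eta> powr p)"
  proof (rule finite_measure.integrable_const_bound[OF fin])
    show "AE t in lebesgue_on ?I. norm (indicator A t * sobolev_norm k p \<eta> powr p)
        \<le> sobolev_norm k p \<eta> powr p"
      by (simp add: indicator_def)
    show "(\<lambda>t. indicator A t * sobolev_norm k p \<eta> powr p) \<in> borel_measurable (lebesgue_on ?I)"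
      using A by (intro borel_measurable_times borel_measurable_indicator) auto
  qed
  moreover have "sobolev_norm k p (?\<phi> t) powr p = indicator A t * sobolev_norm k p \<eta> powr p" for t
    by (simp add: sobolev_norm_zero)
  ultimately show "integrable (lebesgue_on ?I) (\<lambda>t. sobolev_norm k p (?\<phi> t) powr p)" by simp
qed

text \<open>The test functions equal to \<open>\<eta>\<close> on \<open>A\<close> and zero elsewhere
  show that two integrable functions of time have the same integral over every measurable
  \<open>A\<close>, so they agree almost everywhere.\<close>

lemma weak_form_AE:
  fixes dth F :: "real \<Rightarrow> real \<Rightarrow> real"
  assumes weak: "\<And>\<phi>. sobolev_Lp {0<..<T} k p \<phi> \<Longrightarrow>
      integrable (lebesgue_on {0<..<T}) (\<lambda>t. \<integral>\<theta>. dth t \<theta> * \<phi> t \<theta> \<partial>circle_measure) \<and>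
      integrable (lebesgue_on {0<..<T})
        (\<lambda>t. \<integral>\<theta>. F t \<theta> * weak_deriv 1 (\<phi> t) \<theta> \<partial>circle_measure) \<and>
      (\<integral>t. (\<integral>\<theta>. dth t \<theta> * \<phi> t \<theta> \<partial>circle_measure) \<partial>lebesgue_on {0<..<T})
        = (\<integral>t. (\<integral>\<theta>. F t \<theta> * weak_deriv 1 (\<phi> t) \<theta> \<partial>circle_measure) \<partial>lebesgue_on {0<..<T})"
    and \<eta>: "\<eta> \<in> sobolev k p"
  shows "AE t in lebesgue_on {0<..<T}. (\<integral>\<theta>. dth t \<theta> * \<eta> \<theta> \<partial>circle_measure)
     = (\<integral>\<theta>. F t \<theta> * weak_deriv 1 \<eta> \<theta> \<partial>circle_measure)"
proof (rule density_unique_real)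
  let ?I = "{0<..<T}"
  let ?p = "\<lambda>t. \<integral>\<theta>. dth t \<theta> * \<eta> \<theta> \<partial>circle_measure"
  let ?q = "\<lambda>t. \<integral>\<theta>. F t \<theta> * weak_deriv 1 \<eta> \<theta> \<partial>circle_measure"
  \<comment> \<open>Outside \<open>A\<close> the weak derivative is a chosen one of the zero
    function, which vanishes only almost everywhere.\<close>
  have zero: "(\<integral>\<theta>. F t \<theta> * weak_deriv 1 (\<lambda>_. 0 :: real) \<theta> \<partial>circle_measure) = 0" for t
  proof (rule integral_eq_zero_AE)
    show "AE \<theta> in circle_measure. F t \<theta> * weak_deriv 1 (\<lambda>_. 0 :: real) \<theta> = 0"
      using AE_weak_deriv_eq[OF has_weak_deriv_zero[of 1]] by eventually_elim simp
  qed
  have p: "(\<integral>\<theta>. dth t \<theta> * (if t \<in> A then \<eta> else (\<lambda>_. 0)) \<theta> \<partial>circle_measure)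
      = indicator A t *\<^sub>R ?p t" for t A
    by simp
  have q: "(\<integral>\<theta>. F t \<theta> * weak_deriv 1 (if t \<in> A then \<eta> else (\<lambda>_. 0)) \<theta> \<partial>circle_measure)
      = indicator A t *\<^sub>R ?q t" for t A
    using zero[of t] by (cases "t \<in> A") simp_all
  have main: "integrable (lebesgue_on ?I) (\<lambda>t. indicator A t *\<^sub>R ?p t)
      \<and> integrable (lebesgue_on ?I) (\<lambda>t. indicator A t *\<^sub>R ?q t)
      \<and> (\<integral>t. indicator A t *\<^sub>R ?p t \<partial>lebesgue_on ?I) = (\<integral>t. indicator A t *\<^sub>R ?q t \<partial>lebesgue_on ?I)"
    if "A \<in> sets (lebesgue_on ?I)" for A
    using weak[OF sobolev_Lp_indicator[OF that \<eta>]] unfolding p q .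
  have "integrable (lebesgue_on ?I) ?p \<longleftrightarrow> integrable (lebesgue_on ?I) (\<lambda>t. indicator ?I t *\<^sub>R ?p t)"
    "integrable (lebesgue_on ?I) ?q \<longleftrightarrow> integrable (lebesgue_on ?I) (\<lambda>t. indicator ?I t *\<^sub>R ?q t)"
    by (rule Bochner_Integration.integrable_cong; simp)+
  then show "integrable (lebesgue_on ?I) ?p" "integrable (lebesgue_on ?I) ?q"
    using main[of ?I] by auto
  show "(\<integral>t\<in>A. ?p t \<partial>lebesgue_on ?I) = (\<integral>t\<in>A. ?q t \<partial>lebesgue_on ?I)"
    if "A \<in> sets (lebesgue_on ?I)" for A
    using main[OF that] unfolding set_lebesgue_integral_def by blast
qed

section \<open>Differentiation in time of coefficients and energy\<close>

lemma sobolev_continuous_mono: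
  fixes u :: "real \<Rightarrow> real \<Rightarrow> real"
  assumes "sobolev_continuous I k 2 u" "j \<le> k"
  shows "sobolev_continuous I j 2 u"
  unfolding sobolev_continuous_def
proof (intro conjI ballI)
  fix t assume t: "t \<in> I"
  show "u t \<in> sobolev j 2"
    using assms(1) t by (intro sobolev_mono[OF _ assms(2)]) (simp add: sobolev_continuous_def)
  have "((\<lambda>s. sobolev_norm k 2 (\<lambda>\<theta>. u s \<theta> - u t \<theta>)) \<longlongrightarrow> 0) (at t within I)"
    using assms t by (auto simp: sobolev_continuous_def)
  then show "((\<lambda>s. sobolev_norm j 2 (\<lambda>\<theta>. u s \<theta> - u t \<theta>)) \<longlongrightarrow> 0) (at t within I)"
    by (intro Lim_null_comparison[of "\<lambda>s. sobolev_norm j 2 (\<lambda>\<theta>. u s \<theta> - u t \<theta>)"])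
       (simp_all add: sobolev_norm_nonneg sobolev_norm_mono[OF assms(2)])
qed

lemma sobolev_continuousD:
  assumes "sobolev_continuous I k p u" "t \<in> I"
  shows "u t \<in> sobolev k p" "\<forall>\<^sub>F s in at t within I. u s \<in> sobolev k p"
    "((\<lambda>s. sobolev_norm k p (\<lambda>\<theta>. u s \<theta> - u t \<theta>)) \<longlongrightarrow> 0) (at t within I)"
  using assms by (auto simp: sobolev_continuous_def eventually_at_filter)

lemma continuous_on_fourier_coeff:
  assumes "sobolev_continuous I 1 2 u"
  shows "continuous_on I (\<lambda>t. fourier_coeff (u t) n)"
  unfolding continuous_on_def
proof
  fix t assume "t \<in> I"
  note D = sobolev_continuousD[OF assms this]
  show "((\<lambda>t. fourier_coeff (u t) n) \<longlongrightarrow> fourier_coeff (u t) n) (at t within I)"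
    by (rule fourier_coeff_tendsto[OF D(2,1,3)])
qed

lemma continuous_on_energy_form:
  assumes "sobolev_continuous I 1 2 u" "sobolev_continuous I 1 2 w"
  shows "continuous_on I (\<lambda>t. energy_form (u t) (w t))"
  unfolding continuous_on_def
proof
  fix t assume t: "t \<in> I"
  note D = sobolev_continuousD[OF assms(1) t] sobolev_continuousD[OF assms(2) t]
  show "((\<lambda>t. energy_form (u t) (w t)) \<longlongrightarrow> energy_form (u t) (w t)) (at t within I)"
    by (rule energy_form_tendsto[OF D(2,1,3) D(5,4,6)])
qed

context
  fixes u v :: "real \<Rightarrow> real \<Rightarrow> real" and I :: "real set" and k :: nat
  assumes C1: "sobolev_C1 I k 2 u v" and I: "open I" and k: "1 \<le> k"
begin

lemma sobolev_C1_continuous: "sobolev_continuous I 1 2 u" "sobolev_continuous I 1 2 v"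
  using C1 by (auto simp only: sobolev_C1_def intro: sobolev_continuous_mono[OF _ k])

lemma sobolev_C1_quotient:
  assumes t: "t \<in> I"
  defines "q \<equiv> \<lambda>s \<theta>. inverse (s - t) * (u s \<theta> - u t \<theta>)"
  shows "\<forall>\<^sub>F s in at t. q s \<in> sobolev 1 2"
    "((\<lambda>s. sobolev_norm 1 2 (\<lambda>\<theta>. q s \<theta> - v t \<theta>)) \<longlongrightarrow> 0) (at t)"
proof -
  note D = sobolev_continuousD[OF sobolev_C1_continuous(1) t, unfolded at_within_open[OF t I]]
  show "\<forall>\<^sub>F s in at t. q s \<in> sobolev 1 2"
    unfolding q_def
    using D(2) by eventually_elim (rule sobolev_cmult[OF sobolev_diff[OF _ D(1)]])
  have "((\<lambda>s. sobolev_norm k 2 (\<lambda>\<theta>. q s \<theta> - v t \<theta>)) \<longlongrightarrow> 0) (at t within I)"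
    using C1 t unfolding sobolev_C1_def q_def by simp
  then have "((\<lambda>s. sobolev_norm k 2 (\<lambda>\<theta>. q s \<theta> - v t \<theta>)) \<longlongrightarrow> 0) (at t)"
    by (simp only: at_within_open[OF t I])
  then show "((\<lambda>s. sobolev_norm 1 2 (\<lambda>\<theta>. q s \<theta> - v t \<theta>)) \<longlongrightarrow> 0) (at t)"
    by (intro Lim_null_comparison[of "\<lambda>s. sobolev_norm 1 2 (\<lambda>\<theta>. q s \<theta> - v t \<theta>)"])
       (simp_all add: sobolev_norm_nonneg sobolev_norm_mono[OF k] del: One_nat_def)
qed

lemma fourier_coeff_quotient_tendsto:
  assumes t: "t \<in> I"
  shows "((\<lambda>s. (fourier_coeff (u s) n - fourier_coeff (u t) n) / of_real (s - t))
    \<longlongrightarrow> fourier_coeff (v t) n) (at t)"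
proof -
  note Du = sobolev_continuousD[OF sobolev_C1_continuous(1) t, unfolded at_within_open[OF t I]]
  note Dv = sobolev_continuousD[OF sobolev_C1_continuous(2) t]
  have "((\<lambda>s. fourier_coeff (\<lambda>\<theta>. inverse (s - t) * (u s \<theta> - u t \<theta>)) n)
      \<longlongrightarrow> fourier_coeff (v t) n) (at t)"
    by (rule fourier_coeff_tendsto[OF sobolev_C1_quotient(1)[OF t] Dv(1) sobolev_C1_quotient(2)[OF t]])
  moreover have "\<forall>\<^sub>F s in at t. fourier_coeff (\<lambda>\<theta>. inverse (s - t) * (u s \<theta> - u t \<theta>)) n
      = (fourier_coeff (u s) n - fourier_coeff (u t) n) / of_real (s - t)"
    using Du(2)
  proof eventually_elim
    case (elim s)
    show ?case
      unfolding fourier_coeff_cmult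
        fourier_coeff_diff[OF sobolev_integrable[OF elim] sobolev_integrable[OF Du(1)]]
      by (simp add: divide_inverse mult.commute)
  qed
  ultimately show ?thesis by (rule Lim_transform_eventually)
qed

lemma Re_fourier_coeff_derivative:
  assumes t: "t \<in> I"
  shows "((\<lambda>t. Re (fourier_coeff (u t) n)) has_real_derivative Re (fourier_coeff (v t) n)) (at t)"
  using tendsto_Re[OF fourier_coeff_quotient_tendsto[OF t, of n]]
  by (simp add: has_field_derivative_iff flip: of_real_diff)

lemma Im_fourier_coeff_derivative:
  assumes t: "t \<in> I"
  shows "((\<lambda>t. Im (fourier_coeff (u t) n)) has_real_derivative Im (fourier_coeff (v t) n)) (at t)"
  using tendsto_Im[OF fourier_coeff_quotient_tendsto[OF t, of n]]
  by (simp add: has_field_derivative_iff flip: of_real_diff)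

text \<open>By symmetry, the increment of the quadratic form is the bilinear form of the difference
  and the sum of the two states; the quotient converges in the first argument and the sum in the
  second.\<close>

lemma energy_form_derivative:
  assumes t: "t \<in> I"
  shows "((\<lambda>t. energy_form (u t) (u t)) has_real_derivative 2 * energy_form (u t) (v t)) (at t)"
proof -
  note Du = sobolev_continuousD[OF sobolev_C1_continuous(1) t, unfolded at_within_open[OF t I]]
  note Dv = sobolev_continuousD[OF sobolev_C1_continuous(2) t]
  have sum: "\<forall>\<^sub>F s in at t. (\<lambda>\<theta>. u s \<theta> + u t \<theta>) \<in> sobolev 1 2"
    using Du(2) by eventually_elim (rule sobolev_add[OF _ Du(1)])
  have "((\<lambda>s. energy_form (\<lambda>\<theta>. inverse (s - t) * (u s \<theta> - u t \<theta>)) (\<lambda>\<theta>. u s \<theta> + u t \<theta>))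
      \<longlongrightarrow> energy_form (v t) (\<lambda>\<theta>. u t \<theta> + u t \<theta>)) (at t)"
    using Du(3)
    by (intro energy_form_tendsto[OF sobolev_C1_quotient(1)[OF t] Dv(1) sobolev_C1_quotient(2)[OF t]
          sum sobolev_add[OF Du(1) Du(1)]]) simp
  moreover have "energy_form (v t) (\<lambda>\<theta>. u t \<theta> + u t \<theta>) = 2 * energy_form (u t) (v t)"
    using energy_form_add_left[OF Du(1) Du(1) Dv(1)] by (simp add: energy_form_commute[of "v t"])
  moreover have "\<forall>\<^sub>F s in at t.
      energy_form (\<lambda>\<theta>. inverse (s - t) * (u s \<theta> - u t \<theta>)) (\<lambda>\<theta>. u s \<theta> + u t \<theta>)
      = (energy_form (u s) (u s) - energy_form (u t) (u t)) / (s - t)"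
    using Du(2)
  proof eventually_elim
    case (elim s)
    note ut = Du(1)
    have "energy_form x (\<lambda>\<theta>. u s \<theta> + u t \<theta>) = energy_form x (u s) + energy_form x (u t)"
      if "x \<in> sobolev 1 2" for x
      using energy_form_add_left[OF elim ut that] by (simp add: energy_form_commute[of x])
    then show ?case
      using energy_form_diff_left[OF elim ut sobolev_add[OF elim ut]] elim ut
        energy_form_cmult_left[OF sobolev_diff[OF elim ut] sobolev_add[OF elim ut], of "inverse (s - t)"]
      by (simp add: energy_form_commute[of "u t" "u s"] divide_inverse mult.commute)
  qed
  ultimately show ?thesis
    unfolding has_field_derivative_iff by (auto dest: Lim_transform_eventually)
qed

end

text \<open>Countably many test functions, \<open>n\<close> integer and
  \<open>c \<in> {1, \<i>}\<close>, share one exceptional null set. The coefficient at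
  \<open>0\<close> is free of conditions because a constant test function has zero derivative; for
  the others integrability of \<open>F t\<close> is a premise, established later only at times where
  \<open>h\<close> is near \<open>hbar\<close>.\<close>

lemma weak_form_fourier:
  fixes dth F :: "real \<Rightarrow> real \<Rightarrow> real"
  assumes p: "0 < p"
    and weak: "\<And>\<phi>. sobolev_Lp {0<..<T} 1 p \<phi> \<Longrightarrow>
      integrable (lebesgue_on {0<..<T}) (\<lambda>t. \<integral>\<theta>. dth t \<theta> * \<phi> t \<theta> \<partial>circle_measure) \<and>
      integrable (lebesgue_on {0<..<T})
        (\<lambda>t. \<integral>\<theta>. F t \<theta> * weak_deriv 1 (\<phi> t) \<theta> \<partial>circle_measure) \<and>
      (\<integral>t. (\<integral>\<theta>. dth t \<theta> * \<phi> t \<theta> \<partial>circle_measure) \<partial>lebesgue_on {0<..<T})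
        = (\<integral>t. (\<integral>\<theta>. F t \<theta> * weak_deriv 1 (\<phi> t) \<theta> \<partial>circle_measure) \<partial>lebesgue_on {0<..<T})"
    and dth: "\<And>t. t \<in> {0<..<T} \<Longrightarrow> integrable circle_measure (dth t)"
  shows "AE t in lebesgue_on {0<..<T}. fourier_coeff (dth t) 0 = 0 \<and>
    (integrable circle_measure (F t) \<longrightarrow>
      (\<forall>n. fourier_coeff (dth t) n = - \<i> * of_int n * fourier_coeff (F t) n))"
proof -
  let ?\<eta> = "\<lambda>c n \<theta>. Re (c * cis (of_int n * \<theta>))"
  have "AE t in lebesgue_on {0<..<T}. (\<integral>\<theta>. dth t \<theta> * ?\<eta> c n \<theta> \<partial>circle_measure)
     = (\<integral>\<theta>. F t \<theta> * weak_deriv 1 (?\<eta> c n) \<theta> \<partial>circle_measure)" for c n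
    by (rule weak_form_AE[OF weak sobolev_Re_cis[OF p]])
  then have "AE t in lebesgue_on {0<..<T}. \<forall>n. \<forall>c\<in>{1, \<i>}.
      (\<integral>\<theta>. dth t \<theta> * ?\<eta> c n \<theta> \<partial>circle_measure)
     = (\<integral>\<theta>. F t \<theta> * weak_deriv 1 (?\<eta> c n) \<theta> \<partial>circle_measure)"
    by (subst AE_all_countable, intro allI AE_ball_countable[THEN iffD2]) auto
  then show ?thesis using AE_space
  proof eventually_elim
    case (elim t)
    then have t: "t \<in> {0<..<T}" by simp
    have ae: "AE \<theta> in circle_measure. weak_deriv 1 (?\<eta> c n) \<theta> = ?\<eta> (\<i> * of_int n * c) n \<theta>" for c n
      by (rule AE_weak_deriv_eq[OF has_weak_deriv_Re_cis])
    have eq: "(\<integral>\<theta>. dth t \<theta> * ?\<eta> c n \<theta> \<partial>circle_measure)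
       = (\<integral>\<theta>. F t \<theta> * weak_deriv 1 (?\<eta> c n) \<theta> \<partial>circle_measure)" if "c \<in> {1, \<i>}" for c n
      using elim(1) that by blast
    have "Re (c * fourier_coeff (dth t) 0) = 0" if c: "c \<in> {1, \<i>}" for c
    proof -
      have "2 * pi * Re (c * fourier_coeff (dth t) (- 0))
          = (\<integral>\<theta>. F t \<theta> * weak_deriv 1 (?\<eta> c 0) \<theta> \<partial>circle_measure)"
        unfolding integral_mult_Re_cis[OF dth[OF t], symmetric] by (rule eq[OF c])
      also have "\<dots> = 0"
      proof (rule integral_eq_zero_AE)
        show "AE \<theta> in circle_measure. F t \<theta> * weak_deriv 1 (?\<eta> c 0) \<theta> = 0"
          using ae[of c 0] by eventually_elim simp
      qed
      finally show ?thesis by simp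
    qed
    from this[of 1] this[of \<i>] have "fourier_coeff (dth t) 0 = 0" by (simp add: complex_eq_iff)
    moreover have "fourier_coeff (dth t) n = - \<i> * of_int n * fourier_coeff (F t) n"
      if F: "integrable circle_measure (F t)" for n
    proof -
      have "Re (c * fourier_coeff (dth t) n) = Re (c * (- \<i> * of_int n * fourier_coeff (F t) n))"
        if c: "c \<in> {1, \<i>}" for c
      proof -
        have meas: "?\<eta> d (- n) \<in> borel_measurable circle_measure" for d
          by (intro measurable_circle_continuous continuous_intros)
        have wd: "weak_deriv 1 (?\<eta> c (- n)) \<in> borel_measurable circle_measure"
          using has_weak_deriv_weak_deriv[OF has_weak_deriv_Re_cis[of c "- n"]]
          by (auto simp: has_weak_deriv_def)
        have "2 * pi * Re (c * fourier_coeff (dth t) (- (- n)))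
            = (\<integral>\<theta>. F t \<theta> * weak_deriv 1 (?\<eta> c (- n)) \<theta> \<partial>circle_measure)"
          unfolding integral_mult_Re_cis[OF dth[OF t], symmetric] by (rule eq[OF c])
        also have "\<dots> = (\<integral>\<theta>. F t \<theta> * ?\<eta> (\<i> * of_int (- n) * c) (- n) \<theta> \<partial>circle_measure)"
        proof (rule integral_cong_AE)
          show "(\<lambda>\<theta>. F t \<theta> * weak_deriv 1 (?\<eta> c (- n)) \<theta>) \<in> borel_measurable circle_measure"
            by (rule borel_measurable_times[OF borel_measurable_integrable[OF F] wd])
          show "(\<lambda>\<theta>. F t \<theta> * ?\<eta> (\<i> * of_int (- n) * c) (- n) \<theta>) \<in> borel_measurable circle_measure"
            by (rule borel_measurable_times[OF borel_measurable_integrable[OF F] meas])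
          show "AE \<theta> in circle_measure. F t \<theta> * weak_deriv 1 (?\<eta> c (- n)) \<theta>
              = F t \<theta> * ?\<eta> (\<i> * of_int (- n) * c) (- n) \<theta>"
            using ae[of c "- n"] by eventually_elim simp
        qed
        also have "\<dots> = 2 * pi * Re (\<i> * of_int (- n) * c * fourier_coeff (F t) (- (- n)))"
          by (rule integral_mult_Re_cis[OF F])
        finally have "Re (c * fourier_coeff (dth t) n) = Re (\<i> * of_int (- n) * c * fourier_coeff (F t) n)"
          by simp
        then show ?thesis by (simp add: algebra_simps)
      qed
      from this[of 1] this[of \<i>] show ?thesis by (auto simp: complex_eq_iff)
    qed
    ultimately show ?case by blast
  qed
qed

section \<open>Distance to the first modes, and the initial data\<close>

lemma sobolev_norm_of_real:
  assumes w: "\<And>j. j \<le> k \<Longrightarrow> has_weak_deriv j w (g j)"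
  shows "sobolev_norm k p (\<lambda>\<theta>. complex_of_real (w \<theta>)) = sobolev_norm k p w"
proof -
  have "(\<integral>\<theta>. norm (weak_deriv j (\<lambda>\<theta>. complex_of_real (w \<theta>)) \<theta>) powr p \<partial>circle_measure)
      = (\<integral>\<theta>. norm (weak_deriv j w \<theta>) powr p \<partial>circle_measure)" if j: "j \<le> k" for j
  proof (rule integral_cong_AE)
    note wc = has_weak_deriv_of_real[OF w[OF j]]
    have "weak_deriv j w \<in> borel_measurable circle_measure"
      "weak_deriv j (\<lambda>\<theta>. complex_of_real (w \<theta>)) \<in> borel_measurable circle_measure"
      using has_weak_deriv_weak_deriv[OF w[OF j]] has_weak_deriv_weak_deriv[OF wc]
      by (simp_all add: has_weak_deriv_def borel_measurable_integrable)
    then show "(\<lambda>\<theta>. norm (weak_deriv j w \<theta>) powr p) \<in> borel_measurable circle_measure"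
      "(\<lambda>\<theta>. norm (weak_deriv j (\<lambda>\<theta>. complex_of_real (w \<theta>)) \<theta>) powr p)
        \<in> borel_measurable circle_measure"
      by measurable
    show "AE \<theta> in circle_measure. norm (weak_deriv j (\<lambda>\<theta>. complex_of_real (w \<theta>)) \<theta>) powr p
        = norm (weak_deriv j w \<theta>) powr p"
      using AE_weak_deriv_eq[OF w[OF j]] AE_weak_deriv_eq[OF wc]
      by eventually_elim simp
  qed
  then show ?thesis unfolding sobolev_norm_def by simp
qed

text \<open>For real \<open>f\<close> the complex expression \<open>first_modes\<close> is the mean
  plus the real \<open>first_mode\<close>, so the difference in the theorem is the
  remainder.\<close>

lemma sobolev_norm_minus_first_modes:
  assumes f: "f \<in> sobolev 1 2" and mean: "fourier_coeff f 0 = of_real hbar"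
  shows "sobolev_norm 1 2 (\<lambda>\<theta>. of_real (f \<theta>) - first_modes hbar f \<theta>)
    = sobolev_norm 1 2 (remainder f)"
proof -
  have "of_real (f \<theta>) - first_modes hbar f \<theta> = complex_of_real (remainder f \<theta>)" for \<theta>
  proof -
    have "complex_of_real (first_mode f \<theta>)
        = fourier_coeff f 1 * cis \<theta> + cnj (fourier_coeff f 1) * cis (- \<theta>)"
      by (simp add: complex_eq_iff)
    moreover have "fourier_coeff f (- 1) = cnj (fourier_coeff f 1)" by (rule fourier_coeff_minus)
    ultimately show ?thesis
      unfolding first_modes_def remainder_def mean
      by (simp add: cis_conv_exp)
  qed
  moreover have "sobolev_norm 1 2 (\<lambda>\<theta>. complex_of_real (remainder f \<theta>)) = sobolev_norm 1 2 (remainder f)"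
  proof (rule sobolev_norm_of_real)
    fix j :: nat assume "j \<le> 1"
    then show "has_weak_deriv j (remainder f) (if j = 0 then remainder f else remainder_deriv f)"
      using has_weak_deriv_remainder[OF f]
        has_weak_deriv_0[OF square_integrable_integrable[OF square_integrable_remainder(1)[OF f]]]
      by (cases "j = 0") (auto simp: le_Suc_eq)
  qed
  ultimately show ?thesis by simp
qed

text \<open>Neither the derivative nor the coefficient at \<open>1\<close> sees the constant
  \<open>m\<close>, and removing modes only decreases the norm of the derivative.\<close>

lemma initial_energy_bound:
  assumes f: "f \<in> sobolev 1 2"
  shows "energy f \<le> (sobolev_norm 1 2 (\<lambda>\<theta>. f \<theta> - m))\<^sup>2"
    and "norm (fourier_coeff f 1) \<le> sobolev_norm 1 2 (\<lambda>\<theta>. f \<theta> - m)"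
proof -
  note w = sobolev_weak_deriv[OF f order_refl]
  have wd: "has_weak_deriv 1 (\<lambda>\<theta>. f \<theta> - m) (weak_deriv 1 f)"
    using has_weak_deriv_diff[OF w(1) has_weak_deriv_1_const, of m] by (simp del: One_nat_def)
  have i: "integrable circle_measure (\<lambda>\<theta>. f \<theta> - m)"
    using sobolev_integrable[OF f] by simp
  note N = sobolev_norm_1[OF i wd]
  have "2 * energy f \<le> (\<integral>\<theta>. (remainder_deriv f \<theta>)\<^sup>2 \<partial>circle_measure)"
    unfolding energy_remainder[OF f] by simp
  also have "\<dots> \<le> (\<integral>\<theta>. (weak_deriv 1 f \<theta>)\<^sup>2 \<partial>circle_measure)"
    unfolding remainder_deriv_def integral_remove_first_mode[OF w(2)] by simp
  also have "\<dots> \<le> (sobolev_norm 1 2 (\<lambda>\<theta>. f \<theta> - m))\<^sup>2"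
    unfolding N by simp
  finally show "energy f \<le> (sobolev_norm 1 2 (\<lambda>\<theta>. f \<theta> - m))\<^sup>2"
    using energy_nonneg[OF f] by simp
  have "(\<lambda>\<theta>. f \<theta> - m) \<in> sobolev 1 2"
    using sobolev_diff[OF f sobolev_Re_cis[of 2 "of_real m" 0]] by simp
  from norm_fourier_coeff_le_sobolev[OF this, of 1]
  show "norm (fourier_coeff f 1) \<le> sobolev_norm 1 2 (\<lambda>\<theta>. f \<theta> - m)"
    by (simp add: fourier_coeff_diff[OF sobolev_integrable[OF f] integrable_circle_const]
        fourier_coeff_const del: One_nat_def)
qed

text \<open>The constant of \<open>dissipation_ge\<close> for the lower bound
  \<open>hbar / 2\<close> on the solution.\<close>

definition dissipation_const :: "real \<Rightarrow> real \<Rightarrow> real \<Rightarrow> real" where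
  "dissipation_const \<alpha> \<sigma> hbar = (hbar / 2) powr (\<alpha> + 2) * \<sigma> powr (\<alpha> - 1)"

text \<open>The constant of \<open>norm_fourier_coeff_flux\<close> for \<open>a = hbar / 2\<close>
  and \<open>b = 2 * hbar\<close>.\<close>

definition mode_speed_const :: "real \<Rightarrow> real \<Rightarrow> real \<Rightarrow> real" where
  "mode_speed_const \<alpha> \<sigma> hbar = (2 * hbar) powr (\<alpha> + 2) * (1 + \<sigma>\<^sup>2) powr ((\<alpha> - 1) / 2)
     * sqrt (2 * pi / dissipation_const \<alpha> \<sigma> hbar) + 1"

section \<open>A priori estimates along a solution\<close>

context
  fixes \<alpha> \<sigma> hbar T :: real and h dth :: "real \<Rightarrow> real \<Rightarrow> real"
  assumes \<alpha>: "1 < \<alpha>" and \<sigma>: "0 < \<sigma>" and hbar: "0 < hbar"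
    and sc: "sobolev_continuous {0..<T} 1 2 h"
    and C1: "sobolev_C1 {0<..<T} 4 2 h dth"
    and weak: "\<forall>\<phi>. sobolev_Lp {0<..<T} 1 (\<alpha> + 1) \<phi> \<longrightarrow>
        integrable (lebesgue_on {0<..<T}) (\<lambda>t. \<integral>\<theta>. dth t \<theta> * \<phi> t \<theta> \<partial>circle_measure) \<and>
        integrable (lebesgue_on {0<..<T})
          (\<lambda>t. \<integral>\<theta>. flux \<alpha> \<sigma> (h t) \<theta> * weak_deriv 1 (\<phi> t) \<theta> \<partial>circle_measure) \<and>
        (\<integral>t. (\<integral>\<theta>. dth t \<theta> * \<phi> t \<theta> \<partial>circle_measure) \<partial>lebesgue_on {0<..<T})
          = (\<integral>t. (\<integral>\<theta>. flux \<alpha> \<sigma> (h t) \<theta> * weak_deriv 1 (\<phi> t) \<theta> \<partial>circle_measure)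
              \<partial>lebesgue_on {0<..<T})"
    and mean0: "fourier_coeff (h 0) 0 = of_real hbar"
begin

lemma one_le_four: "(1::nat) \<le> 4"
  by simp

lemmas C1_continuous = sobolev_C1_continuous[OF C1 open_greaterThanLessThan one_le_four]

lemma solution_sobolev:
  "t \<in> {0..<T} \<Longrightarrow> h t \<in> sobolev 1 2"
  "t \<in> {0<..<T} \<Longrightarrow> h t \<in> sobolev 4 2"
  "t \<in> {0<..<T} \<Longrightarrow> dth t \<in> sobolev 4 2"
  using sc C1 unfolding sobolev_continuous_def sobolev_C1_def by blast+

lemma weak_form_solution:
  "AE t in lebesgue_on {0<..<T}. fourier_coeff (dth t) 0 = 0 \<and>
    (integrable circle_measure (flux \<alpha> \<sigma> (h t)) \<longrightarrow>
      (\<forall>n. fourier_coeff (dth t) n = - \<i> * of_int n * fourier_coeff (flux \<alpha> \<sigma> (h t)) n))"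
proof (rule weak_form_fourier[OF _ weak[rule_format]])
  show "0 < \<alpha> + 1" using \<alpha> by simp
  show "integrable circle_measure (dth t)" if "t \<in> {0<..<T}" for t
    by (rule sobolev_integrable[OF solution_sobolev(3)[OF that]])
qed

text \<open>The mean has zero speed at almost every time, hence by continuity at every time; this
  holds before any bound on \<open>h\<close> is known.\<close>

lemma solution_mean:
  assumes t: "t \<in> {0..<T}"
  shows "fourier_coeff (h t) 0 = of_real hbar"
proof (cases "t = 0")
  case False
  have zero: "fourier_coeff (dth s) 0 = 0" if s: "s \<in> {0<..<T}" for s
  proof -
    have "AE t in lebesgue_on {0<..<T}. t \<in> UNIV \<longrightarrow> norm (fourier_coeff (dth t) 0) \<le> 0"
      using weak_form_solution by eventually_elim simp
    then have "norm (fourier_coeff (dth s) 0) \<le> 0"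
      by (rule AE_continuous_le[OF _ open_UNIV
            continuous_on_norm[OF continuous_on_fourier_coeff[OF C1_continuous(2)]] UNIV_I s])
    then show ?thesis by simp
  qed
  have sub: "{0..t} \<subseteq> {0..<T}" using t by auto
  note cont = continuous_on_subset[OF continuous_on_fourier_coeff[OF sc] sub]
  have "Re (fourier_coeff (h t) 0) = Re (fourier_coeff (h 0) 0)"
  proof (rule DERIV_isconst_end[of 0 t "\<lambda>t. Re (fourier_coeff (h t) 0)"])
    fix s assume "0 < s" "s < t"
    then have s: "s \<in> {0<..<T}" using t by auto
    show "((\<lambda>t. Re (fourier_coeff (h t) 0)) has_real_derivative 0) (at s)"
      using Re_fourier_coeff_derivative[OF C1 open_greaterThanLessThan one_le_four s, of 0]
      by (simp add: zero[OF s])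
  qed (use False t in \<open>auto intro!: continuous_on_Re cont\<close>)
  moreover have "Im (fourier_coeff (h t) 0) = Im (fourier_coeff (h 0) 0)"
  proof (rule DERIV_isconst_end[of 0 t "\<lambda>t. Im (fourier_coeff (h t) 0)"])
    fix s assume "0 < s" "s < t"
    then have s: "s \<in> {0<..<T}" using t by auto
    show "((\<lambda>t. Im (fourier_coeff (h t) 0)) has_real_derivative 0) (at s)"
      using Im_fourier_coeff_derivative[OF C1 open_greaterThanLessThan one_le_four s, of 0]
      by (simp add: zero[OF s])
  qed (use False t in \<open>auto intro!: continuous_on_Im cont\<close>)
  ultimately show ?thesis using mean0 by (simp add: complex_eq_iff)
qed (simp add: mean0)

text \<open>Closeness to \<open>hbar\<close> is an open condition in time. The estimates hold almost
  everywhere on the open set \<open>U\<close> where it is satisfied, and continuity of all terms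
  carries them to \<open>t\<close>.\<close>

lemma solution_decay_estimates:
  assumes t: "t \<in> {0<..<T}"
    and near: "2 * norm (fourier_coeff (h t) 1)
      + sqrt (3 * inverse_square_sum) * sqrt (energy (h t)) < hbar / 2"
  shows "2 * energy_form (h t) (dth t) \<le> - (8 * dissipation_const \<alpha> \<sigma> hbar * energy (h t))"
    and "norm (fourier_coeff (dth t) 1) \<le> mode_speed_const \<alpha> \<sigma> hbar
      * (sqrt (- (2 * energy_form (h t) (dth t))) - 2 * energy_form (h t) (dth t))"
proof -
  let ?E = "\<lambda>t. energy (h t)" and ?E' = "\<lambda>t. 2 * energy_form (h t) (dth t)"
  let ?G = "\<lambda>t. 2 * norm (fourier_coeff (h t) 1) + sqrt (3 * inverse_square_sum) * sqrt (?E t)"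
  let ?\<kappa> = "dissipation_const \<alpha> \<sigma> hbar" and ?K = "mode_speed_const \<alpha> \<sigma> hbar"
  note contF = continuous_on_fourier_coeff[OF C1_continuous(1)]
    continuous_on_fourier_coeff[OF C1_continuous(2)]
  have contE: "continuous_on {0<..<T} ?E"
    unfolding energy_def
    by (intro continuous_intros continuous_on_energy_form C1_continuous contF)
  have contE': "continuous_on {0<..<T} ?E'"
    by (intro continuous_intros continuous_on_energy_form C1_continuous)
  have contG: "continuous_on {0<..<T} ?G"
    by (intro continuous_intros contE contF)
  define U where "U = {s\<in>{0<..<T}. ?G s \<in> {..<hbar / 2}}"
  have U: "open U"
    unfolding U_def
    using continuous_open_preimage[OF contG open_greaterThanLessThan open_lessThan, of "hbar / 2"]
    by (simp add: vimage_def Int_def)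
  have tU: "t \<in> U" using t near by (simp add: U_def)
  have AE: "AE s in lebesgue_on {0<..<T}. s \<in> U \<longrightarrow>
      ?E' s \<le> - (8 * ?\<kappa> * ?E s)
      \<and> norm (fourier_coeff (dth s) 1) \<le> ?K * (sqrt (- ?E' s) - ?E' s)"
    using weak_form_solution
  proof eventually_elim
    case (elim s)
    show ?case
    proof
      assume "s \<in> U"
      then have s: "s \<in> {0<..<T}" and G: "?G s < hbar / 2" by (auto simp: U_def)
      then have s': "s \<in> {0..<T}" by auto
      note h4 = solution_sobolev(2)[OF s]
      \<comment> \<open>The two-sided bounds on \<open>h\<close> are derived from the closeness
        condition and the conserved mean: the deviation is below \<open>hbar / 2\<close>.\<close>
      have ab: "AE \<theta> in circle_measure. hbar / 2 \<le> h s \<theta> \<and> h s \<theta> \<le> 2 * hbar"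
        using AE_deviation_bound[OF solution_sobolev(1)[OF s']]
      proof eventually_elim
        case (elim \<theta>)
        then have "\<bar>h s \<theta> - hbar\<bar> < hbar / 2"
          using G by (simp add: solution_mean[OF s'] del: One_nat_def)
        then have "hbar - hbar / 2 < h s \<theta>" "h s \<theta> < hbar + hbar / 2"
          unfolding abs_diff_less_iff by auto
        then show ?case using hbar by linarith
      qed
      have half: "0 < hbar / 2" using hbar by simp
      note Fl = \<alpha> \<sigma> half h4 ab
      define D where "D = (\<integral>\<theta>. velocity (h s) \<theta> * flux \<alpha> \<sigma> (h s) \<theta> \<partial>circle_measure)"
      have coeff: "fourier_coeff (dth s) n = - \<i> * of_int n * fourier_coeff (flux \<alpha> \<sigma> (h s)) n" for n
        using elim flux_integrable[OF Fl] by blast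
      have E': "?E' s = - D"
        unfolding D_def
        by (rule energy_form_dissipation[OF h4 solution_sobolev(3)[OF s] flux_integrable[OF Fl] coeff])
      have "?\<kappa> * (8 * ?E s) \<le> ?\<kappa> * (\<integral>\<theta>. (velocity (h s) \<theta>)\<^sup>2 \<partial>circle_measure)"
        using hbar \<sigma> by (intro mult_left_mono energy_le_velocity[OF h4])
          (simp add: dissipation_const_def)
      also have "\<dots> \<le> D"
        unfolding D_def dissipation_const_def by (rule dissipation_ge[OF Fl])
      finally have "?E' s \<le> - (8 * ?\<kappa> * ?E s)" unfolding E' by (simp add: mult_ac)
      moreover have "norm (fourier_coeff (dth s) 1) = norm (fourier_coeff (flux \<alpha> \<sigma> (h s)) 1)"
        unfolding coeff[of 1] by (simp add: norm_mult)
      moreover have "\<dots> \<le> ?K * (sqrt D + D)"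
        unfolding D_def mode_speed_const_def dissipation_const_def
        by (rule norm_fourier_coeff_flux[OF Fl])
      ultimately show "?E' s \<le> - (8 * ?\<kappa> * ?E s)
          \<and> norm (fourier_coeff (dth s) 1) \<le> ?K * (sqrt (- ?E' s) - ?E' s)"
        unfolding E' by simp
    qed
  qed
  have "?E' t + 8 * ?\<kappa> * ?E t \<le> 0"
  proof (rule AE_continuous_le[OF _ U _ tU t])
    show "AE s in lebesgue_on {0<..<T}. s \<in> U \<longrightarrow> ?E' s + 8 * ?\<kappa> * ?E s \<le> 0"
      using AE
    proof eventually_elim
      case (elim s)
      show ?case
      proof
        assume "s \<in> U"
        with elim have "?E' s \<le> - (8 * ?\<kappa> * ?E s)" by blast
        then have "?E' s + 8 * ?\<kappa> * ?E s \<le> - (8 * ?\<kappa> * ?E s) + 8 * ?\<kappa> * ?E s"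
          by (rule add_right_mono)
        then show "?E' s + 8 * ?\<kappa> * ?E s \<le> 0" by (simp only: left_minus)
      qed
    qed
    show "continuous_on {0<..<T} (\<lambda>s. ?E' s + 8 * ?\<kappa> * ?E s)"
      by (intro continuous_intros contE contE')
  qed
  then have "?E' t + 8 * ?\<kappa> * ?E t \<le> - (8 * ?\<kappa> * ?E t) + 8 * ?\<kappa> * ?E t"
    by (simp only: left_minus)
  then show "?E' t \<le> - (8 * ?\<kappa> * ?E t)" by (simp only: add_le_cancel_right)
  have "norm (fourier_coeff (dth t) 1) - ?K * (sqrt (- ?E' t) - ?E' t) \<le> 0"
  proof (rule AE_continuous_le[OF _ U _ tU t])
    show "AE s in lebesgue_on {0<..<T}. s \<in> U \<longrightarrow>
        norm (fourier_coeff (dth s) 1) - ?K * (sqrt (- ?E' s) - ?E' s) \<le> 0"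
      using AE by eventually_elim auto
    show "continuous_on {0<..<T} (\<lambda>s. norm (fourier_coeff (dth s) 1) - ?K * (sqrt (- ?E' s) - ?E' s))"
      by (intro continuous_intros contE' contF)
  qed
  then show "norm (fourier_coeff (dth t) 1) \<le> ?K * (sqrt (- ?E' t) - ?E' t)" by simp
qed

text \<open>The bootstrap with \<open>\<mu> = 4 * dissipation_const \<alpha> \<sigma> hbar\<close>,
  half the factor \<open>8\<close> in the decay estimate being given up, and with
  \<open>\<delta> = hbar / 2\<close> and \<open>S\<close> chosen so that its closeness condition is
  \<open>near\<close>.\<close>

lemma solution_energy_decay:
  fixes \<epsilon> :: real
  assumes \<epsilon>: "0 < \<epsilon>" "\<epsilon> \<le> 1"
    and init: "sobolev_norm 1 2 (\<lambda>\<theta>. h 0 \<theta> - hbar) \<le> \<epsilon>"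
    and small: "\<epsilon> * (4 * (1 + 3 * mode_speed_const \<alpha> \<sigma> hbar
        + mode_speed_const \<alpha> \<sigma> hbar / (2 * (4 * dissipation_const \<alpha> \<sigma> hbar)))
        + sqrt (3 * inverse_square_sum)) < hbar / 2"
    and t: "t \<in> {0..<T}"
  shows "energy (h t) \<le> \<epsilon>\<^sup>2 * exp (- (4 * dissipation_const \<alpha> \<sigma> hbar * t))"
proof (rule exponential_decay_bootstrap[where E = "\<lambda>t. energy (h t)"
      and z = "\<lambda>t. fourier_coeff (h t) 1" and E' = "\<lambda>t. 2 * energy_form (h t) (dth t)"
      and z' = "\<lambda>t. fourier_coeff (dth t) 1", OF _ _ _ _ _ _ _ _ _ \<epsilon> _ _ _ small t])
  note contF = continuous_on_fourier_coeff[OF sc]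
  show "continuous_on {0..<T} (\<lambda>t. energy (h t))"
    unfolding energy_def by (intro continuous_intros continuous_on_energy_form sc contF)
  show "continuous_on {0..<T} (\<lambda>t. fourier_coeff (h t) 1)" by (rule contF)
  fix s assume s: "s \<in> {0<..<T}"
  \<comment> \<open>The mean term of the energy is replaced by the constant
    \<open>pi * hbar\<^sup>2\<close>, with which it agrees on the whole time interval.\<close>
  have "((\<lambda>t. energy_form (h t) (h t) + pi * hbar\<^sup>2) has_real_derivative
      2 * energy_form (h s) (dth s)) (at s)"
    using DERIV_add[OF energy_form_derivative[OF C1 open_greaterThanLessThan one_le_four s]
        DERIV_const[of "pi * hbar\<^sup>2"]] by simp
  then show "((\<lambda>t. energy (h t)) has_real_derivative 2 * energy_form (h s) (dth s)) (at s)"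
  proof (rule has_field_derivative_transform_within_open[OF _ open_greaterThanLessThan s])
    fix r assume "r \<in> {0<..<T}"
    then have "fourier_coeff (h r) 0 = of_real hbar" by (intro solution_mean) auto
    then show "energy_form (h r) (h r) + pi * hbar\<^sup>2 = energy (h r)" by (simp add: energy_def)
  qed
  show "((\<lambda>t. Re (fourier_coeff (h t) 1)) has_real_derivative Re (fourier_coeff (dth s) 1)) (at s)"
    by (rule Re_fourier_coeff_derivative[OF C1 open_greaterThanLessThan one_le_four s])
  show "((\<lambda>t. Im (fourier_coeff (h t) 1)) has_real_derivative Im (fourier_coeff (dth s) 1)) (at s)"
    by (rule Im_fourier_coeff_derivative[OF C1 open_greaterThanLessThan one_le_four s])
  assume "2 * norm (fourier_coeff (h s) 1)
      + sqrt (3 * inverse_square_sum) * sqrt (energy (h s)) < hbar / 2"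
  from solution_decay_estimates[OF s this]
  show "2 * energy_form (h s) (dth s) \<le> - (2 * (4 * dissipation_const \<alpha> \<sigma> hbar) * energy (h s)) \<and>
      norm (fourier_coeff (dth s) 1) \<le> mode_speed_const \<alpha> \<sigma> hbar *
        (sqrt (- (2 * energy_form (h s) (dth s))) - 2 * energy_form (h s) (dth s))"
    by simp
next
  fix s assume "s \<in> {0..<T}"
  then show "0 \<le> energy (h s)" by (rule energy_nonneg[OF solution_sobolev(1)])
next
  have h0: "h 0 \<in> sobolev 1 2" using t by (intro solution_sobolev(1)) auto
  show "norm (fourier_coeff (h 0) 1) \<le> \<epsilon>"
    using initial_energy_bound(2)[OF h0, of hbar] init by linarith
  have "(sobolev_norm 1 2 (\<lambda>\<theta>. h 0 \<theta> - hbar))\<^sup>2 \<le> \<epsilon>\<^sup>2"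
    using init by (intro power_mono sobolev_norm_nonneg)
  then show "energy (h 0) \<le> \<epsilon>\<^sup>2" using initial_energy_bound(1)[OF h0, of hbar] by linarith
  show "0 < 4 * dissipation_const \<alpha> \<sigma> hbar" using hbar \<sigma> by (simp add: dissipation_const_def)
  then show "0 \<le> mode_speed_const \<alpha> \<sigma> hbar" by (simp add: mode_speed_const_def)
  show "0 \<le> sqrt (3 * inverse_square_sum)" by (simp add: inverse_square_sum_nonneg)
qed

end

section \<open>Choice of the constants and conclusion\<close>

lemma fourier_coeff_mean: "fourier_coeff f 0 = of_real (circle_mean f)"
  by (simp add: fourier_coeff_cis circle_mean_def)

theorem theorem3p5:
  fixes \<alpha> \<sigma> hbar :: real
  assumes "1 < \<alpha>" and "0 < \<sigma>" and "\<sigma> < 1" and "0 < hbar"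
  shows "\<exists>\<epsilon>0>0. \<exists>c>0. \<exists>C>0. \<forall>\<epsilon> h0 h.
    0 < \<epsilon> \<and> \<epsilon> < \<epsilon>0 \<longrightarrow>
    h0 \<in> sobolev 1 2 \<and> continuous_on UNIV h0 \<and> (\<forall>\<theta>. 0 < h0 \<theta>) \<longrightarrow>
    circle_mean h0 = hbar \<longrightarrow>
    sobolev_norm 1 2 (\<lambda>\<theta>. h0 \<theta> - hbar) \<le> \<epsilon> \<longrightarrow>
    is_solution_past_t_star \<alpha> \<sigma> hbar h0 h \<longrightarrow>
    (\<forall>tbar\<ge>0. ereal tbar \<le> t_star \<alpha> \<sigma> hbar h0 \<longrightarrow>
       C_H1_norm (tbar / 4) tbar (\<lambda>t \<theta>. of_real (h t \<theta>) - first_modes hbar (h t) \<theta>)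
         \<le> ereal (C * Lambda \<alpha> c \<epsilon> tbar))"
proof -
  define \<kappa> where "\<kappa> = dissipation_const \<alpha> \<sigma> hbar"
  define M where "M = 4 * (1 + 3 * mode_speed_const \<alpha> \<sigma> hbar
      + mode_speed_const \<alpha> \<sigma> hbar / (2 * (4 * \<kappa>))) + sqrt (3 * inverse_square_sum)"
  \<comment> \<open>The second entry gives \<open>\<epsilon> * M < hbar / 2\<close>, the smallness
    required by the bootstrap; the cap at \<open>1\<close> serves both the bootstrap and
    \<open>Lambda_ge_exp\<close>.\<close>
  define \<epsilon>0 where "\<epsilon>0 = min 1 (hbar / 2 / M)"
  have \<kappa>: "\<kappa> > 0" using assms by (simp add: \<kappa>_def dissipation_const_def)
  then have "0 \<le> mode_speed_const \<alpha> \<sigma> hbar" by (simp add: mode_speed_const_def \<kappa>_def)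
  then have M: "M > 0"
    using \<kappa> inverse_square_sum_nonneg unfolding M_def by (intro add_pos_nonneg mult_pos_pos) auto
  have \<epsilon>0: "\<epsilon>0 > 0" using M assms by (simp add: \<epsilon>0_def)
  \<comment> \<open>The energy decays at rate \<open>4 * \<kappa>\<close>, the norm at rate
    \<open>2 * \<kappa>\<close>, and \<open>t \<ge> tbar / 4\<close> leaves
    \<open>\<kappa> / 2\<close> in terms of \<open>tbar\<close>; \<open>Lambda_ge_exp\<close>
    multiplies by \<open>\<alpha> - 1\<close>.\<close>
  have c: "\<kappa> / 2 * (\<alpha> - 1) > 0" using \<kappa> assms by simp
  have main: "C_H1_norm (tbar / 4) tbar (\<lambda>t \<theta>. of_real (h t \<theta>) - first_modes hbar (h t) \<theta>)
      \<le> ereal (2 * Lambda \<alpha> (\<kappa> / 2 * (\<alpha> - 1)) \<epsilon> tbar)"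
    if \<epsilon>: "0 < \<epsilon>" "\<epsilon> < \<epsilon>0" and mean: "circle_mean h0 = hbar"
      and init: "sobolev_norm 1 2 (\<lambda>\<theta>. h0 \<theta> - hbar) \<le> \<epsilon>"
      and past: "is_solution_past_t_star \<alpha> \<sigma> hbar h0 h"
      and tbar: "0 \<le> tbar" "ereal tbar \<le> t_star \<alpha> \<sigma> hbar h0"
    for \<epsilon> h0 h tbar
  proof -
    \<comment> \<open>A solution interval reaching strictly beyond \<open>tbar\<close>, so that
      \<open>[tbar / 4, tbar]\<close> lies in the half-open interval \<open>[0, T)\<close>. If
      \<open>t_star\<close> is infinite, \<open>tbar + 1\<close> serves.\<close>
    obtain T where T: "tbar < T" and sol: "is_solution \<alpha> \<sigma> h0 T h"
    proof (cases "t_star \<alpha> \<sigma> hbar h0 = \<infinity>")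
      case True
      then have "is_solution \<alpha> \<sigma> h0 (tbar + 1) h"
        using past tbar(1) by (simp add: is_solution_past_t_star_def)
      then show thesis by (rule that[rotated]) simp
    next
      case False
      then obtain T where "t_star \<alpha> \<sigma> hbar h0 < ereal T" "is_solution \<alpha> \<sigma> h0 T h"
        using past by (auto simp: is_solution_past_t_star_def)
      then show thesis using tbar(2) by (intro that[of T]) (auto dest: order.strict_trans1)
    qed
    have sc: "sobolev_continuous {0..<T} 1 2 h" and h0: "h 0 = h0"
      using sol by (simp_all add: is_solution_def)
    obtain dth where C1: "sobolev_C1 {0<..<T} 4 2 h dth"
      and weak: "\<forall>\<phi>. sobolev_Lp {0<..<T} 1 (\<alpha> + 1) \<phi> \<longrightarrow>
        integrable (lebesgue_on {0<..<T}) (\<lambda>t. \<integral>\<theta>. dth t \<theta> * \<phi> t \<theta> \<partial>circle_measure) \<and>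
        integrable (lebesgue_on {0<..<T})
          (\<lambda>t. \<integral>\<theta>. flux \<alpha> \<sigma> (h t) \<theta> * weak_deriv 1 (\<phi> t) \<theta> \<partial>circle_measure) \<and>
        (\<integral>t. (\<integral>\<theta>. dth t \<theta> * \<phi> t \<theta> \<partial>circle_measure) \<partial>lebesgue_on {0<..<T})
          = (\<integral>t. (\<integral>\<theta>. flux \<alpha> \<sigma> (h t) \<theta> * weak_deriv 1 (\<phi> t) \<theta> \<partial>circle_measure)
              \<partial>lebesgue_on {0<..<T})"
      using sol unfolding is_solution_def by blast
    have mean0: "fourier_coeff (h 0) 0 = of_real hbar"
      by (simp add: h0 mean fourier_coeff_mean)
    note ctx = assms(1,2,4) sc C1 weak mean0
    have "\<epsilon> * M < hbar / 2" using \<epsilon> M by (simp add: \<epsilon>0_def field_simps)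
    then have energy: "energy (h t) \<le> \<epsilon>\<^sup>2 * exp (- (4 * \<kappa> * t))" if "t \<in> {0..<T}" for t
      unfolding \<kappa>_def M_def using \<epsilon> init that
      by (intro solution_energy_decay[OF ctx]) (simp_all add: h0 \<epsilon>0_def)
    have bound: "sobolev_norm 1 2 (\<lambda>\<theta>. of_real (h t \<theta>) - first_modes hbar (h t) \<theta>)
        \<le> 2 * Lambda \<alpha> (\<kappa> / 2 * (\<alpha> - 1)) \<epsilon> tbar" if t: "t \<in> {tbar / 4..tbar}" for t
    proof -
      have t': "t \<in> {0..<T}" using t tbar(1) T by auto
      have ht: "h t \<in> sobolev 1 2" by (rule solution_sobolev(1)[OF ctx t'])
      have "sobolev_norm 1 2 (\<lambda>\<theta>. of_real (h t \<theta>) - first_modes hbar (h t) \<theta>)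
          = sobolev_norm 1 2 (remainder (h t))"
        by (rule sobolev_norm_minus_first_modes[OF ht solution_mean[OF ctx t']])
      also have "\<dots> \<le> 2 * sqrt (energy (h t))" by (rule sobolev_norm_remainder[OF ht])
      also have "\<dots> \<le> 2 * sqrt (\<epsilon>\<^sup>2 * exp (- (4 * \<kappa> * t)))"
        using energy[OF t'] by simp
      also have "\<epsilon>\<^sup>2 * exp (- (4 * \<kappa> * t)) = (\<epsilon> * exp (- (2 * \<kappa> * t)))\<^sup>2"
        by (simp add: power_mult_distrib flip: exp_double)
      also have "2 * sqrt \<dots> = 2 * (\<epsilon> * exp (- (2 * \<kappa> * t)))" using \<epsilon> by simp
      also have "\<dots> \<le> 2 * (\<epsilon> * exp (- (\<kappa> / 2 * tbar)))"
      proof -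
        have "\<kappa> * tbar \<le> \<kappa> * (4 * t)" using t \<kappa> by (intro mult_left_mono) auto
        then show ?thesis using \<epsilon> by simp
      qed
      also have "\<dots> \<le> 2 * Lambda \<alpha> (\<kappa> / 2 * (\<alpha> - 1)) \<epsilon> tbar"
        using Lambda_ge_exp[OF assms(1) tbar(1) \<epsilon>(1), of "\<kappa> / 2"] \<epsilon>(2) \<kappa> by (simp add: \<epsilon>0_def)
      finally show ?thesis .
    qed
    show ?thesis
      unfolding C_H1_norm_def using bound by (intro SUP_least) simp
  qed
  show ?thesis
    by (intro exI[of _ \<epsilon>0] exI[of _ "\<kappa> / 2 * (\<alpha> - 1)"] exI[of _ 2] conjI \<epsilon>0 c allI impI main; simp)
qed

end
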